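(* Let $\Gamma=\langle x,\gamma\rangle\le W$ be the Gupta–Sidki group, where $x$ is the rigid $3$-cycle and $\gamma=(\gamma,x,x^{-1})$. Let $U=\langle\Delta^n(x):n\ge1\rangle$ and $V=\{1,\tau_1,\tau_2,\tau_3\}$ with $\tau_1=\Delta(\tau_1)t$, $\tau_2=\Delta(\tau_3)$, $\tau_3=\Delta(\tau_2)t$, so that $\mathrm{Aut}(\Gamma)=\Gamma:U:V$ as a subgroup of $W$. Set $T=\langle\partial\Delta^{2n+1}(x):n\ge0\rangle$, a countably infinite elementary abelian $3$-group. Then $\mathrm{Aut}^2(\Gamma)=\mathrm{Aut}(\Gamma):T$ (split extension), $T$ centralizes $U$ and $V$, and $\mathrm{Aut}^3(\Gamma)=\mathrm{Aut}^2(\Gamma)$. In particular $\Gamma$ has height $2$.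
   Context: $W$ is the isometry group of the ternary rooted tree $X^*$, $X=\{0,1,2\}$. Elements are written $(g_0,g_1,g_2)\pi$ with $\pi\in\mathrm{Sym}(X)$, meaning $(yw)^{(g_0,g_1,g_2)\pi}=y^\pi w^{g_y}$. $x$ is the isometry $(1,1,1)(0\,1\,2)$ and $t=(1,1,1)(1\,2)$. For $g\in W$: $\Delta g=(g,g,g)$, $\partial g=(1,g,g^{-1})$, and iterates $\Delta^n$, $\partial\Delta^{n}g=\partial(\Delta^n g)$. The automorphism tower $\mathrm{Aut}^i(\Gamma)$ is realized inside $W$ as the normalizer tower of $\Gamma$ in $W$ (automorphisms acting by conjugation); in particular $\mathrm{Aut}(\Gamma)$ is the subgroup $\Gamma UV$ of $W$. $A:B$ denotes a split extension of $A$ by $B$. The height is the least $\alpha$ with $\mathrm{Aut}^\alpha=\mathrm{Aut}^{\alpha+1}$. *)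

theory Defs
  imports "HOL-Algebra.Group_Action" "HOL-Algebra.Generated_Groups" "HOL-Library.Sublist" "HOL-Library.Countable_Set"
begin

text \<open>The alphabet X = {0,1,2} and the ternary rooted tree X* (vertices = words).\<close>
datatype tri = T0 | T1 | T2

type_synonym isom = "tri list \<Rightarrow> tri list"

definition W :: "isom set" where
  "W = {f. bij f \<and> (\<forall>u. length (f u) = length u) \<and>
           (\<forall>u v. prefix u v \<longrightarrow> prefix (f u) (f v))}"

text \<open>Right actions: (v)^(g h) = ((v)^g)^h, so the product g h is the function h \<circ> g.\<close>
definition W_grp :: "isom monoid" where
  "W_grp = \<lparr>carrier = W, monoid.mult = (\<lambda>g h. h \<circ> g), one = id\<rparr>"

text \<open>The element (g_0,g_1,g_2)\<pi>: (y w)^(...) = y^\<pi> w^(g_y).\<close>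
fun wr :: "(tri \<Rightarrow> isom) \<Rightarrow> (tri \<Rightarrow> tri) \<Rightarrow> isom" where
  "wr gs \<pi> [] = []"
| "wr gs \<pi> (y # w) = \<pi> y # gs y w"

fun rot :: "tri \<Rightarrow> tri" where
  "rot T0 = T1" | "rot T1 = T2" | "rot T2 = T0"

fun sw :: "tri \<Rightarrow> tri" where
  "sw T0 = T0" | "sw T1 = T2" | "sw T2 = T1"

definition xx :: isom where "xx = wr (\<lambda>_. id) rot"
definition tt :: isom where "tt = wr (\<lambda>_. id) sw"

definition Delta :: "isom \<Rightarrow> isom" where "Delta g = wr (\<lambda>_. g) id"
definition partial :: "isom \<Rightarrow> isom" where
  "partial g = wr (\<lambda>y. case y of T0 \<Rightarrow> id | T1 \<Rightarrow> g | T2 \<Rightarrow> inv_into UNIV g) id"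

fun gam :: isom where
  "gam [] = []"
| "gam (T0 # w) = T0 # gam w"
| "gam (T1 # w) = T1 # xx w"
| "gam (T2 # w) = T2 # inv_into UNIV xx w"

fun tau1 :: isom where
  "tau1 [] = []"
| "tau1 (y # w) = sw y # tau1 w"

fun tau2 :: isom and tau3 :: isom where
  "tau2 [] = []"
| "tau2 (y # w) = y # tau3 w"
| "tau3 [] = []"
| "tau3 (y # w) = sw y # tau2 w"

definition Gamma :: "isom set" where "Gamma = generate W_grp {xx, gam}"
definition UU :: "isom set" where "UU = generate W_grp {(Delta ^^ n) xx | n. n \<ge> 1}"
definition VV :: "isom set" where "VV = {id, tau1, tau2, tau3}"
definition TT :: "isom set" where
  "TT = generate W_grp {partial ((Delta ^^ (2*n+1)) xx) | n. True}"

text \<open>Automorphism tower realised as normalizer tower of \<Gamma> in W.\<close>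
fun AutT :: "nat \<Rightarrow> isom set" where
  "AutT 0 = Gamma"
| "AutT (Suc n) = normalizer W_grp (AutT n)"

definition height :: nat where "height = (LEAST n. AutT n = AutT (Suc n))"

end

theory Submission
  imports Defs "HOL-Computational_Algebra.Polynomial"
begin

text \<open>
  \<open>\<Gamma>\<close> is recognised inside \<open>W\<close> by a branch criterion: \<open>g = (g\<^sub>0, g\<^sub>1, g\<^sub>2) x\<^sup>k\<close> lies in \<open>\<Gamma>\<close> iff all
  \<open>g\<^sub>i\<close> do and their exponents satisfy \<open>e(g\<^sub>i) = a(g\<^bsub>i-1\<^esub>) - a(g\<^bsub>i+1\<^esub>)\<close> modulo 3, where \<open>(e, a)\<close> is the
  abelianization (exponents of \<open>x\<close> and \<open>\<gamma>\<close>). An element \<open>h\<close> normalizing \<open>\<Gamma>\<close> and acting trivially on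
  the abelianization has sections with the same two properties, all congruent modulo \<open>\<Gamma>\<close>, and
  \<open>h\<close> lies in \<open>\<Gamma> U\<close> as soon as one of its sections does; counting the letters \<open>\<gamma>\<close> in \<open>\<gamma>\<^sup>h\<close>, and
  then in \<open>x\<^sup>h\<close> once \<open>\<gamma>\<^sup>h = \<gamma>\<close>, gives a descent along sections, whence \<open>N(\<Gamma>) = \<Gamma> U V\<close>.
  The group generated by all \<open>\<Delta>\<^sup>i(x)\<close> is the additive group of polynomials over the field with
  three elements. If \<open>h\<close> has trivial root permutation and \<open>x\<^sup>h \<in> \<Gamma> U\<close>, the branch criterion forces
  \<open>h = \<Delta>(h\<^sub>0) \<eta> \<partial>(p)\<close> with \<open>\<eta> \<in> \<Gamma> U\<close> and a polynomial \<open>p\<close>. Conjugating \<open>\<gamma>\<close> controls \<open>h\<^sub>0\<close>, and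
  conjugating \<open>\<tau>\<^sub>2\<close> shows that \<open>p\<close> is odd, both for the second and for the third normalizer.
\<close>

text \<open>The recurring obstacle is to know that \<open>x\<^sup>h\<close> lies in \<Gamma>U when h
  normalizes a larger group. Inside Aut(\<Gamma>), the subgroup \<Gamma>U is cut out by two sign
  characters defined on all of W, so whatever normalizes Aut(\<Gamma>) also normalizes \<Gamma>U.
  Inside Aut(\<Gamma>)T the same characters cut out only \<Gamma>UT, and the T-part of
  \<open>x\<^sup>h\<close> has to be excluded separately, by way of \<open>\<gamma>\<^sup>h\<close>
  and of a commutator with \<open>tau_1\<close>. A second obstacle is that \<Delta>(k) can leave
  Aut(\<Gamma>) for k in Aut(\<Gamma>), though only by the rigid transposition t; this is excluded
  because t conjugates \<gamma> out of Aut(\<Gamma>)T. The operator \<partial> enters through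
  characteristic 3: the sections of x conjugated by \<partial>(p) are p, -2p and p, hence equal, so
  \<partial>(p) normalizes \<Gamma>U for every polynomial p. Oddness of p is exactly the condition
  that \<partial>(p) commutes with V.\<close>

text \<open>With the alphabet as the field with three elements, every permutation of it is affine.\<close>
instantiation tri :: comm_ring_1
begin
definition "0 = T0"
definition "1 = T1"
fun plus_tri where
  "T0 + y = (y::tri)" | "T1 + y = rot y" | "T2 + y = rot (rot y)"
definition "- y = sw y"
definition "x - y = x + sw (y::tri)"
fun times_tri where
  "T0 * y = (T0::tri)" | "T1 * y = y" | "T2 * y = sw y"
instance
proof
  fix a b c :: tri
  show "a * b * c = a * (b * c)" by (cases a; cases b; cases c; simp)
  show "a * b = b * a" by (cases a; cases b; simp)
  show "1 * a = a" by (simp add: one_tri_def)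
  show "a + b + c = a + (b + c)" by (cases a; cases b; cases c; simp)
  show "a + b = b + a" by (cases a; cases b; simp)
  show "0 + a = a" by (simp add: zero_tri_def)
  show "- a + a = 0" by (cases a; simp add: zero_tri_def uminus_tri_def)
  show "a - b = a + - b" by (simp add: minus_tri_def uminus_tri_def)
  show "(a + b) * c = a * c + b * c" by (cases a; cases b; cases c; simp)
  show "(0::tri) \<noteq> 1" by (simp add: zero_tri_def one_tri_def)
qed
end

lemmas tri_eval = zero_tri_def one_tri_def uminus_tri_def minus_tri_def

lemma tri_const: "T0 = 0" "T1 = 1" "T2 = -1"
  by (simp_all add: tri_eval)

lemma tri_add_self: "a + a = - (a::tri)"
  by (cases a; simp add: tri_eval)

lemma tri_cases: "y = 0 \<or> y = 1 \<or> y = (-1::tri)"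
  by (cases y; simp add: tri_eval)

lemma tri_neq [simp]: "(0::tri) \<noteq> -1" "(-1::tri) \<noteq> 0" "(1::tri) \<noteq> -1" "(-1::tri) \<noteq> 1"
  by (simp_all add: tri_eval)

lemma all_tri: "(\<forall>y::tri. P y) \<longleftrightarrow> P 0 \<and> P 1 \<and> P (-1)"
  by (metis tri_cases)

lemma UNIV_tri: "(UNIV :: tri set) = {T0, T1, T2}"
  using tri.exhaust by blast

lemma finite_tri: "finite (A :: tri set)"
  by (rule finite_subset[of _ UNIV]) (simp, simp add: UNIV_tri)

lemma rot_eq: "rot y = y + 1" by (cases y; simp add: tri_eval)
lemma sw_eq: "sw y = - y" by (simp add: tri_eval)

lemma tri_inj_affine:
  fixes f :: "tri \<Rightarrow> tri"
  assumes "inj f"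
  shows "f y = f 0 + (f 1 - f 0) * y" and "f 1 - f 0 = 1 \<or> f 1 - f 0 = -1"
proof -
  have d: "f T0 \<noteq> f T1" "f T0 \<noteq> f T2" "f T1 \<noteq> f T2"
    using assms by (auto dest!: injD)
  then show "f y = f 0 + (f 1 - f 0) * y"
    by (cases y; cases "f T0"; cases "f T1"; cases "f T2"; simp add: tri_eval)
  show "f 1 - f 0 = 1 \<or> f 1 - f 0 = -1"
    using d by (cases "f T0"; cases "f T1"; simp add: tri_eval)
qed

section \<open>Isometries as elements of a type\<close>

text \<open>A type makes the group laws unconditional rewrite rules; membership in \<open>W\<close>
  is checked only when an element is built. The product keeps the order of right actions, as in
  \<open>W_grp\<close>.\<close>

typedef tree_iso = W morphisms app Aut
proof
  show "id \<in> W" by (simp add: W_def)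
qed

lemma W_id: "id \<in> W" by (simp add: W_def)

lemma W_comp: "f \<in> W \<Longrightarrow> g \<in> W \<Longrightarrow> g \<circ> f \<in> W"
  by (auto simp: W_def intro: bij_comp)

lemma W_inv:
  assumes "f \<in> W" shows "inv_into UNIV f \<in> W"
proof -
  let ?i = "inv_into UNIV f"
  have b: "bij f" and l: "\<And>u. length (f u) = length u"
    and p: "\<And>u v. prefix u v \<Longrightarrow> prefix (f u) (f v)" using assms by (auto simp: W_def)
  have fi: "f (?i u) = u" for u using b by (simp add: bij_is_surj surj_f_inv_f)
  have li: "length (?i u) = length u" for u by (metis fi l)
  have "prefix (?i u) (?i v)" if "prefix u v" for u v
  proof -
    \<comment> \<open>The image of this prefix of \<open>?i v\<close> and \<open>u\<close> are
      prefixes of \<open>v\<close> of equal length, hence equal; so \<open>w\<close> is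
      \<open>?i u\<close>.\<close>
    define w where "w = take (length u) (?i v)"
    have pw: "prefix (f w) v" by (metis fi p take_is_prefix w_def)
    have "length (f w) = length u" using that by (simp add: w_def l li prefix_length_le)
    then have "f w = u" using pw that by (metis prefix_length_prefix prefix_order.antisym le_refl)
    then have "?i u = w" using b by (metis bij_inv_eq_iff)
    then show ?thesis by (simp add: w_def take_is_prefix)
  qed
  then show ?thesis using b li by (simp add: W_def bij_imp_bij_inv)
qed

setup_lifting type_definition_tree_iso

instantiation tree_iso :: "{one, times, inverse}"
begin
lift_definition one_tree_iso :: tree_iso is id by (rule W_id)
lift_definition times_tree_iso :: "tree_iso \<Rightarrow> tree_iso \<Rightarrow> tree_iso" is "\<lambda>f g. g \<circ> f" by (rule W_comp)
lift_definition inverse_tree_iso :: "tree_iso \<Rightarrow> tree_iso" is "inv_into UNIV" by (rule W_inv)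
definition "divide_tree_iso (g::tree_iso) h = g * inverse h"
instance ..
end

instance tree_iso :: monoid_mult
  by standard (transfer, auto)+

lemma inverse_left [simp]: "inverse g * g = (1::tree_iso)"
  by transfer (simp add: W_def bij_is_surj fun_eq_iff surj_f_inv_f)

lemma inverse_right [simp]: "g * inverse g = (1::tree_iso)"
  by transfer (simp add: W_def bij_is_inj)

interpretation tree_iso: Groups.group "(*)" "1 :: tree_iso" inverse
  by standard simp_all

lemmas tree_iso_group [simp] = tree_iso.inverse_inverse tree_iso.inverse_neutral tree_iso.inverse_distrib_swap
lemma inverse_cancel [simp]: "inverse g * (g * h) = h" "g * (inverse g * h) = (h::tree_iso)"
  by (simp_all flip: mult.assoc)

lemma tree_iso_eq_iff: "g = h \<longleftrightarrow> inverse g * h = (1::tree_iso)"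
  by (metis tree_iso.inverse_unique tree_iso.inverse_inverse inverse_left)

lemma tree_iso_left_cancel [simp]: "g * h = g * k \<longleftrightarrow> h = (k::tree_iso)" "h * g = k * g \<longleftrightarrow> h = k"
  by (metis inverse_cancel(1)) (metis inverse_right mult.assoc mult.right_neutral)

subsection \<open>Root permutation and sections\<close>

definition root_perm :: "tree_iso \<Rightarrow> tri \<Rightarrow> tri" where "root_perm g y = hd (app g [y])"
definition sec :: "tree_iso \<Rightarrow> tri \<Rightarrow> tree_iso" where "sec g y = Aut (\<lambda>w. tl (app g (y # w)))"

lemma app_W: "bij (app g)" "length (app g u) = length u" "prefix u v \<Longrightarrow> prefix (app g u) (app g v)"
  using app[of g] by (auto simp: W_def)

lemma app_Nil [simp]: "app g [] = []"
  using app_W(2)[of g "[]"] by simp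

lemma app_hd: "app g (y # w) = root_perm g y # tl (app g (y # w))"
proof -
  have "prefix (app g [y]) (app g (y # w))" by (intro app_W) simp
  moreover have "length (app g [y]) = 1" by (simp add: app_W)
  ultimately show ?thesis
    by (auto simp: root_perm_def length_Suc_conv prefix_def)
qed

lemma inj_root_perm: "inj (root_perm g)"
proof -
  have "\<exists>z. root_perm g z = y" for y
  proof -
    obtain v where v: "app g v = [y]" using app_W(1)[of g] by (metis bij_pointE)
    then have "length v = 1" using app_W(2)[of g v] by simp
    then obtain z where "v = [z]" by (metis length_0_conv length_Suc_conv One_nat_def)
    then show ?thesis using v by (auto simp: root_perm_def intro!: exI[of _ z])
  qed
  then have "surj (root_perm g)" by (metis surj_def)
  then show ?thesis using finite_UNIV_surj_inj finite_tri by blast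
qed

lemma section_W: "(\<lambda>w. tl (app g (y # w))) \<in> W" (is "?f \<in> W")
proof -
  have "inj ?f"
  proof
    fix u v assume "?f u = ?f v"
    then have "app g (y # u) = app g (y # v)" by (metis app_hd)
    then show "u = v" using app_W(1)[of g] by (metis bij_is_inj injD list.inject)
  qed
  moreover have "\<exists>u. ?f u = w" for w
  proof -
    obtain v where v: "app g v = root_perm g y # w" using app_W(1)[of g] by (metis bij_pointE)
    then obtain z u where zu: "v = z # u" by (cases v) auto
    then have "root_perm g z = root_perm g y" using v app_hd[of g z u] by simp
    then have "z = y" using inj_root_perm by (metis injD)
    then have "app g (y # u) = root_perm g y # w" using v zu by simp
    then show ?thesis by (metis list.sel(3))
  qed
  moreover have "prefix (?f u) (?f v)" if "prefix u v" for u v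
  proof -
    have "prefix (app g (y # u)) (app g (y # v))" using that by (intro app_W) simp
    then show ?thesis by (subst (asm) (1 2) app_hd) simp
  qed
  ultimately show ?thesis by (auto simp: W_def bij_def app_W surj_def) metis
qed

lemma app_Cons [simp]: "app g (y # w) = root_perm g y # app (sec g y) w"
  by (subst app_hd) (simp add: sec_def Aut_inverse section_W)

text \<open>Induction on words: root permutations determine the letters one by one. This form suits
  elements that occur among their own sections, where comparing sections once does not end.\<close>

lemma tree_iso_coinduct [consumes 1, case_names root_perm sec]:
  assumes "R g h" and "\<And>g h y. R g h \<Longrightarrow> root_perm g y = root_perm h y"
    and "\<And>g h y. R g h \<Longrightarrow> R (sec g y) (sec h y)"
  shows "g = h"
proof -
  have "app g w = app h w" if "R g h" for g h w
    using that by (induction w arbitrary: g h) (auto simp: assms)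
  then show ?thesis using assms(1) by (metis app_inject ext)
qed

lemma tree_iso_eqI: "(\<And>y. root_perm g y = root_perm h y) \<Longrightarrow> (\<And>y. sec g y = sec h y) \<Longrightarrow> g = h"
  by (rule tree_iso_coinduct[of "\<lambda>a b. a = g \<and> b = h \<or> a = b"]) auto

lemma app_one: "app 1 = id" by (rule one_tree_iso.rep_eq)
lemma app_mult: "app (g * h) = app h \<circ> app g" by (rule times_tree_iso.rep_eq)
lemma app_inverse: "app (inverse g) = inv_into UNIV (app g)" by (rule inverse_tree_iso.rep_eq)

lemma root_perm_unique: "app g [y] = [z] \<Longrightarrow> root_perm g y = z"
  by simp

lemma root_perm_one [simp]: "root_perm 1 y = y"
  by (rule root_perm_unique) (simp only: app_one id_apply)

lemma root_perm_mult [simp]: "root_perm (g * h) y = root_perm h (root_perm g y)"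
  by (rule root_perm_unique) (simp only: app_mult o_apply, simp)

lemma sec_unique: "(\<And>w. app g (y # w) = z # app h w) \<Longrightarrow> sec g y = h"
  by (simp add: app_inject[symmetric] fun_eq_iff)

lemma sec_one [simp]: "sec 1 y = 1" by (rule sec_unique[where z = y]) (simp only: app_one id_apply)
lemma sec_mult [simp]: "sec (g * h) y = sec g y * sec h (root_perm g y)"
  by (rule sec_unique[where z = "root_perm h (root_perm g y)"]) (simp only: app_mult o_apply app_Cons)

lemma root_perm_inverse [simp]: "root_perm (inverse g) (root_perm g y) = y" "root_perm g (root_perm (inverse g) y) = y"
  by (metis inverse_right root_perm_mult root_perm_one) (metis inverse_left root_perm_mult root_perm_one)

lemma sec_inverse: "sec (inverse g) y = inverse (sec g (root_perm (inverse g) y))"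
proof -
  have "sec (inverse g * g) y = 1" by (simp only: inverse_left sec_one)
  then have "sec (inverse g) y * sec g (root_perm (inverse g) y) = 1" by (simp only: sec_mult)
  then show ?thesis by (metis inverse_right mult.assoc mult.left_neutral mult.right_neutral)
qed

lemma sec_inverse_root_perm [simp]: "sec (inverse g) (root_perm g y) = inverse (sec g y)"
  by (simp add: sec_inverse)

definition node :: "(tri \<Rightarrow> tree_iso) \<Rightarrow> (tri \<Rightarrow> tri) \<Rightarrow> tree_iso" where
  "node f \<pi> = Aut (wr (\<lambda>y. app (f y)) \<pi>)"

lemma wr_W: 
  assumes "bij \<pi>" shows "wr (\<lambda>y. app (f y)) \<pi> \<in> W"
proof -
  let ?g = "wr (\<lambda>y. app (f y)) \<pi>"
  have gam_len: "length (?g u) = length u" for u by (cases u) (simp_all add: app_W)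
  have "?g u = ?g v \<Longrightarrow> u = v" for u v
    using assms app_W(1) by (cases u; cases v) (auto simp: bij_def inj_eq)
  moreover have "\<exists>u. ?g u = v" for v
  proof (cases v)
    case (Cons z w)
    obtain y where y: "\<pi> y = z" using assms by (metis bij_pointE)
    obtain u where "app (f y) u = w" using app_W(1)[of "f y"] by (metis bij_pointE)
    then show ?thesis using y Cons by (intro exI[of _ "y # u"]) simp
  qed (auto intro: exI[of _ "[]"])
  moreover have "prefix (?g u) (?g v)" if "prefix u v" for u v
    using that by (cases u; cases v) (auto intro: app_W(3))
  ultimately show ?thesis by (auto simp: W_def bij_def inj_def surj_def gam_len) metis
qed

lemma app_node: "bij \<pi> \<Longrightarrow> app (node f \<pi>) = wr (\<lambda>y. app (f y)) \<pi>"
  by (simp add: node_def Aut_inverse wr_W)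

lemma root_perm_node: "bij \<pi> \<Longrightarrow> root_perm (node f \<pi>) y = \<pi> y"
  by (rule root_perm_unique) (simp only: app_node wr.simps app_Nil)

lemma sec_node: "bij \<pi> \<Longrightarrow> sec (node f \<pi>) y = f y"
  by (rule sec_unique[where z = "\<pi> y"]) (simp only: app_node wr.simps)

text \<open>The root permutation of \<open>g\<close> is \<open>y \<mapsto> rotation g + orientation g * y\<close>, where \<open>orientation g\<close> is 1 or -1.\<close>
definition rotation :: "tree_iso \<Rightarrow> tri" where "rotation g = root_perm g 0"
definition orientation :: "tree_iso \<Rightarrow> tri" where "orientation g = root_perm g 1 - root_perm g 0"

lemma root_perm_affine: "root_perm g y = rotation g + orientation g * y"
  unfolding rotation_def orientation_def by (rule tri_inj_affine(1)[OF inj_root_perm])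

lemma orientation_cases: "orientation g = 1 \<or> orientation g = -1"
  unfolding orientation_def by (rule tri_inj_affine(2)[OF inj_root_perm])

lemma orientation_square [simp]: "orientation g * orientation g = 1" "orientation g * (orientation g * y) = y"
  using orientation_cases[of g] by auto

lemma affine_unique: "(\<And>y. root_perm g y = c + s * y) \<Longrightarrow> rotation g = c \<and> orientation g = s"
  by (simp add: rotation_def orientation_def)

lemma rotation_one [simp]: "rotation 1 = 0" and orientation_one [simp]: "orientation 1 = 1"
  by (simp_all add: rotation_def orientation_def)

lemma rotation_mult [simp]: "rotation (g * h) = rotation h + orientation h * rotation g"
  and orientation_mult [simp]: "orientation (g * h) = orientation g * orientation h"
  using affine_unique[of "g * h" "rotation h + orientation h * rotation g" "orientation g * orientation h"]
  by (simp_all add: root_perm_affine[of g] root_perm_affine[of h] algebra_simps)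

lemma orientation_inverse [simp]: "orientation (inverse g) = orientation g"
  by (metis inverse_left mult.left_neutral mult.right_neutral mult.assoc orientation_mult orientation_one orientation_square(1))

lemma rotation_inverse [simp]: "rotation (inverse g) = - (orientation g * rotation g)"
proof -
  have "rotation g + orientation g * rotation (inverse g) = 0" by (metis inverse_left rotation_mult rotation_one)
  then have "orientation g * (rotation g + orientation g * rotation (inverse g)) = 0" by simp
  then show ?thesis by (simp add: distrib_left eq_neg_iff_add_eq_0 add.commute)
qed

lemma root_perm_id_iff: "(\<forall>y. root_perm g y = y) \<longleftrightarrow> rotation g = 0 \<and> orientation g = 1"
  using affine_unique[of g 0 1] by (auto simp: root_perm_affine)

lemma tree_iso_eqI': "rotation g = rotation h \<Longrightarrow> orientation g = orientation h \<Longrightarrow> (\<And>y. sec g y = sec h y) \<Longrightarrow> g = h"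
  by (rule tree_iso_eqI) (simp_all add: root_perm_affine)

lemma tree_iso_eqI3: "rotation g = rotation h \<Longrightarrow> orientation g = orientation h \<Longrightarrow> sec g 0 = sec h 0 \<Longrightarrow> sec g 1 = sec h 1 \<Longrightarrow>
    sec g (-1) = sec h (-1) \<Longrightarrow> g = h"
  by (rule tree_iso_eqI') (use tri_cases in metis)+

lemma tri_numeral [simp]: "(2::tri) = -1" "(3::tri) = 0"
proof -
  show *: "(2::tri) = -1" by (simp flip: one_add_one add: tri_add_self)
  have "(3::tri) = 2 + 1" by simp
  then show "(3::tri) = 0" unfolding * by simp
qed

lemma tri_add_self' [simp]: "a + (a + b) = - a + (b::tri)"
  by (simp add: tri_add_self flip: add.assoc)

declare tri_add_self [simp]

text \<open>A function occurring among its own sections cannot be assembled from known isometries,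
  so the properties are proved by induction on words for a whole section-closed set at once.\<close>

lemma W_coinduct:
  assumes "f \<in> S" and nil: "\<And>f. f \<in> S \<Longrightarrow> f [] = []"
    and cons: "\<And>f. f \<in> S \<Longrightarrow> \<exists>\<pi> F. bij \<pi> \<and> (\<forall>y. F y \<in> S) \<and> (\<forall>y w. f (y # w) = \<pi> y # F y w)"
  shows "f \<in> W"
proof -
  obtain p F where bij: "\<And>f. f \<in> S \<Longrightarrow> bij (p f)" and F: "\<And>f y. f \<in> S \<Longrightarrow> F f y \<in> S"
    and eq: "\<And>f y w. f \<in> S \<Longrightarrow> f (y # w) = p f y # F f y w"
    using cons by metis
  have gam_len: "length (f u) = length u" if "f \<in> S" for f u
    using that by (induction u arbitrary: f) (auto simp: nil eq F)
  have inj: "f u = f v \<longrightarrow> u = v" if "f \<in> S" for f u v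
    using that
  proof (induction u arbitrary: f v)
    case Nil
    then show ?case using gam_len[of f v] nil[of f] by auto
  next
    case (Cons y u)
    then show ?case using F[of f] bij[of f] nil[of f]
      by (cases v) (auto simp: eq bij_def inj_eq)
  qed
  have surj: "\<exists>u. f u = v" if "f \<in> S" for f v
    using that
  proof (induction v arbitrary: f)
    case Nil
    then show ?case using nil by blast
  next
    case (Cons z v)
    then obtain y where "p f y = z" using bij by (metis bij_pointE)
    moreover obtain u where "F f y u = v" using Cons F by blast
    ultimately have "f (y # u) = z # v" using Cons by (simp add: eq)
    then show ?case by blast
  qed
  have pre: "prefix (f u) (f v)" if "f \<in> S" "prefix u v" for f u v
    using that
  proof (induction u arbitrary: f v)
    case Nil
    then show ?case by (simp add: nil)
  next
    case (Cons y u)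
    then obtain w where "v = y # w" "prefix u w" by (cases v) auto
    then show ?case using Cons F by (simp add: eq)
  qed
  have "inj f" using inj[OF assms(1)] by (auto simp: inj_def)
  moreover have "surj f" using surj[OF assms(1)] by (metis surjI)
  ultimately show ?thesis using gam_len[OF assms(1)] pre[OF assms(1)] by (auto simp: W_def bij_def)
qed

subsection \<open>The Gupta--Sidki group\<close>

definition trip :: "tree_iso \<Rightarrow> tree_iso \<Rightarrow> tree_iso \<Rightarrow> tree_iso" where
  "trip a b c = node (\<lambda>y. case y of T0 \<Rightarrow> a | T1 \<Rightarrow> b | T2 \<Rightarrow> c) id"

lemma root_perm_trip [simp]: "root_perm (trip a b c) y = y"
  by (simp add: trip_def root_perm_node)

lemma rotation_trip [simp]: "rotation (trip a b c) = 0" and orientation_trip [simp]: "orientation (trip a b c) = 1"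
  using root_perm_id_iff[of "trip a b c"] by auto

lemma sec_trip [simp]: "sec (trip a b c) 0 = a" "sec (trip a b c) 1 = b" "sec (trip a b c) (-1) = c"
  by (simp_all add: trip_def sec_node tri_eval)

lemma trip_sec: "rotation g = 0 \<Longrightarrow> orientation g = 1 \<Longrightarrow> trip (sec g 0) (sec g 1) (sec g (-1)) = g"
  by (rule tree_iso_eqI3) simp_all

lemma trip_mult: "trip a b c * trip a' b' c' = trip (a * a') (b * b') (c * c')"
  by (rule tree_iso_eqI3) simp_all

lemma trip_one: "trip 1 1 1 = 1"
  by (rule tree_iso_eqI3) simp_all

lemma inverse_trip: "inverse (trip a b c) = trip (inverse a) (inverse b) (inverse c)"
  by (rule tree_iso.inverse_unique) (simp add: trip_mult trip_one)

lemma bij_shift: "bij (\<lambda>y::tri. y + c)"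
  by (rule bij_plus_right)

text \<open>Exponents live in the field \<open>tri\<close>, so \<open>x\<^sup>3 = 1\<close> is built
  into the indexing and exponents are handled by field arithmetic.\<close>

definition x_pow :: "tri \<Rightarrow> tree_iso" where "x_pow c = node (\<lambda>_. 1) (\<lambda>y. y + c)"

lemma root_perm_x_pow: "root_perm (x_pow c) y = y + c" by (simp add: x_pow_def root_perm_node bij_shift)
lemma sec_x_pow [simp]: "sec (x_pow c) y = 1" by (simp add: x_pow_def sec_node bij_shift)
lemma rotation_x_pow [simp]: "rotation (x_pow c) = c" and orientation_x_pow [simp]: "orientation (x_pow c) = 1"
  using affine_unique[of "x_pow c" c 1] by (simp_all add: root_perm_x_pow)

lemma x_pow_add: "x_pow (a + b) = x_pow a * x_pow b"
  by (rule tree_iso_eqI') simp_all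
lemma x_pow_0 [simp]: "x_pow 0 = 1"
  by (rule tree_iso_eqI') simp_all
lemma inverse_x_pow [simp]: "inverse (x_pow a) = x_pow (- a)"
  by (rule tree_iso.inverse_unique) (simp flip: x_pow_add)
lemma x_pow_mult_cancel [simp]: "x_pow a * x_pow (- a) = 1" "x_pow (- a) * x_pow a = 1"
   "x_pow a * (x_pow (- a) * g) = g" "x_pow (- a) * (x_pow a * g) = g"
  by (simp_all flip: x_pow_add mult.assoc)

lemma x_pow_merge: "x_pow a * x_pow b = x_pow (a + b)" "x_pow a * (x_pow b * g) = x_pow (a + b) * g"
  by (simp_all add: x_pow_add mult.assoc)

lemma xx_eq: "xx = app (x_pow 1)"
proof -
  have *: "rot = (\<lambda>y. y + 1)" by (rule ext) (rule rot_eq)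
  have "bij rot" unfolding * by (rule bij_shift)
  moreover have "x_pow 1 = node (\<lambda>_. 1) rot" by (simp only: x_pow_def *)
  ultimately show ?thesis by (simp add: xx_def app_node app_one)
qed

lemma gam_W: "gam \<in> W"
\<comment> \<open>Closure under sections is needed: besides itself, \<open>gam\<close> has
  \<open>xx\<close> and its inverse as sections, and these are absorbed by \<open>W\<close>.\<close>
proof (rule W_coinduct[of _ "insert gam W"])
  fix f assume f: "f \<in> insert gam W"
  have "g [] = []" if "g \<in> W" for g using that by (simp add: W_def) (metis length_0_conv)
  then show "f [] = []" using f by auto
  show "\<exists>\<pi> F. bij \<pi> \<and> (\<forall>y. F y \<in> insert gam W) \<and> (\<forall>y w. f (y # w) = \<pi> y # F y w)"
  proof (cases "f = gam")
    case True
    have "bij (id :: tri \<Rightarrow> tri)" by simp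
    moreover have "xx \<in> W" "inv_into UNIV xx \<in> W" 
      using app[of "x_pow 1"] by (auto simp: xx_eq W_inv)
    moreover have "gam (y # w) = id y # (case y of T0 \<Rightarrow> gam | T1 \<Rightarrow> xx | T2 \<Rightarrow> inv_into UNIV xx) w" for y w
      by (cases y) simp_all
    ultimately show ?thesis unfolding True
      by (intro exI[of _ id] exI[of _ "case_tri gam xx (inv_into UNIV xx)"]) (auto split: tri.split)
  next
    case False
    then have "f = app (Aut f)" using f by (simp add: Aut_inverse)
    then show ?thesis
      by (intro exI[of _ "root_perm (Aut f)"] exI[of _ "\<lambda>y. app (sec (Aut f) y)"])
         (metis app_Cons app insertI2 inj_root_perm finite_tri finite_UNIV_inj_surj bij_def)
  qed
qed simp

definition gam_iso :: tree_iso where "gam_iso = Aut gam"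

lemma app_gam_iso: "app gam_iso = gam" by (simp add: gam_iso_def Aut_inverse gam_W)

lemma gam_iso_eq: "gam_iso = trip gam_iso (x_pow 1) (x_pow (-1))"
proof -
  have "app gam_iso w = app (trip gam_iso (x_pow 1) (x_pow (-1))) w" for w
  proof (cases w)
    case (Cons y v)
    have "inv_into UNIV xx = app (x_pow (-1))" by (simp add: xx_eq flip: app_inverse)
    then show ?thesis unfolding Cons app_gam_iso trip_def
      by (cases y) (simp_all add: app_node app_gam_iso xx_eq del: app_Cons)
  qed simp
  then show ?thesis by (metis app_inject ext)
qed

lemma rotation_gam_iso [simp]: "rotation gam_iso = 0" and orientation_gam_iso [simp]: "orientation gam_iso = 1"
  by (subst gam_iso_eq, simp)+

lemma sec_gam_iso [simp]: "sec gam_iso 0 = gam_iso" "sec gam_iso 1 = x_pow 1" "sec gam_iso (-1) = x_pow (-1)"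
  by (subst gam_iso_eq, simp)+

definition gam_pow :: "tri \<Rightarrow> tree_iso" where
  "gam_pow c = (case c of T0 \<Rightarrow> 1 | T1 \<Rightarrow> gam_iso | T2 \<Rightarrow> inverse gam_iso)"

lemma gam_pow_simps [simp]: "gam_pow 0 = 1" "gam_pow 1 = gam_iso" "gam_pow (-1) = inverse gam_iso"
  by (simp_all add: gam_pow_def tri_eval)

lemma gam_pow_eq: "gam_pow c = trip (gam_pow c) (x_pow c) (x_pow (- c))"
proof -
  have "trip (inverse gam_iso) (inverse (x_pow 1)) (inverse (x_pow (-1))) = inverse gam_iso"
    unfolding inverse_trip[symmetric] by (simp flip: gam_iso_eq)
  then show ?thesis
    using tri_cases[of c] by (auto simp: trip_one simp flip: gam_iso_eq)
qed

lemma rotation_gam_pow [simp]: "rotation (gam_pow c) = 0" and orientation_gam_pow [simp]: "orientation (gam_pow c) = 1"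
  by (subst gam_pow_eq, simp)+

lemma sec_gam_pow [simp]: "sec (gam_pow c) 0 = gam_pow c" "sec (gam_pow c) 1 = x_pow c" "sec (gam_pow c) (-1) = x_pow (- c)"
  by (subst gam_pow_eq, simp)+

text \<open>This contains \<open>\<gamma>\<^sup>3 = 1\<close>. Only the section at 0 repeats the
  claim; the other two are powers of x, where additivity is known.\<close>

lemma gam_pow_add: "gam_pow (a + b) = gam_pow a * gam_pow b"
proof (rule tree_iso_coinduct[of "\<lambda>g h. g = h \<or> g = gam_pow (a + b) \<and> h = gam_pow a * gam_pow b"])
  fix g h y
  assume "g = h \<or> g = gam_pow (a + b) \<and> h = gam_pow a * gam_pow b"
  then show "root_perm g y = root_perm h y" and "sec g y = sec h y \<or> sec g y = gam_pow (a + b) \<and> sec h y = gam_pow a * gam_pow b"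
    using tri_cases[of y] by (auto simp: root_perm_affine simp flip: x_pow_add)
qed simp

lemma inverse_gam_pow [simp]: "inverse (gam_pow a) = gam_pow (- a)"
  by (rule tree_iso.inverse_unique) (simp flip: gam_pow_add)

lemma gam_pow_mult_cancel [simp]: "gam_pow a * gam_pow (- a) = 1" "gam_pow (- a) * gam_pow a = 1"
   "gam_pow a * (gam_pow (- a) * g) = g" "gam_pow (- a) * (gam_pow a * g) = g"
  by (simp_all flip: gam_pow_add mult.assoc)

lemma gam_iso_cube: "gam_iso * gam_iso = inverse gam_iso" "inverse gam_iso * inverse gam_iso = gam_iso"
  "gam_iso * (gam_iso * g) = inverse gam_iso * g" "inverse gam_iso * (inverse gam_iso * g) = gam_iso * g"
  using gam_pow_add[of 1 1] gam_pow_add[of "-1" "-1"] by (simp_all flip: mult.assoc)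

text \<open>Only the letters \<open>\<gamma>\<close> are counted: powers of \<open>x\<close> have length 0.\<close>
inductive gam_len_le :: "nat \<Rightarrow> tree_iso \<Rightarrow> bool" where
  gam_len_le_one: "gam_len_le 0 1"
| gam_len_le_x_pow: "gam_len_le n g \<Longrightarrow> gam_len_le n (g * x_pow c)"
| gam_len_le_gam_pow: "gam_len_le n g \<Longrightarrow> gam_len_le (Suc n) (g * gam_pow c)"

lemma gam_len_le_Suc: "gam_len_le n g \<Longrightarrow> gam_len_le (Suc n) g"
  using gam_len_le_gam_pow[of n g 0] by simp

lemma gam_len_le_mono: "gam_len_le n g \<Longrightarrow> n \<le> m \<Longrightarrow> gam_len_le m g"
  by (induction m) (auto simp: le_Suc_eq intro: gam_len_le_Suc)

lemma gam_len_le_mult: "gam_len_le m h \<Longrightarrow> gam_len_le n g \<Longrightarrow> gam_len_le (n + m) (g * h)"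
  by (induction rule: gam_len_le.induct) (auto intro: gam_len_le.intros simp flip: mult.assoc)

lemma gam_len_le_x_pow_only: "gam_len_le n (x_pow c)"
  using gam_len_le_mono[OF gam_len_le_x_pow[OF gam_len_le_one, of c], of n] by simp

lemma gam_len_le_gam_pow_only: "gam_len_le 1 (gam_pow c)"
  using gam_len_le_gam_pow[OF gam_len_le_one, of c] by simp

lemma gam_len_le_inverse: "gam_len_le n g \<Longrightarrow> gam_len_le n (inverse g)"
proof (induction rule: gam_len_le.induct)
  case (gam_len_le_x_pow n g c)
  then show ?case using gam_len_le_mult[OF gam_len_le_x_pow.IH gam_len_le_x_pow_only[of 0 "-c"]] by simp
next
  case (gam_len_le_gam_pow n g c)
  then show ?case using gam_len_le_mult[OF gam_len_le_gam_pow.IH gam_len_le_gam_pow_only[of "-c"]] by simp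
qed (simp add: gam_len_le_one)

definition Gam :: "tree_iso set" where "Gam = {g. \<exists>n. gam_len_le n g}"

lemma Gam_one [simp]: "1 \<in> Gam" using gam_len_le_one by (auto simp: Gam_def)
lemma Gam_x_pow [simp]: "x_pow c \<in> Gam" using gam_len_le_x_pow_only by (auto simp: Gam_def)
lemma Gam_gam_pow [simp]: "gam_pow c \<in> Gam" using gam_len_le_gam_pow_only by (auto simp: Gam_def)
lemma Gam_gam_iso [simp]: "gam_iso \<in> Gam" using Gam_gam_pow[of 1] by simp
lemma Gam_mult [simp]: "g \<in> Gam \<Longrightarrow> h \<in> Gam \<Longrightarrow> g * h \<in> Gam" using gam_len_le_mult by (fastforce simp: Gam_def)
lemma Gam_inverse [simp]: "g \<in> Gam \<Longrightarrow> inverse g \<in> Gam" using gam_len_le_inverse by (auto simp: Gam_def)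

lemma Gam_induct [consumes 1, case_names one x_pow gam_pow]:
  assumes "g \<in> Gam" "P 1" "\<And>g c. g \<in> Gam \<Longrightarrow> P g \<Longrightarrow> P (g * x_pow c)"
    "\<And>g c. g \<in> Gam \<Longrightarrow> P g \<Longrightarrow> P (g * gam_pow c)"
  shows "P g"
proof -
  obtain n where "gam_len_le n g" using assms(1) by (auto simp: Gam_def)
  then show ?thesis by induction (auto simp: Gam_def intro!: assms(2-4))
qed

text \<open>On \<open>\<Gamma>\<close> the exponent of \<open>\<gamma>\<close> can be read off the second level: the rotations of the three
  sections form an arithmetic progression, and the exponent is its common difference.\<close>
definition gam_exp :: "tree_iso \<Rightarrow> tri" where "gam_exp g = rotation (sec g 1) - rotation (sec g 0)"

definition arith_rotations :: "tree_iso \<Rightarrow> bool" where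
  "arith_rotations g \<longleftrightarrow> orientation g = 1 \<and> (\<forall>y. orientation (sec g y) = 1 \<and> rotation (sec g y) = rotation (sec g 0) + gam_exp g * y)"

text \<open>Shifting the argument of a progression by \<open>rotation g\<close> changes only its
  initial term, so the common differences add. This makes \<open>gam_exp\<close> a homomorphism on
  \<Gamma>.\<close>

lemma arith_rotations_mult:
  assumes "arith_rotations g" "arith_rotations h" shows "arith_rotations (g * h)" and "gam_exp (g * h) = gam_exp g + gam_exp h"
proof -
  have 1: "orientation g = 1" "orientation h = 1" "orientation (sec g y) = 1" "orientation (sec h y) = 1" for y using assms unfolding arith_rotations_def by blast+
  have eg: "rotation (sec g y) = rotation (sec g 0) + gam_exp g * y" 
    and eh: "rotation (sec h y) = rotation (sec h 0) + gam_exp h * y" for y using assms unfolding arith_rotations_def by blast+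
  have *: "rotation (sec (g * h) y) = (rotation (sec g 0) + rotation (sec h 0) + gam_exp h * rotation g) + (gam_exp g + gam_exp h) * y" for y
    by (simp add: root_perm_affine 1 eh[of "y + rotation g"] eg[of y] algebra_simps)
  show gam_exp: "gam_exp (g * h) = gam_exp g + gam_exp h"
    unfolding gam_exp_def[of "g * h"] * by simp
  show "arith_rotations (g * h)"
    unfolding arith_rotations_def gam_exp by (auto simp: 1 * root_perm_affine algebra_simps simp del: sec_mult) (auto simp: 1)
qed

lemma arith_rotations_x_pow: "arith_rotations (x_pow c)" and gam_exp_x_pow [simp]: "gam_exp (x_pow c) = 0"
  by (simp_all add: arith_rotations_def gam_exp_def)

lemma gam_exp_gam_pow [simp]: "gam_exp (gam_pow c) = c"
  by (simp add: gam_exp_def)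

lemma arith_rotations_gam_pow: "arith_rotations (gam_pow c)"
  by (simp add: arith_rotations_def all_tri)

lemma gam_exp_one [simp]: "gam_exp 1 = 0" using gam_exp_x_pow[of 0] by simp
lemma arith_rotations_one: "arith_rotations 1" using arith_rotations_x_pow[of 0] by simp

lemma Gam_arith_rotations: "g \<in> Gam \<Longrightarrow> arith_rotations g"
  by (induction rule: Gam_induct) (auto intro: arith_rotations_mult arith_rotations_x_pow arith_rotations_gam_pow arith_rotations_one)

lemma Gam_orientation [simp]: "g \<in> Gam \<Longrightarrow> orientation g = 1"
  using Gam_arith_rotations unfolding arith_rotations_def by blast

lemma gam_exp_mult [simp]: "g \<in> Gam \<Longrightarrow> h \<in> Gam \<Longrightarrow> gam_exp (g * h) = gam_exp g + gam_exp h"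
  by (simp add: arith_rotations_mult Gam_arith_rotations)

lemma gam_exp_inverse [simp]: "g \<in> Gam \<Longrightarrow> gam_exp (inverse g) = - gam_exp g"
  using gam_exp_mult[of g "inverse g"] by (simp add: add_eq_0_iff)

lemma sec_gam_pow_Gam [simp]: "sec (gam_pow c) y \<in> Gam"
  using tri_cases[of y] by auto

lemma Gam_sec [simp]: "g \<in> Gam \<Longrightarrow> sec g y \<in> Gam"
  by (induction arbitrary: y rule: Gam_induct) simp_all

section \<open>The branch criterion for membership in \<Gamma>\<close>

text \<open>On \<Gamma>, \<open>rotation\<close> is the exponent of x. The model is (\<gamma>, x,
  x^-1): a letter \<gamma> in one section comes with x and x^-1 in the next two.\<close>

definition branch_rel :: "tree_iso \<Rightarrow> bool" where
  "branch_rel g \<longleftrightarrow> (\<forall>y. rotation (sec g y) = gam_exp (sec g (y - 1)) - gam_exp (sec g (y + 1)))"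

lemma relD: "branch_rel g \<Longrightarrow> rotation (sec g y) = gam_exp (sec g (y - 1)) - gam_exp (sec g (y + 1))"
  by (auto simp: branch_rel_def)

lemma branch_rel_gam_pow: "branch_rel (gam_pow c)"
  by (simp add: branch_rel_def all_tri)

text \<open>The relation is linear in the exponents and stable under cyclic shifts of the sections;
  with \<open>orientation g = 1\<close> the sections of \<open>h\<close> enter after just such a
  shift.\<close>

lemma branch_rel_mult:
  assumes "orientation g = 1" "\<And>y. sec g y \<in> Gam" "\<And>y. sec h y \<in> Gam" "branch_rel g" "branch_rel h"
  shows "branch_rel (g * h)"
  unfolding branch_rel_def using assms
  by (simp add: root_perm_affine relD[OF assms(4)] relD[OF assms(5)] algebra_simps)

lemma Gam_branch_rel: "g \<in> Gam \<Longrightarrow> branch_rel g"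
proof (induction rule: Gam_induct)
  case one
  then show ?case by (simp add: branch_rel_def)
next
  case (x_pow g c)
  then show ?case by (simp add: branch_rel_def)
next
  case (gam_pow g c)
  then show ?case by (intro branch_rel_mult branch_rel_gam_pow) simp_all
qed

text \<open>\<Gamma> is self-replicating: both generators occur as sections, at any given vertex of
  level one, of elements of \<Gamma> that fix this level.\<close>

lemma Gam_lift:
  assumes "g \<in> Gam" shows "\<exists>h\<in>Gam. rotation h = 0 \<and> sec h y = g"
proof -
  have "\<exists>h\<in>Gam. rotation h = 0 \<and> sec h 0 = g" using assms
  proof (induction rule: Gam_induct)
    case one
    then show ?case by (intro bexI[of _ 1]) simp_all
  next
    case (x_pow g c)
    then obtain h where "h \<in> Gam" "rotation h = 0" "sec h 0 = g" by auto
    \<comment> \<open>Conjugation by x carries the section of \<open>gam_pow (- c)\<close> at -1,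
      which is \<open>x_pow c\<close>, to the vertex 0.\<close>
    then show ?case by (intro bexI[of _ "h * (x_pow (-1) * gam_pow (- c) * x_pow 1)"]) (simp_all add: root_perm_affine)
  next
    case (gam_pow g c)
    then obtain h where "h \<in> Gam" "rotation h = 0" "sec h 0 = g" by auto
    then show ?case by (intro bexI[of _ "h * gam_pow c"]) (simp_all add: root_perm_affine)
  qed
  then obtain h where "h \<in> Gam" "rotation h = 0" "sec h 0 = g" by auto
  then show ?thesis by (intro bexI[of _ "x_pow (- y) * h * x_pow y"]) (simp_all add: root_perm_affine)
qed

text \<open>These turn out to be the elements with both exponents 0
  (\<open>Gam_derived_iff\<close>), that is, the derived subgroup. Defined through branching, it
  allows three such sections to be prescribed independently.\<close>

definition Gam_derived :: "tree_iso set" where "Gam_derived = {k. trip k 1 1 \<in> Gam}"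

lemma Gam_derived_one: "1 \<in> Gam_derived" by (simp add: Gam_derived_def trip_one)
lemma Gam_derived_mult: "a \<in> Gam_derived \<Longrightarrow> b \<in> Gam_derived \<Longrightarrow> a * b \<in> Gam_derived"
  using Gam_mult[of "trip a 1 1" "trip b 1 1"] by (simp add: Gam_derived_def trip_mult del: Gam_mult)
text \<open>Conjugate \<open>trip a 1 1\<close> by a lift of \<open>g\<close> that fixes level
  one.\<close>

lemma Gam_derived_conj:
  assumes "a \<in> Gam_derived" "g \<in> Gam" shows "inverse g * a * g \<in> Gam_derived"
proof -
  obtain h where h: "h \<in> Gam" "rotation h = 0" "sec h 0 = g" using Gam_lift[OF assms(2)] by blast
  have "inverse h * trip a 1 1 * h \<in> Gam" using assms h by (simp add: Gam_derived_def)
  also have "inverse h * trip a 1 1 * h = trip (inverse g * a * g) 1 1"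
    by (rule tree_iso_eqI3) (simp_all add: h root_perm_affine sec_inverse)
  finally show ?thesis by (simp add: Gam_derived_def)
qed

text \<open>This is the commutator of \<open>\<gamma>\<gamma>\<^sup>x = (\<gamma>x\<^bsup>-1\<^esup>, x\<gamma>, 1)\<close> and of the conjugate \<open>(x\<gamma>, 1, \<gamma>x\<^bsup>-1\<^esup>)\<close>.\<close>
lemma Gam_derived_comm: "x_pow 1 * gam_iso * x_pow (-1) * inverse gam_iso \<in> Gam_derived"
proof -
  define u where "u = gam_iso * (x_pow (-1) * gam_iso * x_pow 1)"
  define v where "v = (x_pow 1 * gam_iso * x_pow (-1)) * gam_iso"
  have "inverse u * inverse v * u * v = trip (x_pow 1 * gam_iso * x_pow (-1) * inverse gam_iso) 1 1"
    by (rule tree_iso_eqI3)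
       (simp_all add: u_def v_def root_perm_affine sec_inverse mult.assoc gam_iso_cube x_pow_merge)
  moreover have "inverse u * inverse v * u * v \<in> Gam" by (simp add: u_def v_def)
  ultimately show ?thesis by (simp add: Gam_derived_def)
qed

text \<open>In the branch relation for (k, 1, 1), vertex 0 kills the exponent of x and vertex 1 that
  of \<gamma>.\<close>

lemma Gam_derived_Gam: "k \<in> Gam_derived \<Longrightarrow> k \<in> Gam \<and> rotation k = 0 \<and> gam_exp k = 0"
proof -
  assume "k \<in> Gam_derived"
  then have t: "trip k 1 1 \<in> Gam" by (simp add: Gam_derived_def)
  show ?thesis using Gam_sec[OF t, of 0] relD[OF Gam_branch_rel[OF t], of 0] relD[OF Gam_branch_rel[OF t], of 1] by simp
qed

lemma Gam_normal_form:
  assumes "g \<in> Gam" shows "\<exists>i j. \<exists>k\<in>Gam_derived. g = x_pow i * gam_pow j * k"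
  using assms
proof (induction rule: Gam_induct)
  case one
  then show ?case using Gam_derived_one by (intro exI[of _ 0] bexI[of _ 1]) simp_all
next
  case (x_pow g c)
  \<comment> \<open>\<open>C j d\<close>: the powers \<open>gam_pow j\<close> and
    \<open>x_pow d\<close> commute modulo \<open>Gam_derived\<close>. This is additive in each
    argument, so the single commutator \<open>Gam_derived_comm\<close> yields all cases.\<close>
  define C where "C j d \<longleftrightarrow> (\<exists>k\<in>Gam_derived. gam_pow j * x_pow d = x_pow d * gam_pow j * k)" for j d
  have C_0: "C j 0" "C 0 d" for j d using Gam_derived_one by (auto simp: C_def intro: bexI[of _ 1])
  have C_x_pow: "C j (d + d')" if C: "C j d" "C j d'" for j d d'
  proof -
    obtain k k' where k: "k \<in> Gam_derived" "k' \<in> Gam_derived" "gam_pow j * x_pow d = x_pow d * gam_pow j * k" "gam_pow j * x_pow d' = x_pow d' * gam_pow j * k'"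
      using C by (auto simp: C_def)
    have "gam_pow j * x_pow (d + d') = x_pow d * (gam_pow j * x_pow d') * (inverse (x_pow d') * k * x_pow d')"
      using k(3) by (simp add: x_pow_add flip: mult.assoc) (simp add: mult.assoc)
    also have "\<dots> = x_pow (d + d') * gam_pow j * (k' * (inverse (x_pow d') * k * x_pow d'))"
      by (simp only: k(4) x_pow_add mult.assoc)
    finally show ?thesis using Gam_derived_mult[OF k(2) Gam_derived_conj[OF k(1) Gam_x_pow]] by (auto simp: C_def)
  qed
  have C_gam_pow: "C (i + j) d" if C: "C i d" "C j d" for i j d
  proof -
    obtain k k' where k: "k \<in> Gam_derived" "k' \<in> Gam_derived" "gam_pow i * x_pow d = x_pow d * gam_pow i * k" "gam_pow j * x_pow d = x_pow d * gam_pow j * k'"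
      using C by (auto simp: C_def)
    have "gam_pow (i + j) * x_pow d = gam_pow i * x_pow d * gam_pow j * k'"
      by (simp only: gam_pow_add mult.assoc k(4))
    also have "\<dots> = x_pow d * gam_pow (i + j) * ((inverse (gam_pow j) * k * gam_pow j) * k')"
      unfolding k(3) by (simp add: gam_pow_add mult.assoc)
    finally show ?thesis using Gam_derived_mult[OF Gam_derived_conj[OF k(1) Gam_gam_pow] k(2)] by (auto simp: C_def)
  qed
  have "gam_pow 1 * x_pow (-1) = x_pow (-1) * gam_pow 1 * (inverse (gam_pow 1) * (x_pow 1 * gam_iso * x_pow (-1) * inverse gam_iso) * gam_pow 1)"
    by (simp add: mult.assoc)
  then have "C 1 (-1)" unfolding C_def using Gam_derived_conj[OF Gam_derived_comm Gam_gam_pow] by blast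
  then have "C 1 c" using tri_cases[of c] C_0 C_x_pow[of 1 "-1" "-1"] by auto
  then have "C j c" for j using tri_cases[of j] C_0 C_gam_pow[of 1 c 1] by auto
  then have comm_gen: "\<exists>k\<in>Gam_derived. gam_pow j * x_pow c = x_pow c * gam_pow j * k" for j by (simp add: C_def)
  obtain i j k where k: "k \<in> Gam_derived" "g = x_pow i * gam_pow j * k" using x_pow by auto
  obtain k' where k': "k' \<in> Gam_derived" "gam_pow j * x_pow c = x_pow c * gam_pow j * k'" using comm_gen by blast
  have "g * x_pow c = x_pow i * (gam_pow j * x_pow c) * (inverse (x_pow c) * k * x_pow c)"
    by (simp add: k mult.assoc)
  also have "\<dots> = x_pow (i + c) * gam_pow j * (k' * (inverse (x_pow c) * k * x_pow c))"
    by (simp add: k' x_pow_add mult.assoc)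
  finally show ?case using Gam_derived_mult[OF k'(1) Gam_derived_conj[OF k(1) Gam_x_pow[of c]]] by blast
next
  case (gam_pow g c)
  then obtain i j k where k: "k \<in> Gam_derived" "g = x_pow i * gam_pow j * k" by auto
  then have "g * gam_pow c = x_pow i * gam_pow (j + c) * (inverse (gam_pow c) * k * gam_pow c)"
    by (simp add: gam_pow_add mult.assoc)
  then show ?case using Gam_derived_conj[OF k(1) Gam_gam_pow[of c]] by blast
qed

lemma Gam_derived_iff: "k \<in> Gam_derived \<longleftrightarrow> k \<in> Gam \<and> rotation k = 0 \<and> gam_exp k = 0"
proof
  assume *: "k \<in> Gam \<and> rotation k = 0 \<and> gam_exp k = 0"
  then obtain i j k' where k': "k' \<in> Gam_derived" "k = x_pow i * gam_pow j * k'" using Gam_normal_form by blast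
  note Gam_derived_Gam[OF k'(1)]
  then have "i = 0" "j = 0" using * k' by simp_all
  then show "k \<in> Gam_derived" using k' by simp
qed (rule Gam_derived_Gam)

lemma trip_Gam_derived:
  assumes "a \<in> Gam_derived" "b \<in> Gam_derived" "c \<in> Gam_derived" shows "trip a b c \<in> Gam"
proof -
  have "trip a b c = trip a 1 1 * (x_pow (-1) * trip b 1 1 * x_pow 1) * (x_pow 1 * trip c 1 1 * x_pow (-1))"
    by (rule tree_iso_eqI3) (simp_all add: root_perm_affine)
  then show ?thesis using assms by (simp add: Gam_derived_def)
qed

lemma Gam_iff: "g \<in> Gam \<longleftrightarrow> orientation g = 1 \<and> (\<forall>y. sec g y \<in> Gam) \<and> branch_rel g"
proof
  assume *: "orientation g = 1 \<and> (\<forall>y. sec g y \<in> Gam) \<and> branch_rel g"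
  define a where "a y = gam_exp (sec g y)" for y
  \<comment> \<open>The three conjugates of \<gamma> contribute \<gamma>-exponents at 0, 1 and -1
    respectively. Dividing by \<open>h\<close> leaves sections of \<gamma>-exponent 0, whose
    rotations then vanish by the branch relation.\<close>
  define h where "h = gam_pow (a 0) * (x_pow (-1) * gam_pow (a 1) * x_pow 1) * (x_pow 1 * gam_pow (a (-1)) * x_pow (-1))"
  define f where "f = inverse h * g * x_pow (- rotation g)"
  have h: "h \<in> Gam" "rotation h = 0" by (simp_all add: h_def)
  have "gam_exp (sec h y) = a y" for y
    using tri_cases[of y] by (auto simp: h_def root_perm_affine)
  then have sf: "sec f y \<in> Gam \<and> gam_exp (sec f y) = 0" for y
    using h * by (simp add: f_def root_perm_affine sec_inverse a_def)
  have f: "orientation f = 1" "rotation f = 0" using h * by (simp_all add: f_def)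
  have "branch_rel f" unfolding f_def using * h Gam_branch_rel[OF Gam_inverse[OF h(1)]] Gam_branch_rel[OF Gam_x_pow]
    by (intro branch_rel_mult) (simp_all add: root_perm_affine sec_inverse)
  then have "sec f y \<in> Gam_derived" for y using sf by (simp add: Gam_derived_iff relD)
  then have "f \<in> Gam" using trip_Gam_derived[of "sec f 0" "sec f 1" "sec f (-1)"] by (simp add: trip_sec f)
  moreover have "g = h * f * x_pow (rotation g)" by (simp add: f_def mult.assoc flip: x_pow_add)
  ultimately show "g \<in> Gam" using h by (metis Gam_mult Gam_x_pow)
qed (simp add: Gam_branch_rel)

subsection \<open>Normalizers\<close>

definition conjug :: "tree_iso \<Rightarrow> tree_iso \<Rightarrow> tree_iso" where "conjug h g = inverse h * g * h"
text \<open>An equivalence rather than an inclusion, so that \<open>Norm S\<close> is closed under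
  inverses for every set \<open>S\<close>.\<close>

definition Norm :: "tree_iso set \<Rightarrow> tree_iso set" where "Norm S = {h. \<forall>g. conjug h g \<in> S \<longleftrightarrow> g \<in> S}"

lemma conjug_mult [simp]: "conjug h (f * g) = conjug h f * conjug h g" and conjug_one [simp]: "conjug h 1 = 1"
  and conjug_inverse [simp]: "conjug h (inverse g) = inverse (conjug h g)"
  and conjug_by_one [simp]: "conjug 1 g = g"
  by (simp_all add: conjug_def mult.assoc)

lemma conjug_conjug: "conjug h (conjug k g) = conjug (k * h) g"
  by (simp add: conjug_def mult.assoc)

lemma conjug_cancel [simp]: "conjug h (conjug (inverse h) g) = g" "conjug (inverse h) (conjug h g) = g"
  by (simp_all add: conjug_conjug)

lemma conjug_fix: assumes "h * g = g * h" shows "conjug h g = g"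
  unfolding conjug_def mult.assoc assms[symmetric] by simp

lemma conjug_fixD: assumes "conjug h g = g" shows "h * g = g * h"
proof -
  have "h * conjug h g = g * h" by (simp add: conjug_def mult.assoc)
  then show ?thesis by (simp add: assms)
qed

lemma NmI:
  assumes "\<And>g. g \<in> S \<Longrightarrow> conjug h g \<in> S" "\<And>g. g \<in> S \<Longrightarrow> conjug (inverse h) g \<in> S"
  shows "h \<in> Norm S"
proof -
  have "conjug h g \<in> S \<longleftrightarrow> g \<in> S" for g
    using assms(1)[of g] assms(2)[of "conjug h g"] by auto
  then show ?thesis by (simp add: Norm_def)
qed

lemma NmD: "h \<in> Norm S \<Longrightarrow> g \<in> S \<Longrightarrow> conjug h g \<in> S"
  by (simp add: Norm_def)

lemma Norm_one [simp]: "1 \<in> Norm S" by (simp add: Norm_def)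
lemma Norm_mult [simp]: "h \<in> Norm S \<Longrightarrow> k \<in> Norm S \<Longrightarrow> h * k \<in> Norm S"
  by (simp add: Norm_def flip: conjug_conjug)
lemma Norm_inverse [simp]: assumes "h \<in> Norm S" shows "inverse h \<in> Norm S"
proof -
  have "conjug (inverse h) g \<in> S \<longleftrightarrow> g \<in> S" for g
  proof -
    have "conjug h f \<in> S \<longleftrightarrow> f \<in> S" for f using assms by (simp add: Norm_def)
    from this[of "conjug (inverse h) g"] show ?thesis by simp
  qed
  then show ?thesis by (simp add: Norm_def)
qed

lemma Norm_mult_left_iff: "k \<in> Norm S \<Longrightarrow> k * h \<in> Norm S \<longleftrightarrow> h \<in> Norm S"
  using Norm_mult[of k S h] Norm_mult[OF Norm_inverse, of k S "k * h"] unfolding inverse_cancel by blast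

definition is_subgroup :: "tree_iso set \<Rightarrow> bool" where
  "is_subgroup S \<longleftrightarrow> 1 \<in> S \<and> (\<forall>g\<in>S. \<forall>h\<in>S. g * h \<in> S) \<and> (\<forall>g\<in>S. inverse g \<in> S)"

lemma subgroup_Norm: "is_subgroup S \<Longrightarrow> g \<in> S \<Longrightarrow> g \<in> Norm S"
  by (intro NmI) (auto simp: is_subgroup_def conjug_def)

lemma is_subgroup_Norm: "is_subgroup (Norm S)"
  by (simp add: is_subgroup_def)

lemma is_subgroup_Gam: "is_subgroup Gam"
  by (simp add: is_subgroup_def)

lemma Gam_Norm [simp]: "g \<in> Gam \<Longrightarrow> g \<in> Norm Gam"
  by (rule subgroup_Norm[OF is_subgroup_Gam])

lemma Gam_conjug: "h \<in> Norm Gam \<Longrightarrow> g \<in> Gam \<Longrightarrow> conjug h g \<in> Gam"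
  by (rule NmD)

lemma generators_conjug:
  assumes S: "is_subgroup S" and "conjug h (x_pow 1) \<in> S" "conjug h gam_iso \<in> S" "g \<in> Gam"
  shows "conjug h g \<in> S"
  using assms(4)
proof (induction rule: Gam_induct)
  case one
  then show ?case using S by (simp add: is_subgroup_def)
next
  case (x_pow g c)
  have "conjug h (x_pow c) \<in> S" using assms(2) S conjug_inverse[of h "x_pow 1"] tri_cases[of c]
    by (auto simp: is_subgroup_def simp del: conjug_inverse)
  then show ?case using x_pow S by (simp add: is_subgroup_def)
next
  case (gam_pow g c)
  have "conjug h (gam_pow c) \<in> S" using assms(3) S tri_cases[of c] by (auto simp: is_subgroup_def)
  then show ?case using gam_pow S by (simp add: is_subgroup_def)
qed

lemma Norm_Gam_I:
  assumes "conjug h (x_pow 1) \<in> Gam" "conjug h gam_iso \<in> Gam" "conjug (inverse h) (x_pow 1) \<in> Gam" "conjug (inverse h) gam_iso \<in> Gam"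
  shows "h \<in> Norm Gam"
  using generators_conjug[OF is_subgroup_Gam assms(1,2)] generators_conjug[OF is_subgroup_Gam assms(3,4)]
  by (rule NmI)

lemma orientation_conjug [simp]: "orientation (conjug h g) = orientation g"
  using orientation_cases[of h] by (auto simp: conjug_def)

lemma rotation_conjug: "orientation g = 1 \<Longrightarrow> rotation (conjug h g) = orientation h * rotation g"
  by (simp add: conjug_def algebra_simps)

lemma sec_conjug: "sec (conjug h g) (root_perm h y) = inverse (sec h y) * sec g y * sec h (root_perm g y)"
  by (simp add: conjug_def mult.assoc)

lemma sec_conjug_id: "rotation h = 0 \<Longrightarrow> orientation h = 1 \<Longrightarrow> sec (conjug h g) y = inverse (sec h y) * sec g y * sec h (root_perm g y)"
  using sec_conjug[of h g y] by (simp add: root_perm_affine)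

lemma sec_conjug_trip: "rotation h = 0 \<Longrightarrow> orientation h = 1 \<Longrightarrow> rotation g = 0 \<Longrightarrow> orientation g = 1 \<Longrightarrow> sec (conjug h g) y = conjug (sec h y) (sec g y)"
  by (simp add: sec_conjug_id conjug_def root_perm_affine sec_inverse)

lemma root_perm_bij: "bij (root_perm g)"
  using inj_root_perm finite_UNIV_inj_surj[OF finite_tri] by (auto simp: bij_def)

lemma sum_tri: "(\<Sum>y\<in>UNIV. f y) = f 0 + f 1 + f (-1::tri)"
  by (simp add: UNIV_tri tri_const add.assoc)

text \<open>Write a, b, c for the \<gamma>-exponents of the sections at 0, 1, -1. The branch
  relation gives (a - c) - (c - b) = a + b - 2c, and -2 = 1.\<close>

lemma gam_exp_sum: "g \<in> Gam \<Longrightarrow> gam_exp g = (\<Sum>y\<in>UNIV. gam_exp (sec g y))"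
  by (simp add: gam_exp_def[of g] sum_tri relD[OF Gam_branch_rel] algebra_simps)

lemma gam_exp_sum_root_perm: "g \<in> Gam \<Longrightarrow> gam_exp g = (\<Sum>y\<in>UNIV. gam_exp (sec g (root_perm h y)))"
  unfolding gam_exp_sum by (rule sum.reindex_bij_betw[OF root_perm_bij, symmetric])

text \<open>The sections of \<open>x\<^sup>h\<close>, which lie in \<Gamma>, are the quotients of
  neighbouring sections of \<open>h\<close>.\<close>

lemma normal_sections:
  assumes "h \<in> Norm Gam" shows "inverse (sec h y) * sec h z \<in> Gam"
proof -
  have 1: "inverse (sec h y) * sec h (y + 1) \<in> Gam" for y
    using Gam_sec[OF Gam_conjug[OF assms Gam_x_pow[of 1]], of "root_perm h y"] by (simp only: sec_conjug sec_x_pow root_perm_x_pow mult.right_neutral)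
  have "inverse (sec h y) * sec h (y + c) \<in> Gam" for c
    using tri_cases[of c] 1[of y] Gam_inverse[OF 1[of "y - 1"]] by auto
  from this[of "z - y"] show ?thesis by simp
qed

text \<open>Around the 3-cycle the sections of \<open>x\<^sup>h\<close> telescope to 1, so their
  \<gamma>-exponents sum to 0; by \<open>gam_exp_sum\<close> this sum is the exponent
  sought.\<close>

lemma gam_exp_conjug_x_pow:
  assumes "h \<in> Norm Gam" shows "gam_exp (conjug h (x_pow c)) = 0"
proof -
  have s: "sec (conjug h (x_pow 1)) (root_perm h y) = inverse (sec h y) * sec h (y + 1)" for y
    by (simp only: sec_conjug sec_x_pow root_perm_x_pow mult.right_neutral)
  define n where "n y = inverse (sec h y) * sec h (y + 1)" for y
  have n: "n y \<in> Gam" for y using normal_sections[OF assms] by (simp add: n_def)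
  have "n 0 * n 1 * n (-1) = 1" by (simp add: n_def mult.assoc)
  then have "gam_exp (n 0) + gam_exp (n 1) + gam_exp (n (-1)) = 0"
    using n by (metis Gam_mult gam_exp_mult gam_exp_one)
  then have "gam_exp (conjug h (x_pow 1)) = 0"
    using gam_exp_sum_root_perm[OF Gam_conjug[OF assms Gam_x_pow[of 1]], of h] by (simp add: s sum_tri flip: n_def)
  moreover have "conjug h (x_pow (-1)) = inverse (conjug h (x_pow 1))" by (simp flip: conjug_inverse)
  ultimately show ?thesis using tri_cases[of c] Gam_conjug[OF assms Gam_x_pow[of 1]] by auto
qed

text \<open>An element \<open>h\<close> of \<open>Norm Gam\<close> acts diagonally on the
  abelianization, by \<open>orientation h\<close> on the exponent of x and by
  \<open>gam_sign h\<close> on that of \<gamma>.\<close>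

definition gam_sign :: "tree_iso \<Rightarrow> tri" where "gam_sign h = gam_exp (conjug h gam_iso)"

lemma gam_exp_conjug:
  assumes "h \<in> Norm Gam" "g \<in> Gam" shows "gam_exp (conjug h g) = gam_sign h * gam_exp g"
  using assms(2)
proof (induction rule: Gam_induct)
  case (gam_pow g c)
  have "gam_exp (conjug h (gam_pow c)) = c * gam_sign h" using tri_cases[of c] assms by (auto simp: gam_sign_def Gam_conjug)
  then show ?case using gam_pow assms by (simp add: Gam_conjug algebra_simps)
qed (use assms in \<open>simp_all add: Gam_conjug gam_exp_conjug_x_pow\<close>)

lemma gam_exp_gam_iso [simp]: "gam_exp gam_iso = 1" using gam_exp_gam_pow[of 1] by simp

lemma gam_sign_one [simp]: "gam_sign 1 = 1"
  using gam_exp_gam_pow[of 1] by (simp add: gam_sign_def)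

lemma gam_sign_mult: "h \<in> Norm Gam \<Longrightarrow> k \<in> Norm Gam \<Longrightarrow> gam_sign (h * k) = gam_sign h * gam_sign k"
  by (simp add: gam_sign_def[of "h * k"] gam_exp_conjug Gam_conjug mult.commute flip: conjug_conjug)

lemma gam_sign_cases: "h \<in> Norm Gam \<Longrightarrow> gam_sign h = 1 \<or> gam_sign h = -1"
proof -
  assume h: "h \<in> Norm Gam"
  then have "gam_sign h * gam_sign (inverse h) = 1" by (simp flip: gam_sign_mult)
  then show ?thesis using tri_cases[of "gam_sign h"] by auto
qed

lemma gam_sign_Gam [simp]: "g \<in> Gam \<Longrightarrow> gam_sign g = 1"
  using gam_exp_gam_pow[of 1] by (simp add: gam_sign_def conjug_def)

definition Norm_triv :: "tree_iso set" where "Norm_triv = {h \<in> Norm Gam. orientation h = 1 \<and> gam_sign h = 1}"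

lemma Norm_triv_mult [simp]: "h \<in> Norm_triv \<Longrightarrow> k \<in> Norm_triv \<Longrightarrow> h * k \<in> Norm_triv"
  by (simp add: Norm_triv_def gam_sign_mult)
lemma Norm_triv_Gam [simp]: "g \<in> Gam \<Longrightarrow> g \<in> Norm_triv"
  by (simp add: Norm_triv_def)
lemma Norm_triv_conjug: "h \<in> Norm_triv \<Longrightarrow> g \<in> Gam \<Longrightarrow> conjug h g \<in> Gam"
  by (simp add: Norm_triv_def Gam_conjug)
lemma Norm_triv_act: "h \<in> Norm_triv \<Longrightarrow> g \<in> Gam \<Longrightarrow> rotation (conjug h g) = rotation g \<and> gam_exp (conjug h g) = gam_exp g"
  by (simp add: Norm_triv_def gam_exp_conjug rotation_conjug)

text \<open>Self-replication makes the sections normalize \<Gamma>, and being congruent modulo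
  \<Gamma> they share both signs. The conjugate of \<gamma> fixes these: its exponent sum gives
  \<open>gam_sign\<close>, its branch relation at vertex 1 gives \<open>orientation\<close>.\<close>

lemma Norm_triv_sec:
  assumes "h \<in> Norm_triv" shows "sec h y \<in> Norm_triv"
proof -
  define k where "k = h * x_pow (- rotation h)"
  have k: "k \<in> Norm_triv" "rotation k = 0" "orientation k = 1" "sec k y = sec h y" for y
    using assms by (auto simp: k_def Norm_triv_def gam_sign_mult)
  have kN: "k \<in> Norm Gam" using k by (simp add: Norm_triv_def)
  have cjs: "conjug (sec f z) g \<in> Gam" if f: "f \<in> Norm Gam" "rotation f = 0" "orientation f = 1" and g: "g \<in> Gam" for f g z
  proof -
    obtain g' where "g' \<in> Gam" "rotation g' = 0" "sec g' z = g" using Gam_lift[OF g] by blast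
    then show ?thesis using Gam_sec[OF Gam_conjug[OF f(1)], of g' z] f by (simp add: sec_conjug_trip)
  qed
  have sN: "sec k z \<in> Norm Gam" for z
    using cjs[OF kN k(2,3), of _ z] cjs[of "inverse k" _ z] kN k by (intro NmI) (simp_all add: sec_inverse root_perm_affine)
  define c where "c z = inverse (sec k 0) * sec k z" for z
  have c: "c z \<in> Gam" "sec k z = sec k 0 * c z" for z using normal_sections[OF kN] by (simp_all add: c_def)
  have orientation: "orientation (sec k z) = orientation (sec k 0)" and gam_sign: "gam_sign (sec k z) = gam_sign (sec k 0)" for z
    by (subst c(2), simp add: c(1) sN gam_sign_mult)+
  define g where "g = conjug k gam_iso"
  have g: "g \<in> Gam" "sec g 0 = conjug (sec k 0) gam_iso" "sec g 1 = conjug (sec k 1) (x_pow 1)" "sec g (-1) = conjug (sec k (-1)) (x_pow (-1))"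
    using k by (simp_all add: g_def Norm_triv_conjug sec_conjug_trip)
  have "gam_exp g = gam_sign (sec k 0)" 
    unfolding gam_exp_sum[OF g(1)] sum_tri g by (simp add: gam_exp_conjug_x_pow[OF sN] gam_sign_def)
  moreover have "gam_exp g = 1" using Norm_triv_act[OF k(1), of gam_iso] gam_exp_gam_pow[of 1] by (simp add: g_def)
  moreover have "orientation (sec k 1) = gam_sign (sec k 0)"
    using relD[OF Gam_branch_rel[OF g(1)], of 1] by (simp add: g(2-4) rotation_conjug gam_exp_conjug_x_pow[OF sN] gam_sign_def)
  ultimately show ?thesis using sN[of y] orientation[of y] gam_sign[of y] k(4)[of y] by (simp add: Norm_triv_def orientation[of 1])
qed

section \<open>The Klein four-group V\<close>

definition tau_1 :: tree_iso where "tau_1 = Aut tau1"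
definition tau_2 :: tree_iso where "tau_2 = Aut tau2"
definition tau_3 :: tree_iso where "tau_3 = Aut tau3"

lemma bij_sw: "bij sw"
  by (rule bijI') (use sw_eq in \<open>simp_all, metis add.inverse_inverse\<close>)

lemma tau_W: "tau1 \<in> W" "tau2 \<in> W" "tau3 \<in> W"
proof -
  have id: "bij (id :: tri \<Rightarrow> tri)" by simp
  have "f \<in> {tau1, tau2, tau3} \<Longrightarrow> f \<in> W" for f
  proof (erule W_coinduct)
    fix f assume f: "f \<in> {tau1, tau2, tau3}"
    then show "f [] = []" by auto
    from f consider "f = tau1" | "f = tau2" | "f = tau3" by auto
    then show "\<exists>\<pi> F. bij \<pi> \<and> (\<forall>y. F y \<in> {tau1, tau2, tau3}) \<and> (\<forall>y w. f (y # w) = \<pi> y # F y w)"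
    proof cases
      case 1
      then show ?thesis using bij_sw by (intro exI[of _ sw] exI[of _ "\<lambda>_. tau1"]) auto
    next
      case 2
      then show ?thesis using id by (intro exI[of _ id] exI[of _ "\<lambda>_. tau3"]) auto
    next
      case 3
      then show ?thesis using bij_sw by (intro exI[of _ sw] exI[of _ "\<lambda>_. tau2"]) auto
    qed
  qed
  then show "tau1 \<in> W" "tau2 \<in> W" "tau3 \<in> W" by auto
qed

lemma app_tau: "app tau_1 = tau1" "app tau_2 = tau2" "app tau_3 = tau3"
  by (simp_all add: tau_1_def tau_2_def tau_3_def Aut_inverse tau_W)

lemma root_perm_tau: "root_perm tau_1 y = - y" "root_perm tau_2 y = y" "root_perm tau_3 y = - y"
  by (rule root_perm_unique, simp add: app_tau sw_eq del: app_Cons)+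

lemma sec_tau: "sec tau_1 y = tau_1" "sec tau_2 y = tau_3" "sec tau_3 y = tau_2"
  by (rule sec_unique[where z = "sw y"], simp add: app_tau del: app_Cons,
      rule sec_unique[where z = y], simp add: app_tau del: app_Cons,
      rule sec_unique[where z = "sw y"], simp add: app_tau del: app_Cons)

text \<open>For signs \<open>a, b\<close>, the element \<open>klein a b\<close> of V conjugates \<open>x\<close> to \<open>x\<^sup>a\<close> and \<open>\<gamma>\<close> to \<open>\<gamma>\<^sup>b\<close>.\<close>
definition klein :: "tri \<Rightarrow> tri \<Rightarrow> tree_iso" where
  "klein a b = (if a = 1 then if b = 1 then 1 else tau_2 else if b = 1 then tau_1 else tau_3)"

abbreviation sign :: "tri \<Rightarrow> bool" where "sign a \<equiv> a = 1 \<or> a = -1"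

lemma root_perm_klein [simp]: "sign a \<Longrightarrow> sign b \<Longrightarrow> root_perm (klein a b) y = a * y"
  by (auto simp: klein_def root_perm_tau)
lemma rotation_klein [simp]: "sign a \<Longrightarrow> sign b \<Longrightarrow> rotation (klein a b) = 0"
  by (simp add: rotation_def)
lemma orientation_klein [simp]: "sign a \<Longrightarrow> sign b \<Longrightarrow> orientation (klein a b) = a"
  by (simp add: orientation_def)
lemma sec_klein [simp]: "sign a \<Longrightarrow> sign b \<Longrightarrow> sec (klein a b) y = klein (a * b) b"
  by (auto simp: klein_def sec_tau)
lemma klein_1 [simp]: "klein 1 1 = 1" by (simp add: klein_def)

lemma sign_mult [simp]: "sign a \<Longrightarrow> sign b \<Longrightarrow> sign (a * b)"
  by auto

lemma klein_mult: 
  assumes "sign a" "sign b" "sign c" "sign d"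
  shows "klein a b * klein c d = klein (a * c) (b * d)"
\<comment> \<open>The relation ranges over all signs because a section turns
  \<open>klein a b\<close> into \<open>klein (a * b) b\<close>.\<close>
proof (rule tree_iso_coinduct[of "\<lambda>g h. \<exists>a b c d. sign a \<and> sign b \<and> sign c \<and> sign d \<and> 
    g = klein a b * klein c d \<and> h = klein (a * c) (b * d)"])
  fix g h y
  assume "\<exists>a b c d. sign a \<and> sign b \<and> sign c \<and> sign d \<and> g = klein a b * klein c d \<and> h = klein (a * c) (b * d)"
  then obtain a b c d where *: "sign a" "sign b" "sign c" "sign d" "g = klein a b * klein c d" "h = klein (a * c) (b * d)"
    by blast
  then show "root_perm g y = root_perm h y" by (simp add: mult_ac)
  show "\<exists>a b c d. sign a \<and> sign b \<and> sign c \<and> sign d \<and> sec g y = klein a b * klein c d \<and> sec h y = klein (a * c) (b * d)"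
    by (rule exI[of _ "a * b"], rule exI[of _ b], rule exI[of _ "c * d"], rule exI[of _ d])
      (simp add: * mult_ac)
qed (use assms in blast)

lemma sign_square: "sign a \<Longrightarrow> a * a = 1" by auto

lemma inverse_klein [simp]: "sign a \<Longrightarrow> sign b \<Longrightarrow> inverse (klein a b) = klein a b"
  by (rule tree_iso.inverse_unique) (simp add: klein_mult sign_square)

lemma conjug_klein_x_pow: "sign a \<Longrightarrow> sign b \<Longrightarrow> conjug (klein a b) (x_pow c) = x_pow (a * c)"
  by (rule tree_iso_eqI') (simp add: rotation_conjug, simp, auto simp: conjug_def klein_mult)

lemma conjug_klein_gam_pow:
  assumes "sign a" "sign b" shows "conjug (klein a b) (gam_pow c) = gam_pow (b * c)"
proof (rule tree_iso_coinduct[of "\<lambda>g h. g = h \<or> (\<exists>a b c. sign a \<and> sign b \<and> g = conjug (klein a b) (gam_pow c) \<and> h = gam_pow (b * c))"])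
  fix g h y
  assume *: "g = h \<or> (\<exists>a b c. sign a \<and> sign b \<and> g = conjug (klein a b) (gam_pow c) \<and> h = gam_pow (b * c))"
  show "root_perm g y = root_perm h y" using * by (auto simp: root_perm_affine rotation_conjug)
  show "sec g y = sec h y \<or> (\<exists>a b c. sign a \<and> sign b \<and> sec g y = conjug (klein a b) (gam_pow c) \<and> sec h y = gam_pow (b * c))"
  proof (cases "g = h")
    case False
    then obtain a b c where ab: "sign a" "sign b" and gh: "g = conjug (klein a b) (gam_pow c)" "h = gam_pow (b * c)" using * by auto
    have "sec g (root_perm (klein a b) z) = conjug (klein (a * b) b) (sec (gam_pow c) z)" for z
      unfolding gh sec_conjug using ab by (simp add: conjug_def root_perm_affine)
    then have s: "sec g (a * z) = conjug (klein (a * b) b) (sec (gam_pow c) z)" for z using ab by simp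
    have "sec g 0 = conjug (klein (a * b) b) (gam_pow c) \<and> sec h 0 = gam_pow (b * c)" using s[of 0] gh by simp
    moreover have "sec g y = sec h y" if "y \<noteq> 0"
      using s[of 1] s[of "-1"] ab tri_cases[of y] that by (auto simp: gh(2) conjug_klein_x_pow)
    moreover have "sign (a * b)" using ab by (rule sign_mult)
    ultimately show ?thesis using ab(2) by (cases "y = 0") blast+
  qed simp
qed (use assms in blast)

lemma klein_Norm [simp]: "sign a \<Longrightarrow> sign b \<Longrightarrow> klein a b \<in> Norm Gam"
  using conjug_klein_gam_pow[of a b 1] by (intro Norm_Gam_I) (simp_all add: conjug_klein_x_pow)

lemma gam_sign_klein [simp]: "sign a \<Longrightarrow> sign b \<Longrightarrow> gam_sign (klein a b) = b"
  using conjug_klein_gam_pow[of a b 1] by (simp add: gam_sign_def)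

lemma Norm_Gam_decompose:
  assumes "h \<in> Norm Gam" shows "\<exists>a b. sign a \<and> sign b \<and> h * klein a b \<in> Norm_triv"
proof -
  have "sign (orientation h)" "sign (gam_sign h)" using orientation_cases gam_sign_cases assms by auto
  then have "h * klein (orientation h) (gam_sign h) \<in> Norm_triv" using assms by (simp add: Norm_triv_def gam_sign_mult sign_square)
  then show ?thesis using \<open>sign (orientation h)\<close> \<open>sign (gam_sign h)\<close> by blast
qed

subsection \<open>The group U as a group of polynomials\<close>

definition Delta_iso :: "tree_iso \<Rightarrow> tree_iso" where "Delta_iso g = trip g g g"

lemma sec_Delta_iso [simp]: "sec (Delta_iso g) y = g"
  using tri_cases[of y] by (auto simp: Delta_iso_def)
lemma rotation_Delta_iso [simp]: "rotation (Delta_iso g) = 0" and orientation_Delta_iso [simp]: "orientation (Delta_iso g) = 1"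
  by (simp_all add: Delta_iso_def)
lemma Delta_iso_one [simp]: "Delta_iso 1 = 1" by (simp add: Delta_iso_def trip_one)
lemma Delta_iso_mult: "Delta_iso (g * h) = Delta_iso g * Delta_iso h" by (simp add: Delta_iso_def trip_mult)
lemma inverse_Delta_iso: "inverse (Delta_iso g) = Delta_iso (inverse g)" by (simp add: Delta_iso_def inverse_trip)

lemma Delta_iso_comm: "(\<And>y. sec f y = 1) \<Longrightarrow> Delta_iso g * f = f * Delta_iso g"
  by (rule tree_iso_eqI') (simp_all add: root_perm_affine)

text \<open>\<open>phi\<close> maps the polynomial \<open>\<Sum>c\<^sub>i X\<^sup>i\<close> over the field with three elements to the product
  of the \<open>\<Delta>\<^sup>i(x)\<close> to the powers \<open>c\<^sub>i\<close>.\<close>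
definition phi :: "tri poly \<Rightarrow> tree_iso" where "phi p = fold_coeffs (\<lambda>c g. x_pow c * Delta_iso g) p 1"

lemma phi_0 [simp]: "phi 0 = 1" by (simp add: phi_def)

lemma phi_pCons: "phi (pCons c p) = x_pow c * Delta_iso (phi p)"
  by (cases "c = 0 \<and> p = 0") (auto simp: phi_def)

lemma phi_const [simp]: "phi [:c:] = x_pow c" by (simp add: phi_pCons)

lemma rotation_phi [simp]: "rotation (phi (pCons c p)) = c" and sec_phi [simp]: "sec (phi (pCons c p)) y = phi p"
  by (simp_all add: phi_pCons)

lemma orientation_phi [simp]: "orientation (phi p) = 1"
  by (cases p) (simp add: phi_pCons)

lemma phi_add: "phi (p + q) = phi p * phi q"
proof (induction p arbitrary: q)
  case (pCons a p)
  show ?case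
  proof (cases q)
    case (pCons b r)
    show ?thesis unfolding pCons add_pCons
      by (rule tree_iso_eqI') (simp_all add: pCons.IH add.commute)
  qed
qed simp

lemma inverse_phi [simp]: "inverse (phi p) = phi (- p)"
  by (rule tree_iso.inverse_unique) (simp flip: phi_add)

lemma phi_mult_cancel [simp]: "phi p * phi (- p) = 1" "phi (- p) * phi p = 1"
   "phi p * (phi (- p) * g) = g" "phi (- p) * (phi p * g) = g"
  by (simp_all flip: phi_add mult.assoc)

lemma phi_mult_diff [simp]: "phi q * phi ([:a:] - q) = x_pow a"
  by (simp flip: phi_add)

lemma phi_comm: "phi p * phi q = phi q * phi p"
  by (simp add: add.commute flip: phi_add)

lemma conjug_phi_x_pow: "conjug (phi p) (x_pow c) = x_pow c"
  using Delta_iso_comm[of "x_pow c"] x_pow_add[of c] 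
  by (intro conjug_fix, cases p) (simp add: phi_pCons mult.assoc, simp add: add.commute x_pow_merge flip: mult.assoc)

text \<open>Conjugation by \<Delta>(phi q) leaves the sections x and x^-1 of \<gamma> alone and, by
  induction, keeps the exponents of the section at 0; hence the branch relation survives.\<close>

lemma conjug_phi_gam_iso: "conjug (phi p) gam_iso \<in> Gam \<and> rotation (conjug (phi p) gam_iso) = 0 \<and> gam_exp (conjug (phi p) gam_iso) = 1"
proof (induction p)
  case (pCons c q)
  define f where "f = conjug (Delta_iso (phi q)) gam_iso"
  have f: "rotation f = 0" "orientation f = 1" by (simp_all add: f_def rotation_conjug)
  have s: "sec f 0 = conjug (phi q) gam_iso" "sec f 1 = x_pow 1" "sec f (-1) = x_pow (-1)"
    by (simp_all add: f_def sec_conjug_trip conjug_phi_x_pow)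
  have "branch_rel f" using pCons by (simp add: branch_rel_def all_tri s)
  moreover have "sec f y \<in> Gam" for y using tri_cases[of y] pCons by (auto simp: s)
  ultimately have Gam: "f \<in> Gam" using f Gam_iff[of f] by blast
  have "conjug (phi (pCons c q)) gam_iso = conjug (x_pow c) f"
    using Delta_iso_comm[of "x_pow c" "phi q"] by (simp add: f_def conjug_conjug phi_pCons)
  moreover have "gam_exp f = 1" by (simp add: gam_exp_def s)
       (use pCons in simp)
  ultimately show ?case using Gam f by (simp add: gam_exp_conjug[of "x_pow c" f] Gam_conjug rotation_conjug)
qed simp

lemma phi_Norm_triv [simp]: "phi p \<in> Norm_triv"
proof -
  have "phi p \<in> Norm Gam"
    using conjug_phi_gam_iso[of p] conjug_phi_gam_iso[of "- p"] by (intro Norm_Gam_I) (simp_all add: conjug_phi_x_pow)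
  then show ?thesis using conjug_phi_gam_iso[of p] by (simp add: Norm_triv_def gam_sign_def)
qed

text \<open>The class \<open>p\<close> of an element of \<open>\<Gamma> U\<close> is determined up to its constant term only, because \<open>x \<in> \<Gamma>\<close>.\<close>
definition Gam_U_class :: "tri poly \<Rightarrow> tree_iso \<Rightarrow> bool" where "Gam_U_class p h \<longleftrightarrow> h * phi (- p) \<in> Gam"
definition Gam_U :: "tree_iso set" where "Gam_U = {h. \<exists>p. Gam_U_class p h}"

lemma Gam_U_class_iff: "Gam_U_class p h \<longleftrightarrow> (\<exists>g\<in>Gam. h = g * phi p)"
proof
  assume "Gam_U_class p h"
  then show "\<exists>g\<in>Gam. h = g * phi p" unfolding Gam_U_class_def
    by (intro bexI[of _ "h * phi (- p)"]) (simp add: mult.assoc)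
qed (auto simp: Gam_U_class_def mult.assoc)

lemma Gam_U_class_0 [simp]: "Gam_U_class 0 g \<longleftrightarrow> g \<in> Gam" by (simp add: Gam_U_class_def)
lemma Gam_U_class_phi [simp]: "Gam_U_class p (phi p)" by (simp add: Gam_U_class_def)

lemma Gam_U_class_Norm_triv: "Gam_U_class p h \<Longrightarrow> h \<in> Norm_triv"
  by (auto simp: Gam_U_class_iff)
lemma Gam_U_Norm_triv: "h \<in> Gam_U \<Longrightarrow> h \<in> Norm_triv"
  by (auto simp: Gam_U_def Gam_U_class_Norm_triv)
lemma Norm_triv_Norm: "h \<in> Norm_triv \<Longrightarrow> h \<in> Norm Gam" by (simp add: Norm_triv_def)
lemma Norm_triv_orientation: "h \<in> Norm_triv \<Longrightarrow> orientation h = 1" by (simp add: Norm_triv_def)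

lemma Gam_U_class_mult:
  assumes "Gam_U_class p g" "Gam_U_class q h" shows "Gam_U_class (p + q) (g * h)"
proof -
  obtain a b where ab: "a \<in> Gam" "g = a * phi p" "b \<in> Gam" "h = b * phi q" using assms by (auto simp: Gam_U_class_iff)
  have "g * h = a * conjug (phi (- p)) b * phi (p + q)" by (simp add: ab conjug_def phi_add mult.assoc)
  then show ?thesis using ab by (auto simp: Gam_U_class_iff Norm_triv_conjug)
qed

lemma Gam_U_class_inverse:
  assumes "Gam_U_class p h" shows "Gam_U_class (- p) (inverse h)"
proof -
  obtain a where a: "a \<in> Gam" "h = a * phi p" using assms by (auto simp: Gam_U_class_iff)
  have "inverse h = conjug (phi p) (inverse a) * phi (- p)" by (simp add: a conjug_def mult.assoc)
  then show ?thesis using a by (metis Gam_U_class_iff Gam_inverse Norm_triv_conjug phi_Norm_triv)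
qed

lemma Gam_U_class_mult_Gam: "Gam_U_class p h \<Longrightarrow> g \<in> Gam \<Longrightarrow> Gam_U_class p (h * g)" "Gam_U_class p h \<Longrightarrow> g \<in> Gam \<Longrightarrow> Gam_U_class p (g * h)"
  using Gam_U_class_mult[of p h 0 g] Gam_U_class_mult[of 0 g p h] by auto

text \<open>The three sections coincide, so the branch relation forces their rotation to be 0.
  Consequently \<Gamma> and U intersect trivially.\<close>

lemma phi_Gam_iff: "phi p \<in> Gam \<longleftrightarrow> (\<exists>c. p = [:c:])"
proof
  show "phi p \<in> Gam \<Longrightarrow> \<exists>c. p = [:c:]"
  proof (induction p)
    case (pCons c q)
    have "phi q \<in> Gam" using Gam_sec[OF pCons.prems, of 0] by simp
    then obtain d where d: "q = [:d:]" using pCons.IH by blast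
    then have "d = 0" using relD[OF Gam_branch_rel[OF pCons.prems], of 0] by simp
    then show ?case using d by simp
  qed (auto intro: exI[of _ 0])
qed auto

lemma Gam_U_class_add_const [simp]: "Gam_U_class (p + [:c:]) h \<longleftrightarrow> Gam_U_class p h"
proof -
  have "h * phi (- (p + [:c:])) = h * phi (- p) * x_pow (- c)"
    using phi_add[of "- p" "[:- c:]"] by (simp add: mult.assoc)
  moreover have "g * x_pow (- c) \<in> Gam \<longleftrightarrow> g \<in> Gam" for g
    using Gam_mult[of "g * x_pow (- c)" "x_pow c"] by (auto simp: mult.assoc simp del: Gam_mult) (simp add: Gam_mult)
  ultimately show ?thesis by (simp only: Gam_U_class_def)
qed

lemma Gam_U_class_unique:
  assumes "Gam_U_class p h" "Gam_U_class q h" shows "\<exists>c. q = p + [:c:]"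
proof -
  have "Gam_U_class (p - q) (h * inverse h)" using Gam_U_class_mult[OF assms(1) Gam_U_class_inverse[OF assms(2)]] by simp
  then have "phi (- (p - q)) \<in> Gam" by (simp add: Gam_U_class_def)
  then obtain c where "q - p = [:c:]" by (auto simp: phi_Gam_iff)
  then have "q = p + [:c:]" by (simp add: algebra_simps)
  then show ?thesis by blast
qed

lemma Gam_U_class_Gam_U: "Gam_U_class p h \<Longrightarrow> h \<in> Gam_U" by (auto simp: Gam_U_def)
lemma Gam_Gam_U [simp]: "g \<in> Gam \<Longrightarrow> g \<in> Gam_U" using Gam_U_class_Gam_U[of 0] by simp
lemma phi_Gam_U [simp]: "phi p \<in> Gam_U" using Gam_U_class_Gam_U[OF Gam_U_class_phi] .

lemma is_subgroup_Gam_U: "is_subgroup Gam_U"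
  unfolding is_subgroup_def using Gam_Gam_U[OF Gam_one]
  by (auto simp: Gam_U_def dest: Gam_U_class_mult Gam_U_class_inverse)

lemma Gam_U_mult [simp]: "g \<in> Gam_U \<Longrightarrow> h \<in> Gam_U \<Longrightarrow> g * h \<in> Gam_U"
  and Gam_U_inverse [simp]: "g \<in> Gam_U \<Longrightarrow> inverse g \<in> Gam_U"
  using is_subgroup_Gam_U by (auto simp: is_subgroup_def)

lemma Gam_U_class_conjug: "h \<in> Gam_U \<Longrightarrow> Gam_U_class p g \<Longrightarrow> Gam_U_class p (conjug h g)"
proof -
  assume "h \<in> Gam_U" "Gam_U_class p g"
  then obtain q where q: "Gam_U_class q h" by (auto simp: Gam_U_def)
  from Gam_U_class_mult[OF Gam_U_class_mult[OF Gam_U_class_inverse[OF q] \<open>Gam_U_class p g\<close>] q] show ?thesis by (simp add: conjug_def)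
qed

lemma Gam_U_class_sec: "Gam_U_class (pCons c q) h \<Longrightarrow> Gam_U_class q (sec h y)"
  by (auto simp: Gam_U_class_iff)

lemma Gam_U_sec:
  assumes "h \<in> Gam_U" shows "\<exists>q. \<forall>y. Gam_U_class q (sec h y)"
proof -
  obtain p where "Gam_U_class p h" using assms by (auto simp: Gam_U_def)
  moreover obtain c q where "p = pCons c q" by (cases p)
  ultimately show ?thesis using Gam_U_class_sec by blast
qed

section \<open>A branch criterion for \<Gamma>U\<close>

definition defect :: "(tri \<Rightarrow> tree_iso) \<Rightarrow> tri \<Rightarrow> tri" where
  "defect c y = rotation (c y) - (gam_exp (c (y - 1)) - gam_exp (c (y + 1)))"

text \<open>A power of \<Delta>(x) shifts all three rotations equally and keeps the
  \<gamma>-exponents, so exactly the constant violations of the branch relation can be repaired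
  within \<Gamma>U.\<close>

lemma Gam_U_branch:
  assumes "orientation h = 1" "\<And>y. sec h y = c y * phi q" "\<And>y. c y \<in> Gam"
  shows "h \<in> Gam_U \<longleftrightarrow> (\<exists>d. \<forall>y. defect c y = d)"
proof
  assume "\<exists>d. \<forall>y. defect c y = d"
  then obtain d where d: "defect c y = d" for y by blast
  define f where "f = h * phi (- pCons 0 (q + [:d:]))"
  have f: "sec f y = c y * x_pow (- d)" for y
    by (simp add: f_def assms mult.assoc phi_add)
  have "branch_rel f" unfolding branch_rel_def f
    using d by (simp add: assms(3) defect_def algebra_simps) 
  moreover have "orientation f = 1" using assms(1) by (simp add: f_def)
  moreover have "sec f y \<in> Gam" for y by (simp add: f assms(3))
  ultimately have "f \<in> Gam" using Gam_iff[of f] by blast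
  then show "h \<in> Gam_U" using Gam_U_class_Gam_U[of "pCons 0 (q + [:d:])"] by (simp add: Gam_U_class_def f_def)
next
  assume "h \<in> Gam_U"
  then obtain p where p: "Gam_U_class p h" by (auto simp: Gam_U_def)
  obtain e r where r: "p = pCons e r" by (cases p)
  have "Gam_U_class r (sec h 0)" using p r Gam_U_class_sec by blast
  moreover have "Gam_U_class q (sec h 0)" using assms(2,3) by (auto simp: Gam_U_class_iff)
  \<comment> \<open>The class of a section is known only up to its constant term; this ambiguity
    becomes the common defect.\<close>
  ultimately obtain d where d: "r = q + [:d:]" using Gam_U_class_unique by blast
  define f where "f = h * phi (- p)"
  have "f \<in> Gam" using p by (simp add: f_def Gam_U_class_def)
  moreover have f: "sec f y = c y * x_pow (- d)" for y
    by (simp add: f_def assms r d mult.assoc phi_add)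
  ultimately have "defect c y = d" for y
    using relD[OF Gam_branch_rel, of f y] by (simp add: f assms(3) defect_def algebra_simps)
  then show "\<exists>d. \<forall>y. defect c y = d" by blast
qed

text \<open>The sections are congruent modulo \<Gamma>, hence of one class. The branch relation of
  \<open>x\<^sup>h\<close>, whose sections are quotients of neighbours, says precisely that the
  defect does not change from one vertex to the next.\<close>

lemma Norm_triv_Gam_U_sec:
  assumes "h \<in> Norm_triv" "sec h z \<in> Gam_U" shows "h \<in> Gam_U"
proof -
  obtain q where q: "Gam_U_class q (sec h z)" using assms by (auto simp: Gam_U_def)
  have Norm: "h \<in> Norm Gam" using assms by (simp add: Norm_triv_def)
  define c where "c y = sec h y * phi (- q)" for y
  have c: "c y \<in> Gam" "sec h y = c y * phi q" for y
    using Gam_U_class_mult_Gam(1)[OF q normal_sections[OF Norm, of z y]] by (simp_all add: c_def Gam_U_class_def mult.assoc)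
  define g where "g = conjug h (x_pow 1)"
  have g: "g \<in> Gam" using assms by (simp add: g_def Norm_triv_conjug)
  have orientation: "orientation h = 1" using assms by (simp add: Norm_triv_def)
  have s: "sec g (y + rotation h) = conjug (phi q) (inverse (c y) * c (y + 1))" for y
    using sec_conjug[of h "x_pow 1" y] by (simp add: g_def root_perm_affine orientation c conjug_def mult.assoc add_ac)
  have Sign_kernel: "rotation (sec g (y + rotation h)) = rotation (c (y + 1)) - rotation (c y)"
   and A: "gam_exp (sec g (y + rotation h)) = gam_exp (c (y + 1)) - gam_exp (c y)" for y
    using Norm_triv_act[OF phi_Norm_triv, of "inverse (c y) * c (y + 1)" q] by (simp_all add: s c)
  have d: "defect c (y + 1) = defect c y" for y
  proof -
    have y: "y - 1 + rotation h = y + rotation h - 1" "y + 1 + rotation h = y + rotation h + 1" "y + 1 + 1 = y - 1"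
      by (simp_all add: algebra_simps)
    have "rotation (c (y + 1)) - rotation (c y) = (gam_exp (c y) - gam_exp (c (y - 1))) - (gam_exp (c (y - 1)) - gam_exp (c (y + 1)))"
      using relD[OF Gam_branch_rel[OF g], of "y + rotation h"] Sign_kernel[of y] A[of "y - 1"] A[of "y + 1"]
      unfolding y by simp
    then have "rotation (c (y + 1)) = rotation (c y) + ((gam_exp (c y) - gam_exp (c (y - 1))) - (gam_exp (c (y - 1)) - gam_exp (c (y + 1))))"
      by (simp add: algebra_simps)
    then show ?thesis unfolding defect_def y by (simp add: algebra_simps)
  qed
  have "defect c y = defect c 0" for y
    using tri_cases[of y] d[of 0] d[of "-1"] by auto
  then show ?thesis using Gam_U_branch[OF orientation c(2,1)] by blast
qed

subsection \<open>Contraction\<close>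

definition gam_len :: "tree_iso \<Rightarrow> nat" where "gam_len g = (LEAST n. gam_len_le n g)"

lemma gam_len_le_gam_len: "g \<in> Gam \<Longrightarrow> gam_len_le (gam_len g) g"
  unfolding gam_len_def Gam_def by (auto intro: LeastI)
lemma gam_len_le: "gam_len_le n g \<Longrightarrow> gam_len g \<le> n"
  unfolding gam_len_def by (rule Least_le)

text \<open>Each letter \<gamma> is passed on as \<gamma> to exactly one section and as a power of x
  to the others, so the lengths add up. If one section receives all letters, they merge into a
  single power of \<gamma>.\<close>

lemma gam_len_le_sections:
  assumes "gam_len_le n g"
  shows "\<exists>m. m 0 + m 1 + m (-1) = n \<and> (\<forall>y. gam_len_le (m y) (sec g y)) \<and>
    (\<forall>y. m y = n \<longrightarrow> (\<exists>s k. g = x_pow (- y) * gam_pow s * x_pow k))"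
  using assms
proof induction
  case gam_len_le_one
  have "\<exists>s k. 1 = x_pow (- y) * gam_pow s * x_pow k" for y
    by (intro exI[of _ 0] exI[of _ y]) simp
  then show ?case by (intro exI[of _ "\<lambda>_. 0"]) (auto intro: gam_len_le.gam_len_le_one)
next
  case (gam_len_le_x_pow n g c)
  then obtain m where m: "m 0 + m 1 + m (-1) = n" "\<And>y. gam_len_le (m y) (sec g y)"
    "\<And>y. m y = n \<Longrightarrow> \<exists>s k. g = x_pow (- y) * gam_pow s * x_pow k" by blast
  have "\<exists>s k. g * x_pow c = x_pow (- y) * gam_pow s * x_pow k" if "m y = n" for y
    using m(3)[OF that] by (auto simp: mult.assoc x_pow_merge) blast
  then show ?case using m(1,2) by (intro exI[of _ m]) auto
next
  case (gam_len_le_gam_pow n g c)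
  then obtain m where m: "m 0 + m 1 + m (-1) = n" "\<And>y. gam_len_le (m y) (sec g y)"
    "\<And>y. m y = n \<Longrightarrow> \<exists>s k. g = x_pow (- y) * gam_pow s * x_pow k" by blast
  \<comment> \<open>The vertex that \<open>g\<close> maps to 0, where the new letter keeps its
    \<gamma>.\<close>
  define z where "z = - rotation g"
  define m' where "m' = m(z := Suc (m z))"
  have Gam: "g \<in> Gam" using gam_len_le_gam_pow by (auto simp: Gam_def)
  have "m' 0 + m' 1 + m' (-1) = Suc n"
    using m(1) tri_cases[of z] by (auto simp: m'_def)
  moreover have "gam_len_le (m' y) (sec (g * gam_pow c) y)" for y
  proof (cases "y = z")
    case True
    then show ?thesis using gam_len_le.gam_len_le_gam_pow[OF m(2)[of z], of c] Gam by (simp add: m'_def z_def root_perm_affine)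
  next
    case False
    then have "rotation g + y \<noteq> 0" by (auto simp: z_def eq_neg_iff_add_eq_0 add.commute)
    then obtain d where "sec (gam_pow c) (rotation g + y) = x_pow d" using tri_cases[of "rotation g + y"] by auto
    then show ?thesis using gam_len_le.gam_len_le_x_pow[OF m(2)[of y], of d] Gam False by (simp add: m'_def root_perm_affine)
  qed
  moreover have "\<exists>s k. g * gam_pow c = x_pow (- y) * gam_pow s * x_pow k" if "m' y = Suc n" for y
  proof -
    have "m y \<le> n" using m(1) tri_cases[of y] by auto
    then have y: "y = z" "m z = n" using that by (auto simp: m'_def split: if_splits)
    then obtain s k where g: "g = x_pow (- z) * gam_pow s * x_pow k" using m(3) by blast
    have "rotation g = - z + k" by (subst g) (simp add: add.commute)
    then have "k = 0" unfolding z_def minus_minus by (metis add_cancel_left_right)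
    then have "g * gam_pow c = x_pow (- z) * gam_pow (s + c) * x_pow 0" by (subst g) (simp add: gam_pow_add mult.assoc)
    then show ?thesis using y by blast
  qed
  ultimately show ?case by blast
qed

text \<open>The section at 0 is the only section of \<gamma> with nonzero \<gamma>-exponent, so
  \<open>f\<close> has to fix the vertex 0.\<close>

lemma fix_gam_iso_sections:
  assumes "f \<in> Norm_triv" "conjug f gam_iso = gam_iso"
  shows "rotation f = 0" "conjug (sec f 0) gam_iso = gam_iso" "conjug (sec f 1) (x_pow 1) = x_pow 1" "conjug (sec f (-1)) (x_pow 1) = x_pow 1"
proof -
  have orientation: "orientation f = 1" using assms by (simp add: Norm_triv_orientation)
  have "sec gam_iso (rotation f) = conjug (sec f 0) gam_iso"
    using sec_conjug[of f gam_iso 0] unfolding assms(2) by (simp add: root_perm_affine orientation conjug_def)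
  then have "gam_exp (sec gam_iso (rotation f)) = 1" using Norm_triv_act[OF Norm_triv_sec[OF assms(1)], of gam_iso 0] by simp
  then show rotation: "rotation f = 0" using tri_cases[of "rotation f"] by auto
  have s: "sec gam_iso y = conjug (sec f y) (sec gam_iso y)" for y
    using sec_conjug_trip[OF rotation orientation, of gam_iso y] assms(2) by simp
  show "conjug (sec f 0) gam_iso = gam_iso" "conjug (sec f 1) (x_pow 1) = x_pow 1" using s[of 0] s[of 1] by simp_all
  have "inverse (x_pow (-1)) = inverse (conjug (sec f (-1)) (x_pow (-1)))" using s[of "-1"] by simp
  then show "conjug (sec f (-1)) (x_pow 1) = x_pow 1" unfolding conjug_inverse[symmetric] by simp
qed

lemma fix_x_pow_sections:
  assumes "rotation f = 0" "orientation f = 1"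
  shows "sec (conjug f (x_pow 1)) y = inverse (sec f y) * sec f (y + 1)"
  using assms by (simp add: sec_conjug_id root_perm_x_pow)

text \<open>Commuting with x makes all sections of \<open>f\<close> equal; the one at 0 commutes
  with \<gamma> and the one at 1 with x, so the hypotheses pass to every section.\<close>

lemma fix_generators:
  assumes "f \<in> Norm_triv" "conjug f (x_pow 1) = x_pow 1" "conjug f gam_iso = gam_iso"
  shows "f = 1"
proof (rule tree_iso_coinduct[of "\<lambda>f h. h = 1 \<and> f \<in> Norm_triv \<and> conjug f (x_pow 1) = x_pow 1 \<and> conjug f gam_iso = gam_iso"])
  fix f h :: tree_iso and y assume "h = 1 \<and> f \<in> Norm_triv \<and> conjug f (x_pow 1) = x_pow 1 \<and> conjug f gam_iso = gam_iso"
  then have f: "f \<in> Norm_triv" "conjug f (x_pow 1) = x_pow 1" "conjug f gam_iso = gam_iso" and h: "h = 1" by auto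
  note fs = fix_gam_iso_sections[OF f(1,3)]
  have "inverse (sec f z) * sec f (z + 1) = 1" for z
    using fix_x_pow_sections[OF fs(1) Norm_triv_orientation[OF f(1)], of z] f(2) by simp
  then have "sec f z = sec f (z + 1)" for z using tree_iso_eq_iff by blast
  from this[of 0] this[of 1] have "sec f y = sec f 0 \<and> sec f y = sec f 1" using tri_cases[of y] by auto
  then show "sec h y = 1 \<and> sec f y \<in> Norm_triv \<and> conjug (sec f y) (x_pow 1) = x_pow 1 \<and> conjug (sec f y) gam_iso = gam_iso"
    using fs Norm_triv_sec[OF f(1)] h by auto
  show "root_perm f y = root_perm h y" using fs Norm_triv_orientation[OF f(1)] h by (simp add: root_perm_affine)
qed (use assms in auto)

text \<open>The sections of \<open>f\<close> at 1 and -1 centralize x, so multiplying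
  \<open>sec f 0\<close> on the left by their inverses does not change its effect on x, and these
  quotients are read off \<open>x\<^sup>f\<close>. The price is that a length may double.\<close>

lemma fix_gam_iso_conj:
  assumes f: "f \<in> Norm_triv" "conjug f gam_iso = gam_iso"
  shows "conjug (sec f 0) (x_pow 1) = sec (conjug f (x_pow 1)) 0 * x_pow 1 * inverse (sec (conjug f (x_pow 1)) 0)"
    and "conjug (sec f 0) (x_pow 1) = inverse (sec (conjug f (x_pow 1)) (-1)) * x_pow 1 * sec (conjug f (x_pow 1)) (-1)"
proof -
  note fs = fix_gam_iso_sections[OF f]
  have s: "sec (conjug f (x_pow 1)) y = inverse (sec f y) * sec f (y + 1)" for y
    by (rule fix_x_pow_sections[OF fs(1) Norm_triv_orientation[OF f(1)]])
  have "conjug (sec f 0) (x_pow 1) = conjug (inverse (sec f 1) * sec f 0) (x_pow 1)"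
    using conjug_cancel(2)[of "sec f 1" "x_pow 1"] unfolding fs(3) by (simp flip: conjug_conjug)
  then show "conjug (sec f 0) (x_pow 1) = sec (conjug f (x_pow 1)) 0 * x_pow 1 * inverse (sec (conjug f (x_pow 1)) 0)"
    unfolding s by (simp add: conjug_def mult.assoc)
  have "conjug (sec f 0) (x_pow 1) = conjug (inverse (sec f (-1)) * sec f 0) (x_pow 1)"
    using conjug_cancel(2)[of "sec f (-1)" "x_pow 1"] unfolding fs(4) by (simp flip: conjug_conjug)
  then show "conjug (sec f 0) (x_pow 1) = inverse (sec (conjug f (x_pow 1)) (-1)) * x_pow 1 * sec (conjug f (x_pow 1)) (-1)"
    unfolding s by (simp add: conjug_def mult.assoc)
qed

lemma fix_gam_iso_gam_len_le:
  assumes f: "f \<in> Norm_triv" "conjug f gam_iso = gam_iso"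
    and "gam_len_le a (sec (conjug f (x_pow 1)) 0) \<or> gam_len_le a (sec (conjug f (x_pow 1)) (-1))"
  shows "gam_len_le (a + a) (conjug (sec f 0) (x_pow 1))"
  using assms(3)
proof
  assume gam_len_le: "gam_len_le a (sec (conjug f (x_pow 1)) 0)"
  show ?thesis unfolding fix_gam_iso_conj(1)[OF f] by (intro gam_len_le_mult[OF gam_len_le_inverse[OF gam_len_le]] gam_len_le.gam_len_le_x_pow gam_len_le)
next
  assume gam_len_le: "gam_len_le a (sec (conjug f (x_pow 1)) (-1))"
  show ?thesis unfolding fix_gam_iso_conj(2)[OF f] by (intro gam_len_le_mult[OF gam_len_le] gam_len_le.gam_len_le_x_pow gam_len_le_inverse[OF gam_len_le])
qed

text \<open>The number of occurrences of \<open>\<gamma>\<close> in \<open>x\<^sup>f\<close> drops when \<open>f\<close> is replaced by its section at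
  0 or at 00, unless that section already lies in \<open>\<Gamma>\<close>.\<close>
lemma fix_gam_iso_Gam_U: "f \<in> Norm_triv \<Longrightarrow> conjug f gam_iso = gam_iso \<Longrightarrow> f \<in> Gam_U"
proof (induction "gam_len (conjug f (x_pow 1))" arbitrary: f rule: less_induct)
  case less
  note f = less.prems
  note fs = fix_gam_iso_sections[OF f]
  define M where "M = gam_len (conjug f (x_pow 1))"
  define h where "h = sec f 0"
  have h: "h \<in> Norm_triv" "conjug h gam_iso = gam_iso" using fs Norm_triv_sec[OF f(1)] by (auto simp: h_def)
  note hs = fix_gam_iso_sections[OF h]
  have IH: "k \<in> Gam_U" if "k \<in> Norm_triv" "conjug k gam_iso = gam_iso" "gam_len_le n (conjug k (x_pow 1))" "n < M" for k n
    using less.hyps[of k] that gam_len_le[OF that(3)] by (simp add: M_def)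
  have "conjug f (x_pow 1) \<in> Gam" using f(1) by (simp add: Norm_triv_conjug)
  then obtain m where m: "m 0 + m 1 + m (-1) = M" "\<And>y. gam_len_le (m y) (sec (conjug f (x_pow 1)) y)"
    using gam_len_le_sections[OF gam_len_le_gam_len] M_def by metis
  note hB = fix_gam_iso_gam_len_le[OF f, folded h_def]
  have "h \<in> Gam_U"
  \<comment> \<open>Either bound doubles a section length, so one level gives descent unless both
    sections carry exactly half of the letters.\<close>
  proof (cases "m 0 + m 0 < M \<or> m (-1) + m (-1) < M")
    case True
    then show ?thesis using IH[OF h] hB m(2) by blast
  next
    case False
    \<comment> \<open>No descent at level one. The section \<open>g\<close> of length at most
      \<open>m 0 = M / 2\<close> is now split once more, to bound x conjugated by the section of
      \<open>f\<close> at 00.\<close>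
    then have M: "M = m 0 + m 0" using m(1) by linarith
    define g where "g = sec (conjug f (x_pow 1)) 0"
    have g_eq: "g = inverse h * sec f 1"
      using fix_x_pow_sections[OF fs(1) Norm_triv_orientation[OF f(1)], of 0] by (simp add: g_def h_def)
    have "gam_len_le (m 0) g" using m(2) by (simp add: g_def)
    then obtain n where n: "n 0 + n 1 + n (-1) = m 0" "\<And>y. gam_len_le (n y) (sec g y)"
      "\<And>y. n y = m 0 \<Longrightarrow> \<exists>s k. g = x_pow (- y) * gam_pow s * x_pow k"
      using gam_len_le_sections by metis
    have orientation: "orientation g = 1" using m(2) by (metis Gam_def Gam_orientation g_def mem_Collect_eq)
    have hx: "conjug h (x_pow 1) = g * x_pow 1 * inverse g"
      using fix_gam_iso_conj(1)[OF f] by (simp add: g_def h_def)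
    have hsec: "sec (conjug h (x_pow 1)) y = sec g y * inverse (sec g (y + 1))" for y
      unfolding hx by (simp add: root_perm_affine orientation sec_inverse add_ac)
    have b: "gam_len_le (n 1 + n 0) (sec (conjug h (x_pow 1)) 0)" "gam_len_le (n 0 + n (-1)) (sec (conjug h (x_pow 1)) (-1))"
      unfolding hsec using gam_len_le_mult[OF gam_len_le_inverse[OF n(2)[of 1]] n(2)[of 0]] gam_len_le_mult[OF gam_len_le_inverse[OF n(2)[of 0]] n(2)[of "-1"]]
      by (simp_all add: add.commute)
    show ?thesis
    proof (cases "n 1 + n 0 < m 0 \<or> n 0 + n (-1) < m 0")
      case True
      have *: "sec h 0 \<in> Norm_triv" "conjug (sec h 0) gam_iso = gam_iso" using hs Norm_triv_sec[OF h(1)] by auto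
      have "sec h 0 \<in> Gam_U"
        using True
      proof
        assume "n 1 + n 0 < m 0"
        then show ?thesis by (intro IH[OF * fix_gam_iso_gam_len_le[OF h]]) (use b(1) M in auto)
      next
        assume "n 0 + n (-1) < m 0"
        then show ?thesis by (intro IH[OF * fix_gam_iso_gam_len_le[OF h]]) (use b(2) M in auto)
      qed
      then show ?thesis by (rule Norm_triv_Gam_U_sec[OF h(1)])
    next
      case False
      \<comment> \<open>Both sums reach \<open>m 0\<close> only if all letters of \<open>g\<close>
        sit at the vertex 0, and then \<open>g\<close> is a power of \<gamma> times a power of
        x.\<close>
      then have "n 0 = m 0" using n(1) by linarith
      then obtain s k where "g = gam_pow s * x_pow k" using n(3)[of 0] by auto
      \<comment> \<open>The left side commutes with \<gamma> and the right side with x, so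
        \<open>fix_generators\<close> makes this element trivial.\<close>
      then have e: "h * gam_pow s = sec f 1 * x_pow (- k)" using g_eq
        by (metis inverse_cancel(2) mult.assoc x_pow_mult_cancel(1) mult.right_neutral)
      have "conjug (h * gam_pow s) (x_pow 1) = x_pow 1"
        unfolding e conjug_conjug[symmetric] fs(3) by (simp add: conjug_def x_pow_merge)
      moreover have "conjug (h * gam_pow s) gam_iso = gam_iso"
        using gam_pow_add[of s 1] gam_pow_add[of 1 s] unfolding conjug_conjug[symmetric] h(2)
        by (intro conjug_fix) (simp add: add.commute)
      ultimately have "h * gam_pow s = 1" using h(1) by (intro fix_generators) simp_all
      then have "h = gam_pow (- s)" by (metis inverse_gam_pow tree_iso.inverse_unique tree_iso.inverse_inverse)
      then show ?thesis by simp
    qed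
  qed
  then show ?case unfolding h_def by (rule Norm_triv_Gam_U_sec[OF f(1)])
qed

text \<open>The section of \<open>\<gamma>\<^sup>h\<close> at \<open>rotation h\<close> is \<gamma>
  conjugated by \<open>sec h 0\<close>. If it is not shorter, the exponents identify
  \<open>\<gamma>\<^sup>h\<close> with a conjugate of \<gamma> by a power of x, reducing to the case
  where \<gamma> is fixed.\<close>

lemma Norm_triv_Gam_U: "h \<in> Norm_triv \<Longrightarrow> h \<in> Gam_U"
proof (induction "gam_len (conjug h gam_iso)" arbitrary: h rule: less_induct)
  case less
  note h = less.prems
  define k where "k = rotation h"
  have orientation: "orientation h = 1" using h by (rule Norm_triv_orientation)
  have Gam: "conjug h gam_iso \<in> Gam" using h by (simp add: Norm_triv_conjug)
  obtain m where m: "m 0 + m 1 + m (-1) = gam_len (conjug h gam_iso)" "\<And>y. gam_len_le (m y) (sec (conjug h gam_iso) y)"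
    "\<And>y. m y = gam_len (conjug h gam_iso) \<Longrightarrow> \<exists>s k. conjug h gam_iso = x_pow (- y) * gam_pow s * x_pow k"
    using gam_len_le_sections[OF gam_len_le_gam_len[OF Gam]] by metis
  have s: "sec (conjug h gam_iso) k = conjug (sec h 0) gam_iso"
    using sec_conjug[of h gam_iso 0] by (simp add: root_perm_affine orientation conjug_def k_def)
  show ?case
  proof (cases "m k < gam_len (conjug h gam_iso)")
    case True
    then have "gam_len (conjug (sec h 0) gam_iso) < gam_len (conjug h gam_iso)" using gam_len_le[OF m(2)[of k]] by (simp add: s)
    from less.hyps[OF this Norm_triv_sec[OF h]] show ?thesis by (rule Norm_triv_Gam_U_sec[OF h])
  next
    case False
    then have "m k = gam_len (conjug h gam_iso)" using m(1) tri_cases[of k] by auto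
    then obtain s j where sj: "conjug h gam_iso = x_pow (- k) * gam_pow s * x_pow j" using m(3) by blast
    have "j = k" using arg_cong[OF sj, of rotation] Norm_triv_act[OF h, of gam_iso] by simp
    moreover have "s = 1" using arg_cong[OF sj, of gam_exp] Norm_triv_act[OF h, of gam_iso] by simp
    ultimately have e: "conjug h gam_iso = conjug (x_pow k) gam_iso" using sj by (simp add: conjug_def)
    have "conjug (h * x_pow (- k)) gam_iso = gam_iso"
      unfolding conjug_conjug[symmetric] e by (simp add: conjug_conjug)
    then have "h * x_pow (- k) \<in> Gam_U" using h by (intro fix_gam_iso_Gam_U) simp_all
    then have "h * x_pow (- k) * x_pow k \<in> Gam_U" using Gam_U_mult[of _ "x_pow k"] by simp
    then show ?thesis by (simp add: mult.assoc)
  qed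
qed

lemma Norm_Gam_iff: "h \<in> Norm Gam \<longleftrightarrow> (\<exists>f\<in>Gam_U. \<exists>a b. sign a \<and> sign b \<and> h = f * klein a b)"
proof
  assume "h \<in> Norm Gam"
  then obtain a b where ab: "sign a" "sign b" "h * klein a b \<in> Gam_U" using Norm_Gam_decompose Norm_triv_Gam_U by blast
  then have "h = (h * klein a b) * klein a b" by (simp add: mult.assoc klein_mult sign_square)
  then show "\<exists>f\<in>Gam_U. \<exists>a b. sign a \<and> sign b \<and> h = f * klein a b" using ab by blast
next
  assume "\<exists>f\<in>Gam_U. \<exists>a b. sign a \<and> sign b \<and> h = f * klein a b"
  then obtain f a b where "f \<in> Gam_U" "sign a" "sign b" "h = f * klein a b" by blast
  then show "h \<in> Norm Gam" using Norm_triv_Norm[OF Gam_U_Norm_triv] by simp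
qed

subsection \<open>The second and third normalizers\<close>

text \<open>Together with \<open>orientation\<close> this is a sign character of all of W, hence
  invariant under conjugation by arbitrary isometries.\<close>

definition sign_level1 :: "tree_iso \<Rightarrow> tri" where "sign_level1 g = (\<Prod>y\<in>UNIV. orientation (sec g y))"
definition Sign_kernel :: "tree_iso set" where "Sign_kernel = {g. orientation g = 1 \<and> sign_level1 g = 1}"

lemma sign_level1_mult [simp]: "sign_level1 (g * h) = sign_level1 g * sign_level1 h"
proof -
  have "(\<Prod>y\<in>UNIV. orientation (sec h (root_perm g y))) = sign_level1 h"
    unfolding sign_level1_def by (rule prod.reindex_bij_betw[OF root_perm_bij])
  then show ?thesis by (simp add: sign_level1_def prod.distrib)
qed

lemma sign_level1_one [simp]: "sign_level1 1 = 1" by (simp add: sign_level1_def)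

lemma sign_level1_conjug [simp]: "sign_level1 (conjug h g) = sign_level1 g"
proof -
  have "sign_level1 (inverse h) * sign_level1 h = 1" by (simp flip: sign_level1_mult)
  then show ?thesis unfolding conjug_def sign_level1_mult by (metis mult.assoc mult.commute mult.right_neutral)
qed

lemma Sign_kernel_conjug [simp]: "conjug h g \<in> Sign_kernel \<longleftrightarrow> g \<in> Sign_kernel" by (simp add: Sign_kernel_def)
lemma Sign_kernel_mult: "g \<in> Sign_kernel \<Longrightarrow> h \<in> Sign_kernel \<Longrightarrow> g * h \<in> Sign_kernel" by (simp add: Sign_kernel_def)

lemma prod_tri: "(\<Prod>y\<in>UNIV. f y) = f 0 * f 1 * f (-1::tri)"
  by (simp add: UNIV_tri tri_const mult.assoc)

lemma Gam_U_Sign_kernel [simp]: "h \<in> Gam_U \<Longrightarrow> h \<in> Sign_kernel"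
  using Gam_U_Norm_triv[of h] Norm_triv_sec[of h] by (simp add: Sign_kernel_def Norm_triv_orientation sign_level1_def)

lemma sign_level1_klein: "sign a \<Longrightarrow> sign b \<Longrightarrow> sign_level1 (klein a b) = a * b"
  unfolding sign_level1_def prod_tri by auto

definition Aut_Gamma :: "tree_iso set" where "Aut_Gamma = Norm Gam"

lemma is_subgroup_Aut_Gamma: "is_subgroup Aut_Gamma"
  by (simp add: Aut_Gamma_def is_subgroup_Norm)

lemma Aut_Gamma_mult [simp]: "g \<in> Aut_Gamma \<Longrightarrow> h \<in> Aut_Gamma \<Longrightarrow> g * h \<in> Aut_Gamma"
  and Aut_Gamma_inverse [simp]: "g \<in> Aut_Gamma \<Longrightarrow> inverse g \<in> Aut_Gamma"
  by (simp_all add: Aut_Gamma_def)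

lemma Aut_Gamma_cases:
  assumes "n \<in> Aut_Gamma" obtains f a b where "f \<in> Gam_U" "sign a" "sign b" "n = f * klein a b"
  using assms unfolding Aut_Gamma_def Norm_Gam_iff by blast

lemma Gam_U_Aut_Gamma [simp]: "h \<in> Gam_U \<Longrightarrow> h \<in> Aut_Gamma"
  using Gam_U_Norm_triv Norm_triv_Norm by (auto simp: Aut_Gamma_def)
lemma klein_Aut_Gamma [simp]: "sign a \<Longrightarrow> sign b \<Longrightarrow> klein a b \<in> Aut_Gamma"
  by (simp add: Aut_Gamma_def)

text \<open>On \<open>klein a b\<close> the two characters take the values a and ab, so together
  they detect V.\<close>

lemma Aut_Gamma_Sign_kernel: "n \<in> Aut_Gamma \<Longrightarrow> n \<in> Sign_kernel \<Longrightarrow> n \<in> Gam_U"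
proof (erule Aut_Gamma_cases)
  fix f a b assume f: "n \<in> Sign_kernel" "f \<in> Gam_U" "sign a" "sign b" "n = f * klein a b"
  then have "a = 1" "a * b = 1" using Gam_U_Sign_kernel[OF f(2)] by (auto simp: Sign_kernel_def sign_level1_klein)
  then show "n \<in> Gam_U" using f by auto
qed

lemma Aut_Gamma_sec: "n \<in> Aut_Gamma \<Longrightarrow> sec n y \<in> Aut_Gamma"
proof (erule Aut_Gamma_cases)
  fix f a b assume f: "f \<in> Gam_U" "sign a" "sign b" "n = f * klein a b"
  then have "sec f y \<in> Aut_Gamma" using Norm_triv_sec[OF Gam_U_Norm_triv[OF f(1)], of y] by (simp add: Aut_Gamma_def Norm_triv_Norm)
  then show ?thesis using f sign_mult[OF f(2,3)] by simp
qed

lemma tri_poly_add_self [simp]: "p + p = - (p :: tri poly)"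
  by (rule poly_eqI) (simp only: coeff_add coeff_minus tri_add_self)

lemma tri_poly_two [simp]: "2 * p = - (p :: tri poly)"
  unfolding mult_2 by (rule tri_poly_add_self)

lemma tri_poly_neg_eq: "(p :: tri poly) = - p \<Longrightarrow> p = 0"
  using tri_poly_add_self[of p] by (metis add.right_inverse neg_equal_0_iff_equal)

definition alt :: "tri poly \<Rightarrow> tri poly" where "alt p = pcompose p [:0, -1:]"

lemma alt_pCons [simp]: "alt (pCons c p) = pCons c (- alt p)"
  by (simp add: alt_def pcompose_pCons)
lemma alt_simps [simp]: "alt 0 = 0" "alt (p + q) = alt p + alt q" "alt (- p) = - alt p" "alt (p - q) = alt p - alt q"
  by (simp_all add: alt_def pcompose_add pcompose_uminus pcompose_diff)
lemma alt_alt [simp]: "alt (alt p) = p"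
  by (induction p) simp_all
lemma alt_smult [simp]: "alt (smult a p) = smult a (alt p)"
  by (simp add: alt_def pcompose_smult)

lemma conjug_klein_Delta_iso: "sign a \<Longrightarrow> sign b \<Longrightarrow> conjug (klein a b) (Delta_iso g) = Delta_iso (conjug (klein (a * b) b) g)"
  by (rule tree_iso_eqI') (simp_all add: conjug_def root_perm_affine sec_inverse sign_square)

text \<open>Each \<Delta> passed replaces \<open>a\<close> by \<open>a * b\<close>, so the
  coefficient of degree i is multiplied by \<open>a * b ^ i\<close>.\<close>

lemma conjug_klein_phi:
  "sign a \<Longrightarrow> sign b \<Longrightarrow> conjug (klein a b) (phi p) = phi (smult a (if b = 1 then p else alt p))"
proof (induction p arbitrary: a)
  case (pCons c q)
  then have "conjug (klein (a * b) b) (phi q) = phi (smult (a * b) (if b = 1 then q else alt q))"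
    by (intro pCons.IH sign_mult) auto
  then show ?case using pCons.prems
    by (auto simp: phi_pCons conjug_klein_x_pow conjug_klein_Delta_iso)
qed simp

section \<open>The elements \<partial>(p)\<close>

definition par_phi :: "tri poly \<Rightarrow> tree_iso" where "par_phi p = trip 1 (phi p) (phi (- p))"

lemma rotation_par_phi [simp]: "rotation (par_phi p) = 0" and orientation_par_phi [simp]: "orientation (par_phi p) = 1"
  and sec_par_phi [simp]: "sec (par_phi p) 0 = 1" "sec (par_phi p) 1 = phi p" "sec (par_phi p) (-1) = phi (- p)"
  and root_perm_par_phi [simp]: "root_perm (par_phi p) y = y"
  by (simp_all add: par_phi_def)

lemma par_phi_add: "par_phi (p + q) = par_phi p * par_phi q"
  using phi_add[of "-p" "-q"] by (simp add: par_phi_def trip_mult phi_add)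
lemma par_phi_0 [simp]: "par_phi 0 = 1" by (simp add: par_phi_def trip_one)
lemma inverse_par_phi [simp]: "inverse (par_phi p) = par_phi (- p)"
  by (rule tree_iso.inverse_unique) (simp flip: par_phi_add)
lemma par_phi_mult_cancel [simp]: "par_phi p * par_phi (- p) = 1" "par_phi (- p) * par_phi p = 1"
   "par_phi p * (par_phi (- p) * g) = g" "par_phi (- p) * (par_phi p * g) = g"
  by (simp_all flip: par_phi_add mult.assoc)
lemma par_phi_Sign_kernel [simp]: "par_phi p \<in> Sign_kernel" by (simp add: Sign_kernel_def sign_level1_def prod_tri)

text \<open>The root permutation contributes the sign a, by exchanging the vertices 1 and -1 if a =
  -1, and the sections contribute ab; together this is b.\<close>

lemma conjug_klein_par_phi:
  assumes "sign a" "sign b"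
  shows "conjug (klein a b) (par_phi p) = par_phi (smult b (if b = 1 then p else alt p))"
proof (rule tree_iso_eqI')
  fix y
  have ab: "sign (a * b)" using assms by (rule sign_mult)
  have s: "sec (conjug (klein a b) (par_phi p)) (a * z) = conjug (klein (a * b) b) (sec (par_phi p) z)" for z
    using assms sec_conjug[of "klein a b" "par_phi p" z] by (simp add: conjug_def)
  show "sec (conjug (klein a b) (par_phi p)) y = sec (par_phi (smult b (if b = 1 then p else alt p))) y"
    using s[of 0] s[of 1] s[of "-1"] tri_cases[of y] assms
    by (auto simp: conjug_klein_phi)
qed (use assms in \<open>simp_all add: rotation_conjug\<close>)

lemma par_phi_klein_comm:
  assumes "sign a" "sign b" "alt p = - p" shows "par_phi p * klein a b = klein a b * par_phi p"
  using conjug_fixD[of "klein a b" "par_phi p"] assms conjug_klein_par_phi[OF assms(1,2), of p] by auto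

lemma par_phi_Delta_iso_comm: "par_phi p * Delta_iso (phi q) = Delta_iso (phi q) * par_phi p"
  by (rule tree_iso_eqI3) (simp_all add: phi_comm root_perm_affine)

lemma conjug_par_phi_gam_pow [simp]: "conjug (par_phi p) (gam_pow c) = gam_pow c"
  by (rule tree_iso_eqI3) (simp_all add: rotation_conjug sec_conjug_trip conjug_phi_x_pow)

text \<open>The sections are \<open>phi p\<close>, \<open>phi (- p) * phi (- p)\<close> and
  \<open>phi p\<close>; they agree because -2 = 1.\<close>

lemma conjug_par_phi_x_pow: "conjug (par_phi p) (x_pow 1) = phi (pCons 1 p)"
  by (rule tree_iso_eqI3) (simp_all add: rotation_conjug sec_conjug_id root_perm_x_pow flip: phi_add)

lemma Gam_U_class_pCons: "Gam_U_class (pCons c q) h \<longleftrightarrow> Gam_U_class (pCons 0 q) h"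
  using Gam_U_class_add_const[of "pCons 0 q" c h] by simp

lemma Gam_U_class_const: "Gam_U_class [:c:] h \<longleftrightarrow> h \<in> Gam"
  using Gam_U_class_pCons[of c 0 h] by simp

lemma Gam_U_class_conjug_par_phi: "g \<in> Gam \<Longrightarrow> Gam_U_class (pCons 0 (smult (rotation g) p)) (conjug (par_phi p) g)"
proof (induction rule: Gam_induct)
  case (x_pow g c)
  have 1: "Gam_U_class (pCons 0 p) (conjug (par_phi p) (x_pow 1))" unfolding conjug_par_phi_x_pow Gam_U_class_pCons[of 1, symmetric] by simp
  have "Gam_U_class (pCons 0 (smult c p)) (conjug (par_phi p) (x_pow c))"
    using tri_cases[of c] 1 Gam_U_class_inverse[OF 1] by (auto simp flip: conjug_inverse)
  from Gam_U_class_mult[OF x_pow.IH this] show ?case by (simp add: smult_add_left add.commute)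
next
  case (gam_pow g c)
  from Gam_U_class_mult_Gam(1)[OF gam_pow.IH Gam_gam_pow] show ?case using gam_pow by simp
qed simp

lemma Gam_U_form: "h \<in> Gam_U \<Longrightarrow> \<exists>g\<in>Gam. \<exists>q. h = g * Delta_iso (phi q)"
proof -
  assume "h \<in> Gam_U"
  then obtain p where "Gam_U_class p h" by (auto simp: Gam_U_def)
  moreover obtain c q where "p = pCons c q" by (cases p)
  ultimately obtain g where "g \<in> Gam" "h = g * phi (pCons 0 q)" using Gam_U_class_pCons Gam_U_class_iff by blast
  then show ?thesis by (auto simp: phi_pCons)
qed

lemma conjug_par_phi_Gam_U: "h \<in> Gam_U \<Longrightarrow> conjug (par_phi p) h \<in> Gam_U"
proof -
  assume "h \<in> Gam_U"
  then obtain g q where g: "g \<in> Gam" "h = g * Delta_iso (phi q)" using Gam_U_form by blast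
  have "conjug (par_phi p) (Delta_iso (phi q)) = phi (pCons 0 q)"
    using conjug_fix[OF par_phi_Delta_iso_comm] by (simp add: phi_pCons)
  moreover have "conjug (par_phi p) g \<in> Gam_U" using Gam_U_class_Gam_U[OF Gam_U_class_conjug_par_phi[OF g(1)]] .
  ultimately show ?thesis by (simp add: g)
qed

lemma par_phi_Norm_Gam_U: "par_phi p \<in> Norm Gam_U"
  using conjug_par_phi_Gam_U by (intro NmI) simp_all

lemma par_phi_Norm_Aut_Gamma: "alt p = - p \<Longrightarrow> par_phi p \<in> Norm Aut_Gamma"
proof -
  have *: "conjug (par_phi p) n \<in> Aut_Gamma" if p: "alt p = - p" and n: "n \<in> Aut_Gamma" for p n
    using n
  proof (rule Aut_Gamma_cases)
    fix f a b assume f: "f \<in> Gam_U" "sign a" "sign b" "n = f * klein a b"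
    then show ?thesis using conjug_fix[OF par_phi_klein_comm[OF f(2,3) p]] conjug_par_phi_Gam_U[OF f(1), of p] by simp
  qed
  show "alt p = - p \<Longrightarrow> ?thesis" using *[of p] *[of "- p"] by (intro NmI) simp_all
qed

text \<open>The sign characters place the element in \<Gamma>U, where all sections have one class;
  that at 0 is trivial, so \<open>r\<close> is a constant d. The defects at 0 and 1 are then 0 and
  d, so d = 0.\<close>

lemma par_phi_Aut_Gamma: "par_phi r \<in> Aut_Gamma \<Longrightarrow> r = 0"
proof -
  assume "par_phi r \<in> Aut_Gamma"
  then have h: "par_phi r \<in> Gam_U" by (intro Aut_Gamma_Sign_kernel) simp_all
  then obtain q where q: "Gam_U_class q (sec (par_phi r) y)" for y using Gam_U_sec by blast
  obtain c where "q = [:c:]" using Gam_U_class_unique[OF _ q[of 0], of 0] by auto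
  then have "phi r \<in> Gam" using q[of 1] by (simp add: Gam_U_class_const)
  then obtain d where d: "r = [:d:]" by (auto simp: phi_Gam_iff)
  have Gam: "sec (par_phi r) y \<in> Gam" for y using tri_cases[of y] by (auto simp: d)
  obtain e where e: "defect (sec (par_phi r)) y = e" for y
    using Gam_U_branch[OF orientation_par_phi, of r "sec (par_phi r)" 0] Gam h by auto
  have "defect (sec (par_phi r)) 0 = 0" "defect (sec (par_phi r)) 1 = d" by (simp_all add: defect_def d)
  then show "r = 0" using e d by simp
qed

text \<open>Dividing by \<Delta>(h_0) leaves (1, n1, n2), whose last two sections have the opposite
  classes q and -q, as in \<partial>(q). The branch criterion for \<open>x\<^sup>h\<close> controls
  the remaining \<Gamma>-parts up to a power of \<partial>(x), which goes into p.\<close>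

lemma normalizer_decompose:
  assumes h: "rotation h = 0" "orientation h = 1" and X: "conjug h (x_pow 1) \<in> Gam_U"
  shows "\<exists>\<eta>\<in>Gam_U. \<exists>p. h = Delta_iso (sec h 0) * \<eta> * par_phi p"
proof -
  obtain q where "Gam_U_class q (sec (conjug h (x_pow 1)) y)" for y using Gam_U_sec[OF X] by blast
  then have q: "Gam_U_class q (inverse (sec h y) * sec h (y + 1))" for y
    using fix_x_pow_sections[OF h] by simp
  define n1 n2 where "n1 = inverse (sec h 0) * sec h 1" and "n2 = inverse (sec h 0) * sec h (-1)"
  have "Gam_U_class q n1" "Gam_U_class (- q) n2"
    using q[of 0] Gam_U_class_inverse[OF q[of "-1"]] by (simp_all add: n1_def n2_def)
  then obtain g1 g2 where g: "g1 \<in> Gam" "n1 = g1 * phi q" "g2 \<in> Gam" "n2 = g2 * phi (- q)"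
    by (auto simp: Gam_U_class_iff)
  define c where "c y = sec (conjug h (x_pow 1)) y * phi (- q)" for y
  have qq: "phi (- q) * phi (- q) = phi q" "phi (- q) * (phi (- q) * f) = phi q * f" for f
    by (simp_all flip: phi_add mult.assoc)
  have Xs: "sec (conjug h (x_pow 1)) 0 = n1" "sec (conjug h (x_pow 1)) 1 = inverse n1 * n2"
    "sec (conjug h (x_pow 1)) (-1) = inverse n2"
    by (simp_all add: fix_x_pow_sections[OF h] n1_def n2_def mult.assoc)
  have c0: "c 0 = g1"
    by (simp add: c_def Xs g(2) mult.assoc)
  have c1: "c 1 = conjug (phi q) (inverse g1 * g2)"
    unfolding c_def Xs by (simp add: g conjug_def mult.assoc qq)
  have c2: "c (-1) = conjug (phi (- q)) (inverse g2)"
    unfolding c_def Xs by (simp add: g conjug_def mult.assoc)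
  have cG: "c y \<in> Gam" for y
    using tri_cases[of y] g by (auto simp: c0 c1 c2 Norm_triv_conjug simp del: conjug_mult conjug_inverse)
  have cs: "sec (conjug h (x_pow 1)) y = c y * phi q" for y by (simp add: c_def mult.assoc)
  obtain d where "defect c y = d" for y
    using Gam_U_branch[of "conjug h (x_pow 1)" c q] cs cG X by auto
  then have "defect c 0 = defect c 1" by simp
  moreover have "rotation (c 1) = rotation g2 - rotation g1" "gam_exp (c 1) = gam_exp g2 - gam_exp g1" "rotation (c (-1)) = - rotation g2" "gam_exp (c (-1)) = - gam_exp g2"
    using Norm_triv_act[OF phi_Norm_triv, of "inverse g1 * g2" q] Norm_triv_act[OF phi_Norm_triv, of "inverse g2" "-q"] g
    by (simp_all add: c1 c2 del: conjug_mult conjug_inverse)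
  ultimately have "rotation g1 - (- gam_exp g2 - (gam_exp g2 - gam_exp g1)) = rotation g2 - rotation g1 - (gam_exp g1 - (- gam_exp g2))"
    by (simp add: defect_def c0)
  then have e2: "rotation g2 = - rotation g1"
    by (cases "rotation g1"; cases "rotation g2"; cases "gam_exp g1"; cases "gam_exp g2"; simp add: tri_const)
  \<comment> \<open>Solves the equation that \<eta> has the same defect at 1 as at 0; by
    \<open>e2\<close> the equation at -1 has the same solution.\<close>
  define j where "j = rotation g1 - gam_exp g1 - gam_exp g2"
  define \<eta> where "\<eta> = trip 1 (g1 * x_pow (- j)) (g2 * x_pow j)"
  have sG: "sec \<eta> y \<in> Gam" for y using tri_cases[of y] g by (auto simp: \<eta>_def)
  have "defect (sec \<eta>) y = gam_exp g1 - gam_exp g2" for y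
    using tri_cases[of y] g by (auto simp: defect_def \<eta>_def e2 j_def algebra_simps)
  then have \<eta>: "\<eta> \<in> Gam_U" using Gam_U_branch[of \<eta> "sec \<eta>" 0] sG by (simp add: \<eta>_def)
  have "[:- j:] + (q + [:j:]) = q" "[:j:] + ([:- j:] - q) = - q"
    by (simp_all add: algebra_simps flip: add.assoc)
  then have "x_pow (- j) * phi (q + [:j:]) = phi q" "x_pow j * phi ([:- j:] - q) = phi (- q)"
    by (metis phi_add phi_const)+
  moreover have "sec h 1 = sec h 0 * (g1 * phi q)" "sec h (-1) = sec h 0 * (g2 * phi (- q))"
    unfolding g(2,4)[symmetric] by (simp_all add: n1_def n2_def)
  ultimately have "h = Delta_iso (sec h 0) * \<eta> * par_phi (q + [:j:])"
    using h by - (rule tree_iso_eqI3, simp_all add: \<eta>_def root_perm_affine mult.assoc)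
  then show ?thesis using \<eta> by blast
qed

section \<open>Extensions of Aut(\<Gamma>) by odd polynomials\<close>

definition Odd :: "tri poly set" where "Odd = {p. alt p = - p}"
definition Aut_Gamma_par :: "tri poly set \<Rightarrow> tree_iso set" where "Aut_Gamma_par S = {n * par_phi w |n w. n \<in> Aut_Gamma \<and> w \<in> S}"

text \<open>The two instances are \<open>{0}\<close>, which gives Aut(\<Gamma>), and
  \<open>Odd\<close>, which gives Aut(\<Gamma>)T; both normalizer steps share the argument.\<close>

definition odd_group :: "tri poly set \<Rightarrow> bool" where
  "odd_group S \<longleftrightarrow> S \<subseteq> Odd \<and> 0 \<in> S \<and> (\<forall>v\<in>S. \<forall>w\<in>S. v + w \<in> S) \<and> (\<forall>w\<in>S. - w \<in> S)"

lemma odd_group_Odd: "odd_group Odd" and odd_group_0: "odd_group {0}"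
  by (auto simp: odd_group_def Odd_def)

lemma Aut_Gamma_par_0: "Aut_Gamma_par {0} = Aut_Gamma" by (auto simp: Aut_Gamma_par_def)

lemma Odd_const: "p \<in> Odd \<Longrightarrow> p = [:c:] \<Longrightarrow> p = 0"
  using tri_poly_neg_eq[of p] by (simp add: Odd_def)

lemma is_subgroup_Aut_Gamma_par:
  assumes "odd_group S" shows "is_subgroup (Aut_Gamma_par S)"
  unfolding is_subgroup_def
proof (intro conjI ballI)
  have S: "w \<in> S \<Longrightarrow> par_phi w \<in> Norm Aut_Gamma" for w
    using assms by (auto simp: odd_group_def Odd_def par_phi_Norm_Aut_Gamma)
  show "1 \<in> Aut_Gamma_par S"
    unfolding Aut_Gamma_par_def using assms Gam_U_Aut_Gamma[OF Gam_Gam_U[OF Gam_one]] by (auto simp: odd_group_def intro!: exI[of _ 1] exI[of _ 0])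
  fix g assume "g \<in> Aut_Gamma_par S"
  then obtain n w where g: "n \<in> Aut_Gamma" "w \<in> S" "g = n * par_phi w" by (auto simp: Aut_Gamma_par_def)
  have w: "- w \<in> S" using assms g by (auto simp: odd_group_def)
  have "inverse g = conjug (par_phi w) (inverse n) * par_phi (- w)"
    by (simp add: g conjug_def mult.assoc)
  then show "inverse g \<in> Aut_Gamma_par S"
    using NmD[OF S[OF g(2)], of "inverse n"] g(1) w by (auto simp: Aut_Gamma_par_def)
  fix h assume "h \<in> Aut_Gamma_par S"
  then obtain m v where h: "m \<in> Aut_Gamma" "v \<in> S" "h = m * par_phi v" by (auto simp: Aut_Gamma_par_def)
  have "g * h = n * conjug (par_phi (- w)) m * par_phi (w + v)"
    by (simp add: g h conjug_def par_phi_add mult.assoc)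
  moreover have "n * conjug (par_phi (- w)) m \<in> Aut_Gamma" using NmD[OF S[OF w] h(1)] g by simp
  moreover have "w + v \<in> S" using assms g h by (auto simp: odd_group_def)
  ultimately show "g * h \<in> Aut_Gamma_par S" unfolding Aut_Gamma_par_def by blast
qed

lemma Aut_Gamma_Aut_Gamma_par: "odd_group S \<Longrightarrow> n \<in> Aut_Gamma \<Longrightarrow> n \<in> Aut_Gamma_par S"
  unfolding Aut_Gamma_par_def odd_group_def by (auto intro!: exI[of _ n] exI[of _ 0])

lemma Aut_Gamma_par_Sign_kernel:
  assumes "odd_group S" "m \<in> Aut_Gamma_par S" "m \<in> Sign_kernel"
  shows "\<exists>\<eta>\<in>Gam_U. \<exists>w\<in>S. m = \<eta> * par_phi w"
proof -
  obtain n w where m: "n \<in> Aut_Gamma" "w \<in> S" "m = n * par_phi w" using assms by (auto simp: Aut_Gamma_par_def)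
  have "n = m * par_phi (- w)" by (simp add: m mult.assoc)
  then have "n \<in> Sign_kernel" using assms(3) Sign_kernel_mult par_phi_Sign_kernel by metis
  then show ?thesis using m Aut_Gamma_Sign_kernel by blast
qed

text \<open>The factor in \<Gamma>U has sections of one class and \<open>par_phi w\<close> adds the
  multiple \<open>y * w\<close> at y, so the classes form an arithmetic progression with difference
  in \<open>S\<close>.\<close>

lemma Aut_Gamma_par_Sign_kernel_sections:
  assumes "odd_group S" "m \<in> Aut_Gamma_par S" "m \<in> Sign_kernel"
  obtains q w where "w \<in> S" "Gam_U_class q (sec m 0)" "Gam_U_class (q + w) (sec m 1)" "Gam_U_class (q - w) (sec m (-1))"
    "w = 0 \<Longrightarrow> m \<in> Gam_U"
proof -
  obtain \<eta> w where m: "\<eta> \<in> Gam_U" "w \<in> S" "m = \<eta> * par_phi w" using Aut_Gamma_par_Sign_kernel[OF assms] by blast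
  obtain q where q: "Gam_U_class q (sec \<eta> y)" for y using Gam_U_sec[OF m(1)] by blast
  have e: "orientation \<eta> = 1" using m Gam_U_Norm_triv Norm_triv_orientation by blast
  have "sec (par_phi w) z = phi (smult z w)" for z using tri_cases[of z] by auto
  then have "sec m y = sec \<eta> y * phi (smult (rotation \<eta> + y) w)" for y
    by (simp add: m root_perm_affine e)
  then have "Gam_U_class (q + smult (rotation \<eta>) w + smult y w) (sec m y)" for y
    using Gam_U_class_mult[OF q Gam_U_class_phi[of "smult (rotation \<eta> + y) w"], of y] by (simp add: smult_add_left add.assoc)
  from this[of 0] this[of 1] this[of "-1"] show thesis
    using m by (intro that[of w "q + smult (rotation \<eta>) w"]) simp_all
qed

text \<open>The rigid transposition \<open>tt\<close>, as an element of the type.\<close>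

definition swap_12 :: tree_iso where "swap_12 = node (\<lambda>_. 1) uminus"

lemma bij_uminus_tri: "bij (uminus :: tri \<Rightarrow> tri)"
  by (rule bij_uminus)

lemma root_perm_swap_12 [simp]: "root_perm swap_12 y = - y" and sec_swap_12 [simp]: "sec swap_12 y = 1"
  by (simp_all add: swap_12_def root_perm_node sec_node bij_uminus_tri)
lemma rotation_swap_12 [simp]: "rotation swap_12 = 0" and orientation_swap_12 [simp]: "orientation swap_12 = -1"
  by (simp_all add: rotation_def orientation_def)

lemma Delta_iso_Gam_U: "f \<in> Gam_U \<Longrightarrow> Delta_iso f \<in> Gam_U"
proof -
  assume "f \<in> Gam_U"
  then obtain g q where g: "g \<in> Gam" "f = g * phi q" by (auto simp: Gam_U_def Gam_U_class_iff)
  then show ?thesis using Gam_U_branch[of "Delta_iso f" "\<lambda>_. g" q] by (auto simp: defect_def)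
qed

lemma Delta_iso_Aut_Gamma:
  assumes "k \<in> Aut_Gamma" shows "\<exists>n\<in>Aut_Gamma. Delta_iso k = n \<or> Delta_iso k = n * swap_12"
  using assms
proof (rule Aut_Gamma_cases)
  fix f a b assume f: "f \<in> Gam_U" "sign a" "sign b" "k = f * klein a b"
  have ab: "sign (a * b)" using f sign_mult by blast
  have aab: "a * b * b = a" using f(3) by auto
  \<comment> \<open>Both sides have sections \<open>klein a b\<close>; the swap removes the root
    permutation of \<open>klein (a * b) b\<close>, multiplication by \<open>a * b\<close>.\<close>
  have "Delta_iso (klein a b) = klein (a * b) b * (if a * b = 1 then 1 else swap_12)"
    by (rule tree_iso_eqI') (simp_all add: f ab aab del: mult_cancel_right1 mult_cancel_left1, use ab in auto)
  then have "Delta_iso k = Delta_iso f * klein (a * b) b * (if a * b = 1 then 1 else swap_12)"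
    by (simp add: f Delta_iso_mult mult.assoc)
  then have "Delta_iso k = Delta_iso f * klein (a * b) b \<or> Delta_iso k = Delta_iso f * klein (a * b) b * swap_12"
    by (cases "a * b = 1") simp_all
  moreover have "Delta_iso f * klein (a * b) b \<in> Aut_Gamma" using Delta_iso_Gam_U[OF f(1)] ab f(3) by simp
  ultimately show ?thesis by blast
qed

text \<open>The sections of the conjugated \<gamma> share a class q. Those at 1 and -1 are mutually
  inverse, so 2q is the class of 1; hence q is constant, and all sections lie in \<Gamma>.\<close>

lemma Delta_iso_Norm_Gam_U:
  assumes "Delta_iso k \<in> Norm Gam_U" shows "k \<in> Aut_Gamma"
proof -
  have *: "conjug k gam_iso \<in> Gam \<and> conjug k (x_pow 1) \<in> Gam" if "Delta_iso k \<in> Norm Gam_U" for k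
  proof -
    have "conjug (Delta_iso k) gam_iso \<in> Gam_U" using NmD[OF that] by simp
    then obtain q where q: "Gam_U_class q (sec (conjug (Delta_iso k) gam_iso) y)" for y using Gam_U_sec by blast
    have s: "sec (conjug (Delta_iso k) gam_iso) y = conjug k (sec gam_iso y)" for y
      by (rule sec_conjug_trip[of "Delta_iso k", simplified]) simp_all
    have "Gam_U_class (q + q) (conjug k (x_pow 1 * x_pow (-1)))"
      unfolding conjug_mult using Gam_U_class_mult[OF q[of 1] q[of "-1"]] by (simp add: s)
    then have "Gam_U_class (- q) 1" by (simp flip: x_pow_add)
    then obtain c where "- q = [:c:]" using Gam_U_class_unique[of 0 1 "- q"] by auto
    then have "q = [:- c:]" by (metis minus_pCons minus_zero add.inverse_inverse)
    then show ?thesis using q[of 0] q[of 1] by (simp add: s Gam_U_class_const)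
  qed
  show ?thesis unfolding Aut_Gamma_def
    using *[OF assms] *[of "inverse k"] Norm_inverse[OF assms] by (intro Norm_Gam_I) (simp_all add: inverse_Delta_iso)
qed

lemma root_trivial:
  obtains n where "n \<in> Aut_Gamma" "rotation (h * n) = 0" "orientation (h * n) = 1"
proof -
  have s: "sign (orientation h)" by (rule orientation_cases)
  have "klein (orientation h) 1 * x_pow (- (orientation h * rotation h)) \<in> Aut_Gamma" using s by (intro Aut_Gamma_mult) simp_all
  then show thesis using s by (intro that[of "klein (orientation h) 1 * x_pow (- (orientation h * rotation h))"]) simp_all
qed

text \<open>The sections become (\<gamma>, x^-1, x), with defects 0 at 0 and 1 at 1. No T-part can
  compensate, since its polynomial would be constant and odd.\<close>

lemma twisted_gam_iso:
  assumes S: "odd_group S" shows "conjug swap_12 gam_iso \<notin> Aut_Gamma_par S"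
proof
  assume m: "conjug swap_12 gam_iso \<in> Aut_Gamma_par S"
  have s: "sec (conjug swap_12 gam_iso) (- z) = sec gam_iso z" for z
    using sec_conjug[of swap_12 gam_iso z] by (simp add: root_perm_affine sec_inverse)
  have s: "sec (conjug swap_12 gam_iso) 0 = gam_iso" "sec (conjug swap_12 gam_iso) 1 = x_pow (-1)" "sec (conjug swap_12 gam_iso) (-1) = x_pow 1"
    using s[of 0] s[of "-1"] s[of 1] by simp_all
  have "gam_iso \<in> Sign_kernel" by simp
  then obtain q w where w: "w \<in> S" "Gam_U_class q gam_iso" "Gam_U_class (q + w) (x_pow (-1))" "conjug swap_12 gam_iso \<in> Gam_U \<or> w \<noteq> 0"
    using Aut_Gamma_par_Sign_kernel_sections[OF S m] s by (metis Sign_kernel_conjug)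
  obtain c where c: "q = [:c:]" using Gam_U_class_unique[OF _ w(2), of 0] by auto
  obtain d where "q + w = [:d:]" using Gam_U_class_unique[OF _ w(3), of 0] by auto
  then have "w = [:d:] - [:c:]" unfolding c eq_diff_eq by (simp only: add.commute)
  then have "w = [:d - c:]" by simp
  moreover have "w \<in> Odd" using w(1) S by (auto simp: odd_group_def)
  ultimately have "w = 0" using Odd_const by blast
  then have h: "conjug swap_12 gam_iso \<in> Gam_U" using w by blast
  have Gam: "sec (conjug swap_12 gam_iso) y \<in> Gam" for y using tri_cases[of y] s by auto
  obtain e where e: "defect (sec (conjug swap_12 gam_iso)) y = e" for y
    using Gam_U_branch[of "conjug swap_12 gam_iso" "sec (conjug swap_12 gam_iso)" 0] Gam h by auto
  have "defect (sec (conjug swap_12 gam_iso)) 0 = 0" "defect (sec (conjug swap_12 gam_iso)) 1 = 1" by (simp_all add: defect_def s)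
  then show False using e by simp
qed

lemma par_phi_Norm_Aut_Gamma_par_Sign_kernel: 
  assumes "odd_group S" "m \<in> Aut_Gamma_par S" "m \<in> Sign_kernel" shows "conjug (par_phi p) m \<in> Aut_Gamma_par S"
proof -
  obtain \<eta> w where m: "\<eta> \<in> Gam_U" "w \<in> S" "m = \<eta> * par_phi w" using Aut_Gamma_par_Sign_kernel[OF assms] by blast
  have "conjug (par_phi p) (par_phi w) = par_phi w" by (rule conjug_fix) (simp add: add.commute flip: par_phi_add)
  then have "conjug (par_phi p) m = conjug (par_phi p) \<eta> * par_phi w" by (simp add: m)
  then show ?thesis using Gam_U_Aut_Gamma[OF conjug_par_phi_Gam_U[OF m(1), of p]] m(2) unfolding Aut_Gamma_par_def by blast
qed

text \<open>Conjugating \<gamma> excludes the swap in \<Delta>(k), so \<partial>(p) itself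
  normalizes. Its commutator with \<open>tau_2\<close> is \<partial> of a polynomial that must lie
  in \<open>S\<close>.\<close>

lemma normalizer_Aut_Gamma_par:
  assumes S: "odd_group S" and h: "h \<in> Norm (Aut_Gamma_par S)" "h = Delta_iso k * \<eta> * par_phi p" and k: "k \<in> Aut_Gamma" "\<eta> \<in> Gam_U"
  shows "h \<in> Aut_Gamma_par Odd"
proof -
  have sub: "is_subgroup (Aut_Gamma_par S)" by (rule is_subgroup_Aut_Gamma_par[OF S])
  have Aut_Gamma: "n \<in> Aut_Gamma \<Longrightarrow> n \<in> Norm (Aut_Gamma_par S)" for n using subgroup_Norm[OF sub] Aut_Gamma_Aut_Gamma_par[OF S] by blast
  have gmM: "gam_iso \<in> Aut_Gamma_par S" using Aut_Gamma_Aut_Gamma_par[OF S] by simp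
  obtain n where n: "n \<in> Aut_Gamma" "Delta_iso k = n \<or> Delta_iso k = n * swap_12" using Delta_iso_Aut_Gamma[OF k(1)] by blast
  have "Delta_iso k \<noteq> n * swap_12"
  proof
    assume "Delta_iso k = n * swap_12"
    then have "swap_12 * \<eta> * par_phi p \<in> Norm (Aut_Gamma_par S)"
      using h Norm_mult_left_iff[OF Aut_Gamma[OF n(1)], of "swap_12 * \<eta> * par_phi p"] by (simp add: mult.assoc)
    then have "conjug (par_phi p) (conjug \<eta> (conjug swap_12 gam_iso)) \<in> Aut_Gamma_par S" using NmD[OF _ gmM] by (simp add: conjug_conjug)
    then have "conjug (par_phi (- p)) (conjug (par_phi p) (conjug \<eta> (conjug swap_12 gam_iso))) \<in> Aut_Gamma_par S"
      by (rule par_phi_Norm_Aut_Gamma_par_Sign_kernel[OF S]) simp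
    then have "conjug \<eta> (conjug swap_12 gam_iso) \<in> Aut_Gamma_par S" by (simp add: conjug_conjug mult.assoc)
    moreover have "inverse \<eta> \<in> Norm (Aut_Gamma_par S)" using Aut_Gamma k by simp
    ultimately have "conjug (inverse \<eta>) (conjug \<eta> (conjug swap_12 gam_iso)) \<in> Aut_Gamma_par S" by (metis NmD)
    then show False using twisted_gam_iso[OF S] by simp
  qed
  then have D: "Delta_iso k \<in> Aut_Gamma" using n by simp
  have "par_phi p \<in> Norm (Aut_Gamma_par S)"
    using h Norm_mult_left_iff[OF Aut_Gamma, of "Delta_iso k * \<eta>" "par_phi p"] D k by simp
  moreover have t: "klein 1 (-1) \<in> Aut_Gamma_par S" using Aut_Gamma_Aut_Gamma_par[OF S] by simp
  ultimately have "conjug (par_phi p) (klein 1 (-1)) * klein 1 (-1) \<in> Aut_Gamma_par S"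
    using sub NmD by (metis is_subgroup_def)
  also have "conjug (par_phi p) (klein 1 (-1)) * klein 1 (-1) = par_phi (- p) * conjug (klein 1 (-1)) (par_phi p)"
    by (simp add: conjug_def mult.assoc)
  also have "\<dots> = par_phi (- p - alt p)"
    unfolding conjug_klein_par_phi[of 1 "-1", simplified] by (simp flip: par_phi_add)
  finally obtain n w where w: "n \<in> Aut_Gamma" "w \<in> S" "par_phi (- p - alt p) = n * par_phi w" by (auto simp: Aut_Gamma_par_def)
  then have "par_phi (- p - alt p - w) = n" 
    using par_phi_add[of "- p - alt p" "- w"] by (simp add: mult.assoc)
  then have "- p - alt p - w = 0" using par_phi_Aut_Gamma w by blast
  then have "- p - alt p = w" unfolding right_minus_eq .
  then have "- p - alt p \<in> Odd" using w(2) S unfolding odd_group_def by blast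
  \<comment> \<open>This polynomial is even by construction and odd as an element of
    \<open>S\<close>, hence 0.\<close>
  then have "alt (- p - alt p) = - (- p - alt p)" unfolding Odd_def by blast
  moreover have "alt (- p - alt p) = - p - alt p" by simp
  ultimately have "- p - alt p = - (- p - alt p)" by (rule trans[OF sym, rotated])
  then have "- p - alt p = 0" by (rule tri_poly_neg_eq)
  then have "p \<in> Odd" unfolding right_minus_eq Odd_def by simp
  moreover have "Delta_iso k * \<eta> \<in> Aut_Gamma" using D k by simp
  ultimately show ?thesis using h(2) unfolding Aut_Gamma_par_def by blast
qed

lemma Norm_Aut_Gamma: "Norm Aut_Gamma = Aut_Gamma_par Odd"
proof
  show "Aut_Gamma_par Odd \<subseteq> Norm Aut_Gamma"
    using subgroup_Norm[OF is_subgroup_Aut_Gamma] by (auto simp: Aut_Gamma_par_def Odd_def intro!: Norm_mult par_phi_Norm_Aut_Gamma)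
  show "Norm Aut_Gamma \<subseteq> Aut_Gamma_par Odd"
  proof
    fix h assume h: "h \<in> Norm Aut_Gamma"
    obtain n where n: "n \<in> Aut_Gamma" "rotation (h * n) = 0" "orientation (h * n) = 1" by (rule root_trivial)
    define k where "k = h * n"
    have k: "rotation k = 0" "orientation k = 1" "k \<in> Norm Aut_Gamma"
      using n h subgroup_Norm[OF is_subgroup_Aut_Gamma] by (simp_all add: k_def)
    \<comment> \<open>\<Gamma>U is the part of Aut(\<Gamma>) on which both sign characters of W are
      trivial, so it is preserved along with Aut(\<Gamma>).\<close>
    have kH: "f \<in> Norm Gam_U" if "f \<in> Norm Aut_Gamma" for f
    proof -
      have "conjug g f' \<in> Gam_U" if "g \<in> Norm Aut_Gamma" "f' \<in> Gam_U" for g f'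
        using NmD[OF that(1), of f'] that(2) by (intro Aut_Gamma_Sign_kernel) simp_all
      then show ?thesis using that by (intro NmI) simp_all
    qed
    have "conjug k (x_pow 1) \<in> Gam_U" using NmD[OF kH[OF k(3)]] by simp
    then obtain \<eta> p where p: "\<eta> \<in> Gam_U" "k = Delta_iso (sec k 0) * \<eta> * par_phi p"
      using normalizer_decompose[OF k(1,2)] by blast
    have "Delta_iso (sec k 0) = k * par_phi (- p) * inverse \<eta>"
      by (subst p(2)) (simp add: mult.assoc)
    also have "\<dots> \<in> Norm Gam_U"
      using kH[OF k(3)] par_phi_Norm_Gam_U subgroup_Norm[OF is_subgroup_Gam_U p(1)] by (intro Norm_mult Norm_inverse)
    finally have "sec k 0 \<in> Aut_Gamma" by (rule Delta_iso_Norm_Gam_U)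
    then have "k \<in> Aut_Gamma_par Odd"
      using normalizer_Aut_Gamma_par[OF odd_group_0 _ p(2) _ p(1)] k(3) unfolding Aut_Gamma_par_0 by blast
    moreover have "h = k * inverse n" by (simp add: k_def mult.assoc)
    ultimately show "h \<in> Aut_Gamma_par Odd"
      using is_subgroup_Aut_Gamma_par[OF odd_group_Odd] Aut_Gamma_Aut_Gamma_par[OF odd_group_Odd Aut_Gamma_inverse[OF n(1)]]
      by (simp add: is_subgroup_def)
  qed
qed

section \<open>The third normalizer\<close>

text \<open>Self-replication of Aut(\<Gamma>) at the vertex 0; it transfers the normalizing property
  from an element to its section there.\<close>

lemma Aut_Gamma_lift:
  assumes "n \<in> Aut_Gamma" shows "\<exists>m\<in>Aut_Gamma. root_perm m 0 = 0 \<and> sec m 0 = n"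
  using assms
proof (rule Aut_Gamma_cases)
  fix f a b assume f: "f \<in> Gam_U" "sign a" "sign b" "n = f * klein a b"
  obtain g q where g: "g \<in> Gam" "f = g * phi q" using f by (auto simp: Gam_U_def Gam_U_class_iff)
  obtain h where h: "h \<in> Gam" "rotation h = 0" "sec h 0 = g" using Gam_lift[OF g(1)] by blast
  have ab: "sign (a * b)" using f sign_mult by blast
  have aab: "a * b * b = a" using f(3) by auto
  have "h * phi (pCons 0 q) * klein (a * b) b \<in> Aut_Gamma" using h ab f by simp
  moreover have "sec (h * phi (pCons 0 q) * klein (a * b) b) 0 = n"
    using h ab f(3) by (simp add: root_perm_affine aab f(4) g(2))
  moreover have "root_perm (h * phi (pCons 0 q) * klein (a * b) b) 0 = 0"
    using h ab f(3) by (simp add: root_perm_affine)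
  ultimately show ?thesis by blast
qed

text \<open>The T-part is invisible here: \<open>par_phi w\<close> has trivial root permutation and
  trivial section at 0.\<close>

lemma Aut_Gamma_par_sec_0: "m \<in> Aut_Gamma_par S \<Longrightarrow> root_perm m 0 = 0 \<Longrightarrow> sec m 0 \<in> Aut_Gamma"
  by (auto simp: Aut_Gamma_par_def Aut_Gamma_sec)

lemma Gam_U_class_conjug_klein: "sign a \<Longrightarrow> Gam_U_class p f \<Longrightarrow> Gam_U_class (smult a p) (conjug (klein a 1) f)"
proof -
  assume a: "sign a" and "Gam_U_class p f"
  then obtain g where "g \<in> Gam" "f = g * phi p" by (auto simp: Gam_U_class_iff)
  then have "conjug (klein a 1) f = conjug (klein a 1) g * phi (smult a p)" "conjug (klein a 1) g \<in> Gam"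
    using a by (simp_all add: conjug_klein_phi Gam_conjug)
  then show "Gam_U_class (smult a p) (conjug (klein a 1) f)" unfolding Gam_U_class_iff by blast
qed

text \<open>The sign characters place \<open>x\<^sup>h\<close> only in \<Gamma>UT, so
  \<open>normalizer_decompose\<close> applies after the T-parts \<open>p0\<close> of
  \<open>sec h 0\<close> and \<open>w\<close> of \<open>x\<^sup>h\<close> are shown to
  vanish.\<close>

lemma Norm_Aut_Gamma_par_Odd: "Norm (Aut_Gamma_par Odd) = Aut_Gamma_par Odd"
proof
  note sub = is_subgroup_Aut_Gamma_par[OF odd_group_Odd] and NNM = Aut_Gamma_Aut_Gamma_par[OF odd_group_Odd]
  show "Aut_Gamma_par Odd \<subseteq> Norm (Aut_Gamma_par Odd)" using subgroup_Norm[OF sub] by blast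
  have NmM: "n \<in> Norm (Aut_Gamma_par Odd)" if "n \<in> Aut_Gamma" for n using subgroup_Norm[OF sub NNM[OF that]] .
  show "Norm (Aut_Gamma_par Odd) \<subseteq> Aut_Gamma_par Odd"
  proof
    fix f assume f: "f \<in> Norm (Aut_Gamma_par Odd)"
    obtain n where n: "n \<in> Aut_Gamma" "rotation (f * n) = 0" "orientation (f * n) = 1" by (rule root_trivial)
    define h where "h = f * n"
    have h: "rotation h = 0" "orientation h = 1" "h \<in> Norm (Aut_Gamma_par Odd)" using n f NmM by (simp_all add: h_def)
    have sec0: "conjug (sec k 0) l \<in> Aut_Gamma" if k: "rotation k = 0" "orientation k = 1" "k \<in> Norm (Aut_Gamma_par Odd)" and l: "l \<in> Aut_Gamma" for k l
    proof -
      obtain m where m: "m \<in> Aut_Gamma" "root_perm m 0 = 0" "sec m 0 = l" using Aut_Gamma_lift[OF l] by blast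
      have "root_perm (conjug k m) 0 = 0" using k m by (simp add: conjug_def root_perm_affine)
      moreover have "sec (conjug k m) 0 = conjug (sec k 0) l" unfolding sec_conjug_id[OF k(1,2)] m by (simp add: conjug_def)
      ultimately show ?thesis using Aut_Gamma_par_sec_0 NmD[OF k(3) NNM[OF m(1)]] by metis
    qed
    \<comment> \<open>The second normalizer is already known, so it describes the section at 0 up to
      an odd \<open>p0\<close>.\<close>
    have "sec h 0 \<in> Norm Aut_Gamma"
      using sec0[OF h] sec0[of "inverse h"] h by (intro NmI) (simp_all add: sec_inverse root_perm_affine)
    then obtain n0 p0 where n0: "n0 \<in> Aut_Gamma" "p0 \<in> Odd" "sec h 0 = n0 * par_phi p0" unfolding Norm_Aut_Gamma by (auto simp: Aut_Gamma_par_def)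
    have gmM: "conjug h gam_iso \<in> Aut_Gamma_par Odd" and xM: "conjug h (x_pow 1) \<in> Aut_Gamma_par Odd"
      using h(3) NNM by (auto intro: NmD)
    obtain u w where w: "w \<in> Odd" and "Gam_U_class u (sec (conjug h (x_pow 1)) 0)" "Gam_U_class (u - w) (sec (conjug h (x_pow 1)) (-1))"
      and wH: "w = 0 \<Longrightarrow> conjug h (x_pow 1) \<in> Gam_U"
      by (rule Aut_Gamma_par_Sign_kernel_sections[OF odd_group_Odd xM]) simp_all
    define n1 n2 where "n1 = inverse (sec h 0) * sec h 1" and "n2 = inverse (sec h 0) * sec h (-1)"
    have n1: "Gam_U_class u n1" and n2: "Gam_U_class (- (u - w)) n2"
      using \<open>Gam_U_class u (sec (conjug h (x_pow 1)) 0)\<close> Gam_U_class_inverse[OF \<open>Gam_U_class (u - w) (sec (conjug h (x_pow 1)) (-1))\<close>]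
      by (simp_all add: fix_x_pow_sections[OF h(1,2)] n1_def n2_def)
    have h_eq: "h = Delta_iso (sec h 0) * trip 1 n1 n2"
      by (rule tree_iso_eqI3) (simp_all add: h n1_def n2_def root_perm_affine)
    \<comment> \<open>the class of \<open>\<gamma>\<^sup>h\<close> at vertex 1 is both odd and equal to plus or minus \<open>X p\<^sub>0\<close>, which is even\<close>
    have "p0 = 0"
    proof -
      obtain q v where v: "v \<in> Odd" "Gam_U_class q (sec (conjug h gam_iso) 0)" "Gam_U_class (q + v) (sec (conjug h gam_iso) 1)"
        by (rule Aut_Gamma_par_Sign_kernel_sections[OF odd_group_Odd gmM]) simp_all
      have s: "sec (conjug h gam_iso) y = conjug (sec h y) (sec gam_iso y)" for y
        using h by (intro sec_conjug_trip) simp_all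
      have "conjug n0 gam_iso \<in> Gam" "rotation (conjug n0 gam_iso) = 0" using n0(1) by (simp_all add: Aut_Gamma_def Gam_conjug rotation_conjug)
      then have "Gam_U_class 0 (conjug (par_phi p0) (conjug n0 gam_iso))" using Gam_U_class_conjug_par_phi[of "conjug n0 gam_iso" p0] by simp
      then obtain c where c: "q = [:c:]" using Gam_U_class_unique[OF _ v(2), of 0] by (auto simp: s n0(3) conjug_conjug)
      have g: "conjug n0 (x_pow 1) \<in> Gam" "rotation (conjug n0 (x_pow 1)) = orientation n0" using n0(1) by (simp_all add: Aut_Gamma_def Gam_conjug rotation_conjug)
      have "sec h 1 = n0 * par_phi p0 * n1" by (simp add: n1_def flip: n0(3))
      then have "sec (conjug h gam_iso) 1 = conjug n1 (conjug (par_phi p0) (conjug n0 (x_pow 1)))" by (simp add: s conjug_conjug mult.assoc)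
      moreover have "Gam_U_class (pCons 0 (smult (orientation n0) p0)) (conjug n1 (conjug (par_phi p0) (conjug n0 (x_pow 1))))"
        using Gam_U_class_conjug[OF Gam_U_class_Gam_U[OF n1] Gam_U_class_conjug_par_phi[OF g(1)]] by (simp only: g(2))
      ultimately obtain d where "q + v = pCons 0 (smult (orientation n0) p0) + [:d:]"
        using Gam_U_class_unique v(3) by metis
      then have "v = pCons 0 (smult (orientation n0) p0) + [:d:] - [:c:]" unfolding c by (simp only: eq_diff_eq add.commute)
      then have v_eq: "v = pCons (d - c) (smult (orientation n0) p0)" by simp
      have "alt v = v" using n0(2) by (simp add: v_eq Odd_def)
      then have "v = 0" using v(1) tri_poly_neg_eq[of v] by (simp add: Odd_def)
      then show "p0 = 0" using v_eq orientation_cases[of n0] by auto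
    qed
    then have h0: "sec h 0 \<in> Aut_Gamma" using n0 by simp
    \<comment> \<open>compare the two nontrivial sections of the commutator of \<open>h\<close> with \<open>\<tau>\<^sub>1\<close>\<close>
    have "w = 0"
    proof -
      define k where "k = trip 1 n1 n2"
      define t where "t = klein (-1) 1"
      obtain m where m: "m \<in> Aut_Gamma" "Delta_iso (sec h 0) = m \<or> Delta_iso (sec h 0) = m * swap_12" using Delta_iso_Aut_Gamma[OF h0] by blast
      have "t \<in> Aut_Gamma_par Odd" using NNM by (simp add: t_def)
      \<comment> \<open>A swap in \<Delta>(h_0) is not yet excluded, but \<open>tau_1\<close>
        commutes with it, so it does not affect the commutator.\<close>
      have twt: "conjug swap_12 t = t"
        by (rule conjug_fix, rule tree_iso_eqI') (simp_all add: t_def)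
      have "conjug k t \<in> Aut_Gamma_par Odd"
        using m(2)
      proof
        assume "Delta_iso (sec h 0) = m"
        then have "k \<in> Norm (Aut_Gamma_par Odd)"
          using h(3) Norm_mult_left_iff[OF NmM[OF m(1)], of k] h_eq by (simp add: k_def)
        then show ?thesis using \<open>t \<in> Aut_Gamma_par Odd\<close> by (rule NmD)
      next
        assume "Delta_iso (sec h 0) = m * swap_12"
        then have "swap_12 * k \<in> Norm (Aut_Gamma_par Odd)"
          using h(3) Norm_mult_left_iff[OF NmM[OF m(1)], of "swap_12 * k"] h_eq by (simp add: k_def mult.assoc)
        then have "conjug (swap_12 * k) t \<in> Aut_Gamma_par Odd" using \<open>t \<in> Aut_Gamma_par Odd\<close> by (rule NmD)
        then show ?thesis by (simp add: twt flip: conjug_conjug)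
      qed
      then have "conjug k t * t \<in> Aut_Gamma_par Odd" using \<open>t \<in> Aut_Gamma_par Odd\<close> sub by (simp add: is_subgroup_def)
      also have "conjug k t * t = inverse k * conjug t k" by (simp add: conjug_def mult.assoc t_def)
      finally have M: "inverse k * conjug t k \<in> Aut_Gamma_par Odd" .
      have sE: "orientation k = 1" by (simp add: k_def)
      have "sign_level1 (inverse k) * sign_level1 k = 1" by (simp flip: sign_level1_mult)
      then have kE: "inverse k * conjug t k \<in> Sign_kernel" by (simp add: Sign_kernel_def sE)
      have st: "sec (conjug t k) (- y) = conjug t (sec k y)" for y
        using sec_conjug[of t k y] by (simp add: t_def conjug_def root_perm_affine k_def)
      have sk: "sec (inverse k * conjug t k) y = inverse (sec k y) * conjug t (sec k (- y))" for y
        using st[of "- y"] by (simp add: sec_inverse root_perm_affine k_def)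
      obtain q v where v: "v \<in> Odd" "Gam_U_class q (sec (inverse k * conjug t k) 0)" "Gam_U_class (q + v) (sec (inverse k * conjug t k) 1)"
          "Gam_U_class (q - v) (sec (inverse k * conjug t k) (-1))"
        by (rule Aut_Gamma_par_Sign_kernel_sections[OF odd_group_Odd M kE])
      have "Gam_U_class (- u + smult (-1) (- (u - w))) (sec (inverse k * conjug t k) 1)"
        unfolding sk using Gam_U_class_mult[OF Gam_U_class_inverse[OF n1] Gam_U_class_conjug_klein[OF _ n2, of "-1"]] by (simp add: k_def t_def)
      moreover have "- u + smult (-1) (- (u - w)) = - w" by simp
      ultimately have 1: "Gam_U_class (- w) (sec (inverse k * conjug t k) 1)" by (simp only:)
      have "Gam_U_class (u - w + smult (-1) u) (sec (inverse k * conjug t k) (-1))"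
        unfolding sk using Gam_U_class_mult[OF Gam_U_class_inverse[OF n2] Gam_U_class_conjug_klein[OF _ n1, of "-1"]] by (simp add: k_def t_def)
      moreover have "u - w + smult (-1) u = - w" by simp
      ultimately have 2: "Gam_U_class (- w) (sec (inverse k * conjug t k) (-1))" by (simp only:)
      have "Gam_U_class 0 (sec (inverse k * conjug t k) 0)" unfolding sk by (simp add: k_def)
      then obtain c where c: "q = [:c:]" using Gam_U_class_unique[OF _ v(2), of 0] by auto
      obtain d where d: "q + v = - w + [:d:]" using Gam_U_class_unique[OF 1 v(3)] by blast
      obtain e where e: "q - v = - w + [:e:]" using Gam_U_class_unique[OF 2 v(4)] by blast
      \<comment> \<open>Adding eliminates \<open>v\<close>; as \<open>q\<close> is constant, so is
        \<open>w\<close>, and a constant odd polynomial is 0.\<close>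
      have "(q + v) + (q - v) = (- w + - w) + ([:d:] + [:e:])" unfolding d e by (simp only: add_ac)
      then have "- q = w + [:d + e:]" by simp
      then have "w = - [:c:] - [:d + e:]" unfolding c by (simp only: eq_diff_eq)
      then have "w = [:- c - (d + e):]" by simp
      then show "w = 0" using Odd_const[OF w] by blast
    qed
    then obtain \<eta> p where p: "\<eta> \<in> Gam_U" "h = Delta_iso (sec h 0) * \<eta> * par_phi p"
      using normalizer_decompose[OF h(1,2) wH] by blast
    have "h \<in> Aut_Gamma_par Odd" by (rule normalizer_Aut_Gamma_par[OF odd_group_Odd h(3) p(2) h0 p(1)])
    moreover have "f = h * inverse n" by (simp add: h_def mult.assoc)
    ultimately show "f \<in> Aut_Gamma_par Odd" using sub NNM[OF Aut_Gamma_inverse[OF n(1)]] by (simp add: is_subgroup_def)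
  qed
qed

subsection \<open>Transfer to sets of isometries\<close>

lemma carrier_W [simp]: "carrier W_grp = range app"
  using type_definition.Rep_range[OF type_definition_tree_iso] by (simp add: W_grp_def)

lemma mult_W [simp]: "app g \<otimes>\<^bsub>W_grp\<^esub> app h = app (g * h)"
  by (simp add: W_grp_def app_mult)

lemma one_W: "\<one>\<^bsub>W_grp\<^esub> = app 1"
  by (simp add: W_grp_def app_one)

lemma group_W: "group W_grp"
proof (rule groupI)
  fix f assume "f \<in> carrier W_grp"
  then obtain g where "f = app g" by auto
  then show "\<exists>y\<in>carrier W_grp. y \<otimes>\<^bsub>W_grp\<^esub> f = \<one>\<^bsub>W_grp\<^esub>"
    by (intro bexI[of _ "app (inverse g)"]) (simp_all add: one_W)
qed (auto simp: one_W mult.assoc)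

lemma inv_W [simp]: "inv\<^bsub>W_grp\<^esub> (app g) = app (inverse g)"
  by (rule group.inv_equality[OF group_W]) (simp_all add: one_W)

lemma set_mult_app: "app ` A <#>\<^bsub>W_grp\<^esub> app ` S = app ` {a * b |a b. a \<in> A \<and> b \<in> S}"
proof -
  have "app ` A <#>\<^bsub>W_grp\<^esub> app ` S = (\<Union>a\<in>A. \<Union>b\<in>S. {app (a * b)})"
    by (simp add: set_mult_def)
  then show ?thesis by blast
qed

lemma subgroup_app: "is_subgroup S \<Longrightarrow> subgroup (app ` S) W_grp"
  by (intro group.subgroupI[OF group_W]) (auto simp: is_subgroup_def)

lemma generate_app:
  assumes "is_subgroup S" "A \<subseteq> S" and min: "\<And>Q. is_subgroup Q \<Longrightarrow> A \<subseteq> Q \<Longrightarrow> S \<subseteq> Q"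
  shows "generate W_grp (app ` A) = app ` S"
proof
  show "generate W_grp (app ` A) \<subseteq> app ` S"
    using assms by (intro group.generate_subgroup_incl[OF group_W] subgroup_app) auto
  define Q where "Q = {g. app g \<in> generate W_grp (app ` A)}"
  have sub: "subgroup (generate W_grp (app ` A)) W_grp"
    by (intro group.generate_is_subgroup[OF group_W]) auto
  have "is_subgroup Q"
    unfolding is_subgroup_def Q_def
    using subgroup.one_closed[OF sub] subgroup.m_closed[OF sub] subgroup.m_inv_closed[OF sub]
    by (auto simp: one_W simp flip: mult_W inv_W)
  moreover have "A \<subseteq> Q" by (auto simp: Q_def intro: generate.incl)
  ultimately have "S \<subseteq> Q" by (rule min)
  then show "app ` S \<subseteq> generate W_grp (app ` A)" by (auto simp: Q_def)
qed

text \<open>The library normalizer is a stabilizer under h S h^-1, whereas \<open>conjug h g\<close>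
  is h^-1 g h; hence the inverse.\<close>

lemma Norm_iff_image: "h \<in> Norm S \<longleftrightarrow> conjug (inverse h) ` S = S"
proof
  assume h: "h \<in> Norm S"
  show "conjug (inverse h) ` S = S"
  proof
    show "conjug (inverse h) ` S \<subseteq> S" using NmD[OF Norm_inverse[OF h]] by blast
    have "s \<in> conjug (inverse h) ` S" if "s \<in> S" for s
      using NmD[OF h that] by (intro image_eqI[of _ _ "conjug h s"]) simp_all
    then show "S \<subseteq> conjug (inverse h) ` S" by blast
  qed
next
  assume e: "conjug (inverse h) ` S = S"
  have "conjug h s \<in> S" if "s \<in> S" for s
  proof -
    have "s \<in> conjug (inverse h) ` S" using that by (simp only: e)
    then obtain r where "r \<in> S" "s = conjug (inverse h) r" by blast
    then show ?thesis by simp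
  qed
  moreover have "conjug (inverse h) s \<in> S" if "s \<in> S" for s using imageI[OF that, of "conjug (inverse h)"] by (simp only: e)
  ultimately show "h \<in> Norm S" by (rule NmI)
qed

lemma normalizer_app: "normalizer W_grp (app ` S) = app ` Norm S"
proof -
  have "(app h <#\<^bsub>W_grp\<^esub> app ` S) #>\<^bsub>W_grp\<^esub> inv\<^bsub>W_grp\<^esub> (app h) = app ` (conjug (inverse h) ` S)" for h
    unfolding l_coset_def r_coset_def by (auto simp: conjug_def)
  then have P: "(app h <#\<^bsub>W_grp\<^esub> app ` S) #>\<^bsub>W_grp\<^esub> inv\<^bsub>W_grp\<^esub> (app h) = app ` S \<longleftrightarrow> h \<in> Norm S" for h
    unfolding Norm_iff_image by (simp add: inj_image_eq_iff[OF injI[OF app_inject[THEN iffD1]]])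
  have "app ` S \<subseteq> carrier W_grp" by auto
  then have "normalizer W_grp (app ` S) =
      {f \<in> range app. (f <#\<^bsub>W_grp\<^esub> app ` S) #>\<^bsub>W_grp\<^esub> inv\<^bsub>W_grp\<^esub> f = app ` S}"
    by (simp add: normalizer_def stabilizer_def restrict_def)
  also have "\<dots> = app ` {h. (app h <#\<^bsub>W_grp\<^esub> app ` S) #>\<^bsub>W_grp\<^esub> inv\<^bsub>W_grp\<^esub> (app h) = app ` S}"
    by blast
  finally show ?thesis by (simp only: P Collect_mem_eq)
qed

lemma Gamma_eq: "Gamma = app ` Gam"
proof -
  have "generate W_grp (app ` {x_pow 1, gam_iso}) = app ` Gam"
    using generators_conjug[of _ 1] by (intro generate_app is_subgroup_Gam) auto
  then show ?thesis by (simp add: Gamma_def xx_eq app_gam_iso)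
qed

text \<open>All coefficients are 0, 1 or -1, so monic monomials suffice. Only degrees occurring in
  \<open>p\<close> are required, so an odd \<open>p\<close> involves only odd degrees.\<close>

lemma hom_monom_induct:
  assumes add: "\<And>p q. f (p + q) = f p * (f q :: tree_iso)" and zero: "f (0 :: tri poly) = 1"
    and Q: "is_subgroup Q" "\<And>i. coeff p i \<noteq> 0 \<Longrightarrow> f (monom 1 i) \<in> Q"
  shows "f p \<in> Q"
proof -
  have mon: "f (monom (coeff p i) i) \<in> Q" for i
  proof -
    have "f (monom (- 1) i) * f (monom 1 i) = 1" by (simp add: zero add_monom flip: add)
    then have "f (monom (- 1) i) = inverse (f (monom 1 i))"
      by (metis tree_iso.inverse_unique tree_iso.inverse_inverse)
    then show ?thesis using tri_cases[of "coeff p i"] Q zero by (auto simp: is_subgroup_def)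
  qed
  have "finite A \<Longrightarrow> f (\<Sum>i\<in>A. monom (coeff p i) i) \<in> Q" for A
    by (induction A rule: finite_induct) (use mon Q(1) in \<open>auto simp: is_subgroup_def zero add\<close>)
  from this[of "{..degree p}"] show ?thesis by (simp add: poly_as_sum_of_monoms)
qed

lemma Delta_app: "Delta (app g) = app (Delta_iso g)"
proof -
  have "(\<lambda>y. app (case y of T0 \<Rightarrow> g | T1 \<Rightarrow> g | T2 \<Rightarrow> g)) = (\<lambda>_. app g)"
    by (rule ext) (simp split: tri.split)
  then show ?thesis by (simp add: Delta_def Delta_iso_def trip_def app_node)
qed

lemma Delta_pow: "(Delta ^^ n) xx = app (phi (monom 1 n))"
  by (induction n) (simp_all add: xx_eq Delta_app monom_Suc phi_pCons monom_0)

lemma UU_eq: "UU = app ` range (\<lambda>q. Delta_iso (phi q))"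
proof -
  have e: "{(Delta ^^ n) xx |n. n \<ge> 1} = app ` {Delta_iso (phi (monom 1 n)) |n. True}"
  proof -
    have P: "n \<ge> 1 \<longleftrightarrow> (\<exists>m. n = Suc m)" for n by (cases n) auto
    have "{(Delta ^^ n) xx |n. n \<ge> 1} = range (\<lambda>n. (Delta ^^ Suc n) xx)"
      unfolding P by (auto simp del: funpow.simps)
    then show ?thesis by (auto simp: Delta_pow Delta_app)
  qed
  have hom: "Delta_iso (phi (p + q)) = Delta_iso (phi p) * Delta_iso (phi q)" for p q by (simp add: phi_add Delta_iso_mult)
  show ?thesis unfolding UU_def e
  proof (rule generate_app)
    let ?U = "range (\<lambda>q. Delta_iso (phi q))"
    show "is_subgroup ?U"
      unfolding is_subgroup_def
    proof (intro conjI ballI)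
      show "1 \<in> ?U" by (rule range_eqI[of _ _ 0]) simp
      fix g assume "g \<in> ?U"
      then obtain p where g: "g = Delta_iso (phi p)" by blast
      show "inverse g \<in> ?U" by (rule range_eqI[of _ _ "- p"]) (simp add: g inverse_Delta_iso)
      fix h assume "h \<in> ?U"
      then obtain q where h: "h = Delta_iso (phi q)" by blast
      show "g * h \<in> ?U" unfolding g h hom[symmetric] by (rule rangeI)
    qed
    fix Q assume Q: "is_subgroup Q" "{Delta_iso (phi (monom 1 n)) |n. True} \<subseteq> Q"
    have "Delta_iso (phi q) \<in> Q" for q
      by (rule hom_monom_induct[of "\<lambda>q. Delta_iso (phi q)", OF hom _ Q(1)]) (use Q(2) in auto)
    then show "?U \<subseteq> Q" by blast
  qed auto
qed

lemma VV_eq: "VV = app ` {klein a b |a b. sign a \<and> sign b}"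
proof -
  have "{klein a b |a b. sign a \<and> sign b} = {klein 1 1, klein 1 (-1), klein (-1) 1, klein (-1) (-1)}" by blast
  then show ?thesis by (simp add: VV_def klein_def app_tau app_one insert_commute)
qed

lemma partial_app: "partial (app g) = app (trip 1 g (inverse g))"
proof -
  have "(\<lambda>y. app (case y of T0 \<Rightarrow> 1 | T1 \<Rightarrow> g | T2 \<Rightarrow> inverse g)) =
      (\<lambda>y. case y of T0 \<Rightarrow> id | T1 \<Rightarrow> app g | T2 \<Rightarrow> inv_into UNIV (app g))"
    by (rule ext) (simp add: app_one app_inverse split: tri.split)
  then show ?thesis by (simp add: partial_def trip_def app_node)
qed

lemma coeff_alt: "coeff (alt p) i = (-1) ^ i * coeff p i"
  by (induction p arbitrary: i) (auto simp: coeff_pCons split: nat.split)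

lemma monom_Odd: "monom 1 i \<in> Odd \<longleftrightarrow> odd i"
  by (auto simp: Odd_def poly_eq_iff coeff_alt)

lemma TT_eq: "TT = app ` par_phi ` Odd"
proof -
  have "phi (- p) = inverse (phi p)" for p by simp
  then have e: "{partial ((Delta ^^ (2 * n + 1)) xx) |n. True} = app ` {par_phi (monom 1 (2 * n + 1)) |n. True}"
    by (auto simp: Delta_pow partial_app par_phi_def image_iff simp del: inverse_phi funpow.simps)
  show ?thesis unfolding TT_def e
  proof (rule generate_app)
    show "is_subgroup (par_phi ` Odd)"
      using odd_group_Odd by (auto simp: is_subgroup_def odd_group_def image_iff par_phi_add[symmetric] 
        intro: bexI[of _ 0])
    show "{par_phi (monom 1 (2 * n + 1)) |n. True} \<subseteq> par_phi ` Odd" using monom_Odd by fastforce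
    fix Q assume Q: "is_subgroup Q" "{par_phi (monom 1 (2 * n + 1)) |n. True} \<subseteq> Q"
    have "par_phi p \<in> Q" if p: "p \<in> Odd" for p
    proof (rule hom_monom_induct[OF par_phi_add par_phi_0 Q(1)])
      fix i assume "coeff p i \<noteq> 0"
      moreover have "coeff (alt p) i = - coeff p i" using p by (simp add: Odd_def)
      ultimately have "odd i"
        unfolding coeff_alt using tri_cases[of "coeff p i"] by (cases "even i") auto
      then show "par_phi (monom 1 i) \<in> Q" using Q(2) by (auto elim!: oddE)
    qed
    then show "par_phi ` Odd \<subseteq> Q" by blast
  qed
qed

lemma AutT_eq: "AutT 0 = app ` Gam" "AutT 1 = app ` Aut_Gamma" "AutT 2 = app ` Aut_Gamma_par Odd" "AutT 3 = app ` Aut_Gamma_par Odd"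
proof -
  show 0: "AutT 0 = app ` Gam" by (simp add: Gamma_eq)
  show 1: "AutT 1 = app ` Aut_Gamma" by (simp add: Gamma_eq normalizer_app Aut_Gamma_def)
  have "AutT 2 = normalizer W_grp (AutT 1)" by (simp add: numeral_2_eq_2)
  then show 2: "AutT 2 = app ` Aut_Gamma_par Odd" by (simp only: 1 normalizer_app Norm_Aut_Gamma)
  have "AutT 3 = normalizer W_grp (AutT 2)" by (simp add: numeral_3_eq_3 numeral_2_eq_2)
  then show "AutT 3 = app ` Aut_Gamma_par Odd" by (simp only: 2 normalizer_app Norm_Aut_Gamma_par_Odd)
qed

lemma Aut_Gamma_product: "Aut_Gamma = {g * v |g v. g \<in> {a * u |a u. a \<in> Gam \<and> u \<in> range (\<lambda>q. Delta_iso (phi q))} \<and>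
    v \<in> {klein a b |a b. sign a \<and> sign b}}" (is "_ = ?R")
proof
  show "Aut_Gamma \<subseteq> ?R"
  proof
    fix n assume "n \<in> Aut_Gamma"
    then show "n \<in> ?R"
    proof (rule Aut_Gamma_cases)
      fix f a b assume "f \<in> Gam_U" "sign a" "sign b" "n = f * klein a b"
      then show "n \<in> ?R" using Gam_U_form[of f] by blast
    qed
  qed
  have "Delta_iso (phi q) \<in> Aut_Gamma" for q using Gam_U_Aut_Gamma[OF phi_Gam_U[of "pCons 0 q"]] by (simp add: phi_pCons)
  then show "?R \<subseteq> Aut_Gamma" by auto
qed

instance tri :: countable by countable_datatype

lemma countable_tri_poly: "countable (A :: tri poly set)"
proof (rule countable_subset)
  show "A \<subseteq> range Poly" by (metis Poly_coeffs rangeI subsetI)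
qed simp

lemma par_phi_inj: "par_phi p = par_phi q \<Longrightarrow> p = q"
proof -
  assume "par_phi p = par_phi q"
  then have "par_phi (p - q) = 1" using par_phi_add[of p "- q"] by simp
  then have "par_phi (p - q) \<in> Aut_Gamma" by (simp add: Aut_Gamma_def)
  then show "p = q" using par_phi_Aut_Gamma[of "p - q"] by simp
qed

lemma infinite_Odd: "infinite Odd"
proof -
  have "inj (\<lambda>n. monom (1::tri) (2 * n + 1))"
    by (rule injI) (metis degree_monom_eq one_neq_zero add_right_cancel mult_cancel1 zero_neq_numeral)
  then have "infinite (range (\<lambda>n. monom (1::tri) (2 * n + 1)))" by (rule range_inj_infinite)
  moreover have "range (\<lambda>n. monom (1::tri) (2 * n + 1)) \<subseteq> Odd" by (auto simp: monom_Odd)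
  ultimately show ?thesis by (rule infinite_super[rotated])
qed

lemma app_inj: "inj app" by (rule injI) (simp add: app_inject)

theorem theorem5p3:
  shows "AutT 1 = Gamma <#>\<^bsub>W_grp\<^esub> UU <#>\<^bsub>W_grp\<^esub> VV
    \<and> subgroup TT W_grp \<and> infinite TT \<and> countable TT
    \<and> (\<forall>a\<in>TT. \<forall>b\<in>TT. a \<otimes>\<^bsub>W_grp\<^esub> b = b \<otimes>\<^bsub>W_grp\<^esub> a)
    \<and> (\<forall>a\<in>TT. a [^]\<^bsub>W_grp\<^esub> (3::nat) = \<one>\<^bsub>W_grp\<^esub>)
    \<and> AutT 1 \<lhd> W_grp\<lparr>carrier := AutT 2\<rparr>
    \<and> AutT 2 = AutT 1 <#>\<^bsub>W_grp\<^esub> TT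
    \<and> AutT 1 \<inter> TT = {\<one>\<^bsub>W_grp\<^esub>}
    \<and> (\<forall>s\<in>TT. \<forall>u\<in>UU \<union> VV. s \<otimes>\<^bsub>W_grp\<^esub> u = u \<otimes>\<^bsub>W_grp\<^esub> s)
    \<and> AutT 3 = AutT 2
    \<and> height = 2"
proof (intro conjI)
  show "AutT 1 = Gamma <#>\<^bsub>W_grp\<^esub> UU <#>\<^bsub>W_grp\<^esub> VV"
    unfolding AutT_eq Gamma_eq UU_eq VV_eq set_mult_app by (subst Aut_Gamma_product) (rule refl)
  show "subgroup TT W_grp" 
    unfolding TT_def by (rule group.generate_is_subgroup[OF group_W]) 
      (auto simp: Delta_pow partial_app simp del: funpow.simps)
  have "inj_on (app \<circ> par_phi) Odd" using app_inj par_phi_inj by (auto simp: inj_on_def)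
  then show "infinite TT" unfolding TT_eq image_comp using infinite_Odd finite_image_iff by blast
  show "countable TT" unfolding TT_eq by (intro countable_image countable_tri_poly)
  show "\<forall>a\<in>TT. \<forall>b\<in>TT. a \<otimes>\<^bsub>W_grp\<^esub> b = b \<otimes>\<^bsub>W_grp\<^esub> a"
    by (auto simp: TT_eq add.commute simp flip: par_phi_add)
  show "\<forall>a\<in>TT. a [^]\<^bsub>W_grp\<^esub> (3::nat) = \<one>\<^bsub>W_grp\<^esub>"
    by (auto simp: TT_eq numeral_3_eq_3 one_W simp flip: par_phi_add)
  show "AutT 2 = AutT 1 <#>\<^bsub>W_grp\<^esub> TT"
    unfolding AutT_eq TT_eq set_mult_app Aut_Gamma_par_def by (rule arg_cong[of _ _ "image app"]) blast
  show "AutT 1 \<inter> TT = {\<one>\<^bsub>W_grp\<^esub>}"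
  proof -
    have "par_phi r = 1" if "par_phi r \<in> Aut_Gamma" for r using par_phi_Aut_Gamma[OF that] by simp
    moreover have "1 \<in> par_phi ` Odd" using odd_group_Odd by (intro image_eqI[of _ _ 0]) (simp_all add: odd_group_def)
    ultimately have "Aut_Gamma \<inter> par_phi ` Odd = {1}" using Gam_U_Aut_Gamma[OF Gam_Gam_U[OF Gam_one]] by auto
    then show ?thesis unfolding AutT_eq TT_eq image_Int[OF app_inj, symmetric] one_W by simp
  qed
  show "\<forall>s\<in>TT. \<forall>u\<in>UU \<union> VV. s \<otimes>\<^bsub>W_grp\<^esub> u = u \<otimes>\<^bsub>W_grp\<^esub> s"
  proof (intro ballI)
    fix s u assume "s \<in> TT" "u \<in> UU \<union> VV"
    then obtain p f where f: "p \<in> Odd" "s = app (par_phi p)" "u = app f"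
      "(\<exists>q. f = Delta_iso (phi q)) \<or> (\<exists>a b. sign a \<and> sign b \<and> f = klein a b)"
      unfolding TT_eq UU_eq VV_eq by blast
    then have "par_phi p * f = f * par_phi p"
      using par_phi_Delta_iso_comm[of p] par_phi_klein_comm[of _ _ p] unfolding Odd_def by blast
    then show "s \<otimes>\<^bsub>W_grp\<^esub> u = u \<otimes>\<^bsub>W_grp\<^esub> s" by (simp add: f)
  qed
  show "AutT 3 = AutT 2" by (simp only: AutT_eq)
  have sub2: "subgroup (AutT 2) W_grp" and sub1: "subgroup (AutT 1) W_grp"
    unfolding AutT_eq by (intro subgroup_app is_subgroup_Aut_Gamma_par odd_group_Odd is_subgroup_Aut_Gamma)+
  have "group (W_grp\<lparr>carrier := AutT 2\<rparr>)" by (rule subgroup.subgroup_is_group[OF sub2 group_W])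
  moreover have "AutT 1 \<subseteq> AutT 2" unfolding AutT_eq using Aut_Gamma_Aut_Gamma_par[OF odd_group_Odd] by blast
  then have "subgroup (AutT 1) (W_grp\<lparr>carrier := AutT 2\<rparr>)"
    by (rule group.subgroup_incl[OF group_W sub1 sub2])
  moreover have "f \<otimes>\<^bsub>W_grp\<^esub> n \<otimes>\<^bsub>W_grp\<^esub> inv\<^bsub>W_grp\<lparr>carrier := AutT 2\<rparr>\<^esub> f \<in> AutT 1" if fn: "f \<in> AutT 2" "n \<in> AutT 1" for f n
  proof -
    obtain h m where h: "h \<in> Norm Aut_Gamma" "m \<in> Aut_Gamma" "f = app h" "n = app m" using fn unfolding AutT_eq Norm_Aut_Gamma by blast
    have "conjug (inverse h) m \<in> Aut_Gamma" using h by (intro NmD[of _ Aut_Gamma]) simp_all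
    then have "app (h * m * inverse h) \<in> AutT 1" unfolding AutT_eq by (simp add: conjug_def)
    then show ?thesis unfolding group.m_inv_consistent[OF group_W sub2 fn(1)] by (simp only: h mult_W inv_W)
  qed
  ultimately show "AutT 1 \<lhd> W_grp\<lparr>carrier := AutT 2\<rparr>"
    by (auto simp: group.normal_inv_iff)
  \<comment> \<open>This is \<open>tau_1\<close>, which acts on the root as a transposition, whereas
    elements of \<Gamma> act as rotations.\<close>
  have "orientation (klein (-1) 1) = -1" by simp
  then have "klein (-1) 1 \<notin> Gam" using Gam_orientation[of "klein (-1) 1"] by (metis tri_neq(3))
  moreover have "klein (-1) 1 \<in> Aut_Gamma" by simp
  ultimately have 0: "AutT 0 \<noteq> AutT 1" unfolding AutT_eq using app_inj by (metis inj_image_eq_iff)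
  \<comment> \<open>The element \<partial>\<Delta>(x), the first generator of T, separates the
    second normalizer from the first.\<close>
  have "par_phi (monom 1 1) = 1 * par_phi (monom 1 1)" "1 \<in> Aut_Gamma" "monom 1 1 \<in> Odd"
    using monom_Odd[of 1] by simp_all
  then have "par_phi (monom 1 1) \<in> Aut_Gamma_par Odd" unfolding Aut_Gamma_par_def by blast
  moreover have "par_phi (monom 1 1) \<notin> Aut_Gamma" using par_phi_Aut_Gamma[of "monom 1 1"] by auto
  ultimately have 1: "AutT 1 \<noteq> AutT 2" unfolding AutT_eq using app_inj by (metis inj_image_eq_iff)
  show "height = 2"
    unfolding height_def
  proof (rule Least_equality)
    show "AutT 2 = AutT (Suc 2)" using \<open>AutT 3 = AutT 2\<close> by (simp add: numeral_3_eq_3)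
    fix y assume y: "AutT y = AutT (Suc y)"
    have "y \<noteq> 0" "y \<noteq> 1" using 0 1 y by (auto simp: numeral_2_eq_2 simp del: AutT.simps)
    then show "2 \<le> y" by simp
  qed
qed

end
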